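(* For $\alpha\in\mathbb{Z}$ put $$\nu_\alpha(\lambda)=\frac{q^{-\lambda-1}(q^{-\alpha}-1)+q^{\lambda+1}(q^\alpha-1)}{q-q^{-1}}\in F .$$ Then for all $\alpha,\beta\in\mathbb{Z}$, $$\mathcal{A}^x_{\alpha\beta}=\{a\in\mathcal{A}_K\ |\ Y(\mu)\cdot a=\nu_\beta(\mu)a,\quad a\cdot Y(\lambda)=\nu_\alpha(\lambda)a\},$$ where $Y(\lambda)=fk-ek+\left(\frac{q^{-\lambda-1}+q^{\lambda+1}}{q-q^{-1}}\right)(k^2-1)$ and $\mathcal{A}^x_{\alpha\beta}=x^{-1}(\mu)\cdot\mathcal{A}_K[\alpha,\beta]\cdot x(\lambda)$ for the element $x(\lambda)$ given in the context.
   Context: $q\in\mathbb{C}^*$ is not a root of unity, $q^{1/2}$ is a fixed square root, and $q^{\lambda}$ is the entire function $e^{\lambda\log q}$ for a fixed choice of logarithm (compatible with $q^{1/2}$). $F$ is the field of meromorphic functions on $\mathbb{C}$, $K=F\otimes_{\mathbb{C}}F$; elements of $K$ are written $f(\lambda,\mu)$, with $f(\lambda)=f\otimes1$, $f(\mu)=1\otimes f$, $F_1=F\otimes1$. $\mathcal{U}=\mathcal{U}_q(\mathfrak{sl}(2))$ is the unital associative $\mathbb{C}$-algebra with generators $k^{\pm1},e,f$ and relations $kk^{-1}=k^{-1}k=1$, $ke=qek$, $kf=q^{-1}fk$, $ef-fe=\frac{k^2-k^{-2}}{q-q^{-1}}$. It is a Hopf algebra with $\Delta_{\mathcal{U}}(k^{\pm1})=k^{\pm1}\otimes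 k^{\pm1}$, $\Delta_{\mathcal{U}}(e)=k\otimes e+e\otimes k^{-1}$, $\Delta_{\mathcal{U}}(f)=k\otimes f+f\otimes k^{-1}$, counit $\epsilon_{\mathcal{U}}(k^{\pm1})=1$, $\epsilon_{\mathcal{U}}(e)=\epsilon_{\mathcal{U}}(f)=0$, antipode $S_{\mathcal{U}}(k^{\pm1})=k^{\mp1}$, $S_{\mathcal{U}}(e)=-q^{-1}e$, $S_{\mathcal{U}}(f)=-qf$. $\mathcal{A}=\mathcal{A}_q[\mathrm{SL}(2)]$ is the Hopf subalgebra of the Hopf dual of $\mathcal{U}$ spanned by the matrix coefficients of the finite dimensional type 1 representations of $\mathcal{U}$ (those on which $k$ acts semisimply with eigenvalues in $\{q^{n/2}:n\in\mathbb{Z}\}$). $\mathcal{U}$ acts on $\mathcal{A}$ by the left and right regular actions $(u\cdot a\cdot u')(v)=a(u'vu)$ ($u,u',v\in\mathcal{U}$, $a\in\mathcal{A}$). Put $\mathcal{A}[\alpha,\beta]=\{a\in\mathcal{A}: k\cdot a=q^{\beta/2}a,\ a\cdot k=q^{\alpha/2}a\}$ for $\alpha,\beta\in\mathbb{Z}$; then $\mathcal{A}=\bigoplus_{\alpha,\beta\in\mathbb{Z}}\mathcal{A}[\alpha,\beta]$. $\mathcal{A}_K=K\otimes\mathcal{A}$, $\mathcal{A}_K[\alpha,\beta]=K\otimes\mathcal{A}[\alpha,\beta]$, $\mathcal{U}_K=K\otimes\mathcal{U}$, and the regular actions are extended $K$-linearly. With $(a;q)_m=\prod_{j=0}^{m-1}(1-aq^j)$,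 let $$x(\lambda)=\sum_{l,m=0}^{\infty}\frac{(-q^{-\lambda})^{l+m}}{(q^{-2\lambda};q^2)_l}\,\frac{q^{l^2-l+2lm-2m}(1-q^2)^{l+m}}{(q^2;q^2)_l(q^2;q^2)_m}\,(fk^{-1})^l(ek^{-1})^m .$$ This is interpreted through its left or right regular action on $\mathcal{A}_K$; since $e$ and $f$ act locally nilpotently on $\mathcal{A}_K$, the sums are finite on each element. It is known that the resulting operators $a\mapsto x(\lambda)\cdot a$ and $a\mapsto a\cdot x(\lambda)$ in $\mathrm{End}_K(\mathcal{A}_K)$ are invertible; $x^{-1}(\lambda)$ denotes the inverse element. $x(\mu)$, $Y(\mu)$ denote the same expressions with $\lambda$ replaced by $\mu$. *)

theory Defs
  imports
    "HOL-Complex_Analysis.Meromorphic"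
    "HOL-Library.Function_Algebras"
    "HOL-Library.Poly_Mapping"
    "HOL-Library.Groups_Big_Fun"
    "HOL-Algebra.QuotRing"
    "Jordan_Normal_Form.Char_Poly"
begin

section \<open>Complex vector spaces and algebras\<close>

class complex_vector = ab_group_add +
  fixes scaleC :: "complex \<Rightarrow> 'a \<Rightarrow> 'a"  (infixr \<open>*\<^sub>C\<close> 75)
  assumes scaleC_add_right: "c *\<^sub>C (x + y) = c *\<^sub>C x + c *\<^sub>C y"
    and scaleC_add_left: "(c + d) *\<^sub>C x = c *\<^sub>C x + d *\<^sub>C x"
    and scaleC_scaleC: "c *\<^sub>C (d *\<^sub>C x) = (c * d) *\<^sub>C x"
    and scaleC_one: "1 *\<^sub>C x = x"

class complex_algebra_1 = complex_vector + ring_1 +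
  assumes mult_scaleC_left: "(c *\<^sub>C x) * y = c *\<^sub>C (x * y)"
    and mult_scaleC_right: "x * (c *\<^sub>C y) = c *\<^sub>C (x * y)"

class complex_comm_algebra_1 = complex_algebra_1 + comm_ring_1

global_interpretation cvs: vector_space "scaleC :: complex \<Rightarrow> 'a \<Rightarrow> 'a::complex_vector"
  by unfold_locales
    (simp_all add: scaleC_add_right scaleC_add_left scaleC_scaleC scaleC_one)

global_interpretation cvs: vector_space_pair
  "scaleC :: complex \<Rightarrow> 'a \<Rightarrow> 'a::complex_vector" "scaleC :: complex \<Rightarrow> 'b \<Rightarrow> 'b::complex_vector"
  by unfold_locales

abbreviation clinear :: "('a::complex_vector \<Rightarrow> 'b::complex_vector) \<Rightarrow> bool" where
  "clinear \<equiv> Vector_Spaces.linear (*\<^sub>C) (*\<^sub>C)"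

lemma clinear_iff:
  "clinear f \<longleftrightarrow> (\<forall>x y. f (x + y) = f x + f y) \<and> (\<forall>c x. f (c *\<^sub>C x) = c *\<^sub>C f x)"
  by (simp add: module_hom_iff_linear[symmetric] module_hom_iff cvs.module_axioms)

instantiation complex :: complex_comm_algebra_1
begin
definition scaleC_complex :: "complex \<Rightarrow> complex \<Rightarrow> complex" where "scaleC_complex = (*)"
instance by standard (simp_all add: scaleC_complex_def algebra_simps)
end

instantiation "fun" :: (type, complex_vector) complex_vector
begin
definition scaleC_fun :: "complex \<Rightarrow> ('a \<Rightarrow> 'b) \<Rightarrow> 'a \<Rightarrow> 'b" where
  "scaleC_fun c f = (\<lambda>x. c *\<^sub>C f x)"
instance
  by standard (simp_all add: scaleC_fun_def fun_eq_iff scaleC_add_right scaleC_add_left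
      scaleC_scaleC scaleC_one)
end

instantiation poly_mapping :: (type, complex_vector) complex_vector
begin
definition scaleC_poly_mapping :: "complex \<Rightarrow> ('a \<Rightarrow>\<^sub>0 'b) \<Rightarrow> 'a \<Rightarrow>\<^sub>0 'b" where
  "scaleC_poly_mapping c = Poly_Mapping.map ((*\<^sub>C) c)"

lemma lookup_scaleC: "Poly_Mapping.lookup (c *\<^sub>C p) k = c *\<^sub>C Poly_Mapping.lookup (p :: 'a \<Rightarrow>\<^sub>0 'b) k"
  unfolding scaleC_poly_mapping_def by transfer (auto simp: when_def)

instance
  by standard (simp_all add: poly_mapping_eq_iff fun_eq_iff lookup_scaleC lookup_add
      scaleC_add_right scaleC_add_left scaleC_scaleC scaleC_one)
end

lemma scaleC_single: "c *\<^sub>C Poly_Mapping.single k x = Poly_Mapping.single k (c *\<^sub>C x)"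
  by (auto simp: poly_mapping_eq_iff fun_eq_iff lookup_scaleC lookup_single when_def)

lemma poly_mapping_decomp:
  "p = (\<Sum>x\<in>Poly_Mapping.keys p. Poly_Mapping.single x (Poly_Mapping.lookup p x))"
proof (rule poly_mapping_eqI)
  fix k
  have "(\<Sum>x\<in>Poly_Mapping.keys p. Poly_Mapping.lookup (Poly_Mapping.single x (Poly_Mapping.lookup p x)) k) =
      (\<Sum>x\<in>Poly_Mapping.keys p. if k = x then Poly_Mapping.lookup p k else 0)"
    by (rule sum.cong) (auto simp: lookup_single when_def)
  then show "Poly_Mapping.lookup p k = Poly_Mapping.lookup
      (\<Sum>x\<in>Poly_Mapping.keys p. Poly_Mapping.single x (Poly_Mapping.lookup p x)) k"
    by (simp add: lookup_sum in_keys_iff)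
qed

instance poly_mapping :: (monoid_add, complex_algebra_1) complex_algebra_1
proof
  have *: "c *\<^sub>C p = Poly_Mapping.single 0 (c *\<^sub>C 1) * p" for c and p :: "'a \<Rightarrow>\<^sub>0 'b"
  proof -
    have "(*\<^sub>C) c = (*) (c *\<^sub>C (1::'b))" by (simp add: fun_eq_iff mult_scaleC_left)
    then show ?thesis using mult_map_scale_conv_mult[of "c *\<^sub>C 1" p]
      by (simp only: scaleC_poly_mapping_def)
  qed
  show "(c *\<^sub>C x) * y = c *\<^sub>C (x * y)" for c and x y :: "'a \<Rightarrow>\<^sub>0 'b"
    by (simp only: * mult.assoc)
  have comm: "Poly_Mapping.single 0 (c *\<^sub>C 1) * p = p * Poly_Mapping.single 0 (c *\<^sub>C 1)"
    for c and p :: "'a \<Rightarrow>\<^sub>0 'b"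
  proof -
    let ?q = "\<Sum>x\<in>Poly_Mapping.keys p. Poly_Mapping.single x (Poly_Mapping.lookup p x)"
    have "Poly_Mapping.single 0 (c *\<^sub>C 1) * ?q = ?q * Poly_Mapping.single 0 (c *\<^sub>C 1)"
      by (simp add: sum_distrib_left sum_distrib_right mult_single mult_scaleC_left mult_scaleC_right)
    then show ?thesis by (simp only: poly_mapping_decomp[symmetric])
  qed
  show "x * (c *\<^sub>C y) = c *\<^sub>C (x * y)" for c and x y :: "'a \<Rightarrow>\<^sub>0 'b"
    by (simp only: * comm mult.assoc)
qed


section \<open>The tensor product over the complex numbers\<close>

text \<open>The free vector space on pairs, modulo the usual bilinearity relations.\<close>

abbreviation free_pair :: "'a \<Rightarrow> 'b \<Rightarrow> ('a \<times> 'b) \<Rightarrow>\<^sub>0 complex" where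
  "free_pair a b \<equiv> Poly_Mapping.single (a, b) 1"

definition tensor_relations :: "(('a::complex_vector \<times> 'b::complex_vector) \<Rightarrow>\<^sub>0 complex) set" where
  "tensor_relations =
     {free_pair (a + a') b - free_pair a b - free_pair a' b | a a' b. True} \<union>
     {free_pair a (b + b') - free_pair a b - free_pair a b' | a b b'. True} \<union>
     {free_pair (c *\<^sub>C a) b - c *\<^sub>C free_pair a b | c a b. True} \<union>
     {free_pair a (c *\<^sub>C b) - c *\<^sub>C free_pair a b | c a b. True}"

definition tensor_eq ::
  "(('a::complex_vector \<times> 'b::complex_vector) \<Rightarrow>\<^sub>0 complex) \<Rightarrow> (('a \<times> 'b) \<Rightarrow>\<^sub>0 complex) \<Rightarrow> bool" where
  "tensor_eq x y \<longleftrightarrow> x - y \<in> cvs.span tensor_relations"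

quotient_type (overloaded) ('a, 'b) tensor =
  "('a::complex_vector \<times> 'b::complex_vector) \<Rightarrow>\<^sub>0 complex" / tensor_eq
proof (rule equivpI)
  show "reflp tensor_eq" by (simp add: reflp_def tensor_eq_def cvs.span_zero)
  show "symp tensor_eq"
    unfolding symp_def tensor_eq_def using cvs.span_neg by fastforce
  show "transp tensor_eq"
    unfolding transp_def tensor_eq_def using cvs.span_add by fastforce
qed

instantiation tensor :: (complex_vector, complex_vector) complex_vector
begin

lift_definition zero_tensor :: "('a, 'b) tensor" is 0 .

lift_definition plus_tensor :: "('a, 'b) tensor \<Rightarrow> ('a, 'b) tensor \<Rightarrow> ('a, 'b) tensor" is "(+)"
  unfolding tensor_eq_def by (drule (1) cvs.span_add) (simp add: algebra_simps)

lift_definition uminus_tensor :: "('a, 'b) tensor \<Rightarrow> ('a, 'b) tensor" is uminus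
  unfolding tensor_eq_def by (drule cvs.span_neg) simp

lift_definition minus_tensor :: "('a, 'b) tensor \<Rightarrow> ('a, 'b) tensor \<Rightarrow> ('a, 'b) tensor" is "(-)"
  unfolding tensor_eq_def by (drule (1) cvs.span_diff) (simp add: algebra_simps)

lift_definition scaleC_tensor :: "complex \<Rightarrow> ('a, 'b) tensor \<Rightarrow> ('a, 'b) tensor" is "(*\<^sub>C)"
  unfolding tensor_eq_def by (drule cvs.span_scale) (simp add: cvs.scale_right_diff_distrib)

instance
proof
  have eqI: "tensor_eq u v" if "u = v" for u v :: "('a \<times> 'b) \<Rightarrow>\<^sub>0 complex"
    using that by (simp add: tensor_eq_def cvs.span_zero)
  fix x y z :: "('a, 'b) tensor" and c d :: complex
  show "x + y + z = x + (y + z)" "x + y = y + x" "0 + x = x" "- x + x = 0" "x - y = x + - y"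
    by (transfer; rule eqI; simp)+
  show "c *\<^sub>C (x + y) = c *\<^sub>C x + c *\<^sub>C y" by (transfer; rule eqI; rule scaleC_add_right)
  show "(c + d) *\<^sub>C x = c *\<^sub>C x + d *\<^sub>C x" by (transfer; rule eqI; rule scaleC_add_left)
  show "c *\<^sub>C d *\<^sub>C x = (c * d) *\<^sub>C x" by (transfer; rule eqI; rule scaleC_scaleC)
  show "1 *\<^sub>C x = x" by (transfer; rule eqI; rule scaleC_one)
qed

end

lift_definition tensor :: "'a \<Rightarrow> 'b \<Rightarrow> ('a::complex_vector, 'b::complex_vector) tensor"
  (infixr \<open>\<otimes>\<^sub>C\<close> 72) is free_pair .

definition cbilinear :: "('a::complex_vector \<Rightarrow> 'b::complex_vector \<Rightarrow> 'c::complex_vector) \<Rightarrow> bool" where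
  "cbilinear B \<longleftrightarrow> (\<forall>a. clinear (B a)) \<and> (\<forall>b. clinear (\<lambda>a. B a b))"

definition free_extend :: "('x \<Rightarrow> 'c::complex_vector) \<Rightarrow> ('x \<Rightarrow>\<^sub>0 complex) \<Rightarrow> 'c" where
  "free_extend g p = (\<Sum>x\<in>Poly_Mapping.keys p. Poly_Mapping.lookup p x *\<^sub>C g x)"

lemma free_extend_superset:
  assumes "finite S" "Poly_Mapping.keys p \<subseteq> S"
  shows "free_extend g p = (\<Sum>x\<in>S. Poly_Mapping.lookup p x *\<^sub>C g x)"
  unfolding free_extend_def
  by (rule sum.mono_neutral_left) (use assms in \<open>auto simp: in_keys_iff\<close>)

lemma clinear_free_extend: "clinear (free_extend g)"
  unfolding clinear_iff
proof safe
  fix p r :: "'a \<Rightarrow>\<^sub>0 complex" and c :: complex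
  let ?S = "Poly_Mapping.keys p \<union> Poly_Mapping.keys r"
  have "free_extend g (p + r) = (\<Sum>x\<in>?S. Poly_Mapping.lookup (p + r) x *\<^sub>C g x)"
    by (rule free_extend_superset) (auto dest: set_mp[OF keys_add])
  also have "\<dots> = free_extend g p + free_extend g r"
    by (simp add: free_extend_superset[where S = ?S] lookup_add scaleC_add_left sum.distrib)
  finally show "free_extend g (p + r) = free_extend g p + free_extend g r" .
  have "free_extend g (c *\<^sub>C p) =
      (\<Sum>x\<in>Poly_Mapping.keys p. Poly_Mapping.lookup (c *\<^sub>C p) x *\<^sub>C g x)"
    by (rule free_extend_superset) (auto simp: in_keys_iff lookup_scaleC)
  then show "free_extend g (c *\<^sub>C p) = c *\<^sub>C free_extend g p"
    by (simp add: free_extend_def lookup_scaleC scaleC_complex_def cvs.scale_sum_right scaleC_scaleC)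
qed

lemma free_extend_single: "free_extend g (Poly_Mapping.single x c) = c *\<^sub>C g x"
  by (simp add: free_extend_superset[where S = "{x}"])

lemma free_extend_relations:
  assumes "cbilinear B" "z \<in> cvs.span tensor_relations"
  shows "free_extend (\<lambda>(a, b). B a b) z = 0"
proof -
  interpret L: Vector_Spaces.linear "(*\<^sub>C)" "(*\<^sub>C)" "free_extend (\<lambda>(a, b). B a b)"
    by (rule clinear_free_extend)
  have B: "B (x + y) b = B x b + B y b" "B a (u + v) = B a u + B a v"
    "B (c *\<^sub>C x) b = c *\<^sub>C B x b" "B a (c *\<^sub>C u) = c *\<^sub>C B a u" for x y a b u v c
    using assms(1) unfolding cbilinear_def clinear_iff by simp_all
  show ?thesis
    using assms(2)
  proof (induction rule: cvs.span_induct)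
    case base
    show ?case unfolding cvs.subspace_def by (simp add: L.add L.scale L.zero)
  next
    case (step x)
    then show ?case
      unfolding tensor_relations_def
      by (auto simp: L.diff L.scale free_extend_single B scaleC_one)
  qed
qed

text \<open>The linear map on the tensor product induced by a bilinear map, and zero if the map is not bilinear.\<close>

lift_definition tensor_lift ::
  "('a::complex_vector \<Rightarrow> 'b::complex_vector \<Rightarrow> 'c::complex_vector) \<Rightarrow> ('a, 'b) tensor \<Rightarrow> 'c"
  is "\<lambda>B p. if cbilinear B then free_extend (\<lambda>(a, b). B a b) p else 0"
proof -
  fix B :: "'a \<Rightarrow> 'b \<Rightarrow> 'c" and x y :: "('a \<times> 'b) \<Rightarrow>\<^sub>0 complex"
  interpret L: Vector_Spaces.linear "(*\<^sub>C)" "(*\<^sub>C)" "free_extend (\<lambda>(a, b). B a b)"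
    by (rule clinear_free_extend)
  assume "tensor_eq x y"
  then show "(if cbilinear B then free_extend (\<lambda>(a, b). B a b) x else 0) =
    (if cbilinear B then free_extend (\<lambda>(a, b). B a b) y else 0)"
    using free_extend_relations[of B "x - y"] by (auto simp: tensor_eq_def L.diff)
qed

lemma tensor_lift_tensor [simp]: "cbilinear B \<Longrightarrow> tensor_lift B (a \<otimes>\<^sub>C b) = B a b"
  by transfer (simp add: free_extend_single scaleC_one)

lemma clinear_tensor_lift: "clinear (tensor_lift B)"
  unfolding clinear_iff
  by (safe; transfer)
    (simp_all add: cvs.linear_add[OF clinear_free_extend] cvs.linear_scale[OF clinear_free_extend])

lemma cbilinear_tensor: "cbilinear (\<otimes>\<^sub>C)"
  unfolding cbilinear_def clinear_iff
proof (safe; transfer)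
  fix a a' :: 'a and b b' :: 'b and c
  show "tensor_eq (free_pair a (b + b')) (free_pair a b + free_pair a b')"
    "tensor_eq (free_pair (a + a') b) (free_pair a b + free_pair a' b)"
    "tensor_eq (free_pair a (c *\<^sub>C b)) (c *\<^sub>C free_pair a b)"
    "tensor_eq (free_pair (c *\<^sub>C a) b) (c *\<^sub>C free_pair a b)"
    unfolding tensor_eq_def
    by (rule cvs.span_base; fastforce simp: tensor_relations_def diff_diff_eq[symmetric])+
qed

lemma tensor_bil:
  fixes a a' :: "'a::complex_vector" and b b' :: "'b::complex_vector"
  shows "(a + a') \<otimes>\<^sub>C b = a \<otimes>\<^sub>C b + a' \<otimes>\<^sub>C b" "a \<otimes>\<^sub>C (b + b') = a \<otimes>\<^sub>C b + a \<otimes>\<^sub>C b'"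
    "(c *\<^sub>C a) \<otimes>\<^sub>C b = c *\<^sub>C (a \<otimes>\<^sub>C b)" "a \<otimes>\<^sub>C (c *\<^sub>C b) = c *\<^sub>C (a \<otimes>\<^sub>C b)"
  using cbilinear_tensor[where ?'a = 'a and ?'b = 'b] unfolding cbilinear_def clinear_iff by auto

lemma tensor_induct [case_names tensor add]:
  assumes t: "\<And>a b. P (a \<otimes>\<^sub>C b)" and a: "\<And>x y. P x \<Longrightarrow> P y \<Longrightarrow> P (x + y)"
  shows "P x"
proof -
  have *: "P (abs_tensor p)" if "finite S" "Poly_Mapping.keys p = S" for p S
    using that
  proof (induction S arbitrary: p rule: finite_induct)
    case empty
    then have "abs_tensor p = 0" by (simp add: zero_tensor.abs_eq)
    then show ?case using t[of 0 0] tensor_bil(3)[of 0 "0::'a" "0::'b"] by simp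
  next
    case (insert z S)
    obtain u v where z: "z = (u, v)" by (cases z)
    let ?c = "Poly_Mapping.lookup p z"
    let ?r = "p - ?c *\<^sub>C free_pair u v"
    have "Poly_Mapping.keys ?r = S"
      using insert.hyps insert.prems z
      by (auto simp: set_eq_iff in_keys_iff lookup_minus lookup_scaleC lookup_single when_def
          scaleC_complex_def)
    then have "P (abs_tensor ?r)" by (rule insert.IH)
    moreover have "P (abs_tensor (?c *\<^sub>C free_pair u v))"
    proof -
      have "abs_tensor (?c *\<^sub>C free_pair u v) = ?c *\<^sub>C (u \<otimes>\<^sub>C v)"
        by (simp only: tensor.abs_eq scaleC_tensor.abs_eq)
      then show ?thesis using t[of "?c *\<^sub>C u" v] by (simp only: tensor_bil(3))
    qed
    ultimately have "P (abs_tensor ?r + abs_tensor (?c *\<^sub>C free_pair u v))" by (rule a)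
    then show ?case by (simp add: plus_tensor.abs_eq)
  qed
  obtain p where "x = abs_tensor p" by (metis Quotient3_tensor Quotient3_abs_rep)
  then show ?thesis using *[of "Poly_Mapping.keys p" p] by simp
qed

lemma ex_clinear_functional_one: "\<exists>f :: 'a::complex_algebra_1 \<Rightarrow> complex. clinear f \<and> f 1 = 1"
proof -
  have "cvs.independent {1::'a}" by (simp add: cvs.dependent_single)
  from cvs.linear_independent_extend[OF this, of "\<lambda>_. 1::complex"] show ?thesis by auto
qed

instantiation tensor :: (complex_algebra_1, complex_algebra_1) complex_algebra_1
begin

definition one_tensor :: "('a, 'b) tensor" where "one_tensor = 1 \<otimes>\<^sub>C 1"

definition times_tensor :: "('a, 'b) tensor \<Rightarrow> ('a, 'b) tensor \<Rightarrow> ('a, 'b) tensor" where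
  "times_tensor x y =
     tensor_lift (\<lambda>a b. tensor_lift (\<lambda>a' b'. (a * a') \<otimes>\<^sub>C (b * b')) y) x"

lemma times_tensor_bil1:
  fixes a :: 'a and b :: 'b
  shows "cbilinear (\<lambda>a' b'. (a * a') \<otimes>\<^sub>C (b * b'))"
  unfolding cbilinear_def clinear_iff
  by (simp add: distrib_left mult_scaleC_right tensor_bil)

lemma times_tensor_pure:
  fixes a u :: 'a and b v :: 'b
  shows "tensor_lift (\<lambda>a' b'. (a * a') \<otimes>\<^sub>C (b * b')) (u \<otimes>\<^sub>C v) = (a * u) \<otimes>\<^sub>C (b * v)"
  by (rule tensor_lift_tensor[OF times_tensor_bil1])

lemma times_tensor_bil2:
  fixes y :: "('a, 'b) tensor"
  shows "cbilinear (\<lambda>a b. tensor_lift (\<lambda>a' b'. (a * a') \<otimes>\<^sub>C (b * b')) y)"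
proof (induction y rule: tensor_induct)
  case (tensor u v)
  show ?case
    unfolding times_tensor_pure cbilinear_def clinear_iff
    by (simp add: distrib_right mult_scaleC_left tensor_bil)
next
  case (add x y)
  then show ?case
    unfolding cvs.linear_add[OF clinear_tensor_lift] cbilinear_def clinear_iff
    by (simp only: scaleC_add_right) (simp add: add.assoc add.left_commute)
qed

lemma tensor_times: "(a \<otimes>\<^sub>C b) * y = tensor_lift (\<lambda>a' b'. (a * a') \<otimes>\<^sub>C (b * b')) y"
  for a :: 'a and b :: 'b
  unfolding times_tensor_def by (rule tensor_lift_tensor[OF times_tensor_bil2])

lemma tensor_times_tensor: "(a \<otimes>\<^sub>C b) * (a' \<otimes>\<^sub>C b') = (a * a') \<otimes>\<^sub>C (b * b')"
  for a a' :: 'a and b b' :: 'b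
  unfolding tensor_times times_tensor_pure ..

lemma times_tensor_add_scale:
  fixes x y z :: "('a, 'b) tensor"
  shows "(x + y) * z = x * z + y * z" "x * (y + z) = x * y + x * z"
    "(c *\<^sub>C x) * y = c *\<^sub>C (x * y)" "x * (c *\<^sub>C y) = c *\<^sub>C (x * y)"
proof -
  show 1: "(x + y) * z = x * z + y * z" for x y z :: "('a, 'b) tensor"
    unfolding times_tensor_def by (rule cvs.linear_add[OF clinear_tensor_lift])
  show "(c *\<^sub>C x) * y = c *\<^sub>C (x * y)"
    unfolding times_tensor_def by (rule cvs.linear_scale[OF clinear_tensor_lift])
  show "x * (y + z) = x * y + x * z"
  proof (induction x rule: tensor_induct)
    case (tensor a b)
    show ?case unfolding tensor_times by (rule cvs.linear_add[OF clinear_tensor_lift])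
  qed (simp add: 1 algebra_simps)
  show "x * (c *\<^sub>C y) = c *\<^sub>C (x * y)"
  proof (induction x rule: tensor_induct)
    case (tensor a b)
    show ?case unfolding tensor_times by (rule cvs.linear_scale[OF clinear_tensor_lift])
  qed (simp add: 1 scaleC_add_right)
qed

instance
proof
  fix x y z :: "('a, 'b) tensor" and c :: complex
  show "(x * y) * z = x * (y * z)"
  proof (induction x rule: tensor_induct)
    case (tensor a b)
    show ?case
    proof (induction y rule: tensor_induct)
      case (tensor a' b')
      show ?case
        by (induction z rule: tensor_induct)
          (simp_all add: tensor_times_tensor times_tensor_add_scale mult.assoc)
    qed (simp add: times_tensor_add_scale)
  qed (simp add: times_tensor_add_scale)
  show "1 * x = x" "x * 1 = x"
    by (induction x rule: tensor_induct)
      (simp_all add: one_tensor_def tensor_times_tensor times_tensor_add_scale)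
  show "(0 :: ('a, 'b) tensor) \<noteq> 1"
  proof -
    obtain f :: "'a \<Rightarrow> complex" and g :: "'b \<Rightarrow> complex"
      where fg: "clinear f" "f 1 = 1" "clinear g" "g 1 = 1"
      using ex_clinear_functional_one by metis
    have "cbilinear (\<lambda>a b. f a * g b)"
      using fg(1,3) unfolding cbilinear_def clinear_iff
      by (simp add: algebra_simps scaleC_complex_def)
    then have "tensor_lift (\<lambda>a b. f a * g b) (1 :: ('a, 'b) tensor) = 1"
      by (simp add: one_tensor_def fg)
    moreover have "tensor_lift (\<lambda>a b. f a * g b) (0 :: ('a, 'b) tensor) = 0"
      by (rule cvs.linear_0[OF clinear_tensor_lift])
    ultimately show ?thesis by (metis zero_neq_one)
  qed
qed (rule times_tensor_add_scale)+

end

instance tensor :: (complex_comm_algebra_1, complex_comm_algebra_1) complex_comm_algebra_1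
proof
  fix x y :: "('a, 'b) tensor"
  show "x * y = y * x"
  proof (induction x rule: tensor_induct)
    case (tensor a b)
    show ?case
      by (induction y rule: tensor_induct)
        (simp_all add: tensor_times_tensor times_tensor_add_scale mult.commute)
  qed (simp add: times_tensor_add_scale)
qed (simp_all add: distrib_right)


section \<open>The field of meromorphic functions\<close>

text \<open>Two meromorphic functions are identified if they agree off a discrete set.\<close>

definition mero_eq :: "(complex \<Rightarrow> complex) \<Rightarrow> (complex \<Rightarrow> complex) \<Rightarrow> bool" where
  "mero_eq f g \<longleftrightarrow> f meromorphic_on UNIV \<and> g meromorphic_on UNIV \<and> (\<forall>\<^sub>\<approx>z\<in>UNIV. f z = g z)"

quotient_type mero = "complex \<Rightarrow> complex" / partial: mero_eq
  morphisms rep_mero Mero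
proof (rule part_equivpI)
  show "\<exists>f. mero_eq f f" by (rule exI[of _ "\<lambda>_. 0"]) (simp add: mero_eq_def meromorphic_on_const)
  show "symp mero_eq" by (auto simp: symp_def mero_eq_def elim: eventually_mono)
  show "transp mero_eq" by (auto simp: transp_def mero_eq_def elim: eventually_elim2)
qed

instantiation mero :: field
begin

lift_definition zero_mero :: mero is "\<lambda>_. 0" by (simp add: mero_eq_def meromorphic_on_const)
lift_definition one_mero :: mero is "\<lambda>_. 1" by (simp add: mero_eq_def meromorphic_on_const)
lift_definition plus_mero :: "mero \<Rightarrow> mero \<Rightarrow> mero" is "\<lambda>f g z. f z + g z"
  by (auto simp: mero_eq_def intro!: meromorphic_intros elim: eventually_elim2)
lift_definition minus_mero :: "mero \<Rightarrow> mero \<Rightarrow> mero" is "\<lambda>f g z. f z - g z"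
  by (auto simp: mero_eq_def intro!: meromorphic_intros elim: eventually_elim2)
lift_definition uminus_mero :: "mero \<Rightarrow> mero" is "\<lambda>f z. - f z"
  by (auto simp: mero_eq_def intro!: meromorphic_intros elim: eventually_mono)
lift_definition times_mero :: "mero \<Rightarrow> mero \<Rightarrow> mero" is "\<lambda>f g z. f z * g z"
  by (auto simp: mero_eq_def intro!: meromorphic_intros elim: eventually_elim2)
lift_definition inverse_mero :: "mero \<Rightarrow> mero" is "\<lambda>f z. inverse (f z)"
  by (auto simp: mero_eq_def intro!: meromorphic_intros elim: eventually_mono)
lift_definition divide_mero :: "mero \<Rightarrow> mero \<Rightarrow> mero" is "\<lambda>f g z. f z / g z"
  by (auto simp: mero_eq_def intro!: meromorphic_intros elim: eventually_elim2)

instance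
proof
  fix a b c :: mero
  show "a * b * c = a * (b * c)" "a * b = b * a" "1 * a = a" "a + b + c = a + (b + c)"
    "a + b = b + a" "0 + a = a" "- a + a = 0" "a - b = a + - b" "(a + b) * c = a * c + b * c"
    "a div b = a * inverse b"
    by (transfer; auto simp: mero_eq_def algebra_simps divide_inverse intro!: meromorphic_intros)+
  show "inverse (0::mero) = 0" by transfer (simp add: mero_eq_def meromorphic_on_const)
  show "(0::mero) \<noteq> 1" by transfer (simp add: mero_eq_def)
  show "a \<noteq> 0 \<Longrightarrow> inverse a * a = 1"
  proof transfer
    fix f assume f: "mero_eq f f" and nz: "\<not> mero_eq f (\<lambda>_. 0)"
    have m: "f meromorphic_on UNIV" using f by (simp add: mero_eq_def)
    have "\<forall>\<^sub>\<approx>z\<in>UNIV. f z \<noteq> 0"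
      using meromorphic_imp_constant_or_avoid[OF m, of 0] nz m by (auto simp: mero_eq_def)
    then show "mero_eq (\<lambda>z. inverse (f z) * f z) (\<lambda>_. 1)"
      using m by (auto simp: mero_eq_def intro!: meromorphic_intros elim: eventually_mono)
  qed
qed

end

instantiation mero :: complex_comm_algebra_1
begin

lift_definition scaleC_mero :: "complex \<Rightarrow> mero \<Rightarrow> mero" is "\<lambda>c f z. c * f z"
  by (auto simp: mero_eq_def intro!: meromorphic_intros elim: eventually_mono)

instance
  by (standard; transfer; auto simp: mero_eq_def algebra_simps intro!: meromorphic_intros)

end


section \<open>The quantized enveloping algebra\<close>

datatype gen = Gk | Gk_inv | Ge | Gf

datatype word = Word (letters: "gen list")

instantiation word :: monoid_add
begin
definition zero_word :: word where "zero_word = Word []"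
definition plus_word :: "word \<Rightarrow> word \<Rightarrow> word" where
  "plus_word u v = Word (letters u @ letters v)"

instance by standard (simp_all add: zero_word_def plus_word_def)
end

text \<open>
  The free algebra on the four generators is the monoid algebra of the free monoid of words
  (with the product of \<^typ>\<open>word \<Rightarrow>\<^sub>0 complex\<close> being convolution).
\<close>

type_synonym free_alg = "word \<Rightarrow>\<^sub>0 complex"

definition gen :: "gen \<Rightarrow> free_alg" where "gen g = Poly_Mapping.single (Word [g]) 1"

abbreviation "gk \<equiv> gen Gk"
abbreviation "gk_inv \<equiv> gen Gk_inv"
abbreviation "ge \<equiv> gen Ge"
abbreviation "gf \<equiv> gen Gf"

definition free_ring :: "free_alg ring" where
  "free_ring = \<lparr>carrier = UNIV, mult = (*), one = 1, zero = 0, add = (+)\<rparr>"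

definition Uq_relations :: "complex \<Rightarrow> free_alg set" where
  "Uq_relations q =
     {gk * gk_inv - 1, gk_inv * gk - 1,
      gk * ge - q *\<^sub>C (ge * gk), gk * gf - inverse q *\<^sub>C (gf * gk),
      ge * gf - gf * ge - (1 / (q - inverse q)) *\<^sub>C (gk ^ 2 - gk_inv ^ 2)}"

definition Uq_ideal :: "complex \<Rightarrow> free_alg set" where
  "Uq_ideal q = Idl\<^bsub>free_ring\<^esub> (Uq_relations q)"

definition Uq :: "complex \<Rightarrow> free_alg set ring" where
  "Uq q = free_ring Quot (Uq_ideal q)"

definition Uq_class :: "complex \<Rightarrow> free_alg \<Rightarrow> free_alg set" where
  "Uq_class q p = Uq_ideal q +>\<^bsub>free_ring\<^esub> p"


section \<open>The quantized function algebra\<close>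

text \<open>
  The scalar parameter of all that follows is a logarithm \<open>L\<close> of \<open>q = exp L\<close>; it determines
  \<open>q\<^sup>\<lambda> = qpow L \<lambda>\<close> and in particular the square root \<open>qpow L (1/2)\<close> of \<open>q\<close>.
\<close>

definition qpow :: "complex \<Rightarrow> complex \<Rightarrow> complex" where "qpow L z = exp (z * L)"

definition type1_rep :: "complex \<Rightarrow> nat \<Rightarrow> (free_alg set \<Rightarrow> complex mat) \<Rightarrow> bool" where
  "type1_rep L n \<rho> \<longleftrightarrow>
     \<rho> \<in> Ring.ring_hom (Uq (exp L)) (ring_mat TYPE(complex) n ()) \<and>
     (\<forall>c. \<rho> (Uq_class (exp L) (c *\<^sub>C 1)) = c \<cdot>\<^sub>m 1\<^sub>m n) \<and>
     (\<exists>D. diagonal_mat D \<and> similar_mat (\<rho> (Uq_class (exp L) gk)) D) \<and>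
     (\<forall>z. eigenvalue (\<rho> (Uq_class (exp L) gk)) z \<longrightarrow> (\<exists>m::int. z = qpow L (of_int m / 2)))"

text \<open>Functionals on \<open>Uq q\<close> are functions on cosets, set to zero outside the carrier.\<close>

type_synonym functional = "free_alg set \<Rightarrow> complex"

definition matrix_coeff ::
  "complex \<Rightarrow> (free_alg set \<Rightarrow> complex mat) \<Rightarrow> complex vec \<Rightarrow> complex vec \<Rightarrow> functional" where
  "matrix_coeff L \<rho> \<phi> v = (\<lambda>u. if u \<in> carrier (Uq (exp L)) then \<phi> \<bullet> (\<rho> u *\<^sub>v v) else 0)"

definition Aq :: "complex \<Rightarrow> functional set" where
  "Aq L = cvs.span {matrix_coeff L \<rho> \<phi> v | n \<rho> \<phi> v.
     type1_rep L n \<rho> \<and> \<phi> \<in> carrier_vec n \<and> v \<in> carrier_vec n}"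

definition lreg :: "complex \<Rightarrow> free_alg set \<Rightarrow> functional \<Rightarrow> functional" where
  "lreg L u a = (\<lambda>v. if v \<in> carrier (Uq (exp L)) then a (v \<otimes>\<^bsub>Uq (exp L)\<^esub> u) else 0)"

definition rreg :: "complex \<Rightarrow> functional \<Rightarrow> free_alg set \<Rightarrow> functional" where
  "rreg L a u = (\<lambda>v. if v \<in> carrier (Uq (exp L)) then a (u \<otimes>\<^bsub>Uq (exp L)\<^esub> v) else 0)"

definition Aq_weight :: "complex \<Rightarrow> int \<Rightarrow> int \<Rightarrow> functional set" where
  "Aq_weight L \<alpha> \<beta> = {a \<in> Aq L.
     lreg L (Uq_class (exp L) gk) a = qpow L (of_int \<beta> / 2) *\<^sub>C a \<and>
     rreg L a (Uq_class (exp L) gk) = qpow L (of_int \<alpha> / 2) *\<^sub>C a}"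


section \<open>Extension of scalars\<close>

type_synonym K = "(mero, mero) tensor"

definition lam :: "mero \<Rightarrow> K" where "lam f = f \<otimes>\<^sub>C 1"
definition mu :: "mero \<Rightarrow> K" where "mu f = 1 \<otimes>\<^sub>C f"

text \<open>
  For a subspace \<open>V\<close> of the space of functionals, \<open>K \<otimes> V\<close> is identified with the subspace of
  \<open>K \<otimes> functional\<close> spanned by the pure tensors with second factor in \<open>V\<close>.
\<close>

definition base_change :: "functional set \<Rightarrow> (K, functional) tensor set" where
  "base_change V = cvs.span {c \<otimes>\<^sub>C a | c a. a \<in> V}"

abbreviation AK :: "complex \<Rightarrow> (K, functional) tensor set" where
  "AK L \<equiv> base_change (Aq L)"

abbreviation AK_weight :: "complex \<Rightarrow> int \<Rightarrow> int \<Rightarrow> (K, functional) tensor set" where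
  "AK_weight L \<alpha> \<beta> \<equiv> base_change (Aq_weight L \<alpha> \<beta>)"

definition Kscale :: "K \<Rightarrow> (K, functional) tensor \<Rightarrow> (K, functional) tensor" where
  "Kscale c = tensor_lift (\<lambda>d a. (c * d) \<otimes>\<^sub>C a)"

text \<open>
  Elements of \<open>K \<otimes> Uq q\<close> are given by representatives in \<open>K \<otimes> free_alg\<close>. The actions are determined
  by \<open>(c \<otimes> p) \<cdot> (d \<otimes> a) = c d \<otimes> ([p] \<cdot> a)\<close> and \<open>(d \<otimes> a) \<cdot> (c \<otimes> p) = c d \<otimes> (a \<cdot> [p])\<close>, where \<open>[p]\<close> is the
  class of \<open>p\<close> in \<open>Uq q\<close>. They are meant for \<open>t \<in> AK L\<close>, whose second tensor factors are linear
  functionals, so that the expressions below are bilinear in \<open>c\<close> and \<open>p\<close>.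
\<close>

definition lact :: "complex \<Rightarrow> (K, free_alg) tensor \<Rightarrow> (K, functional) tensor \<Rightarrow> (K, functional) tensor" where
  "lact L y t = tensor_lift (\<lambda>c p. tensor_lift (\<lambda>d a.
     (c * d) \<otimes>\<^sub>C lreg L (Uq_class (exp L) p) a) t) y"

definition ract :: "complex \<Rightarrow> (K, functional) tensor \<Rightarrow> (K, free_alg) tensor \<Rightarrow> (K, functional) tensor" where
  "ract L t y = tensor_lift (\<lambda>c p. tensor_lift (\<lambda>d a.
     (c * d) \<otimes>\<^sub>C rreg L a (Uq_class (exp L) p)) t) y"


section \<open>The elements \<open>Y\<close> and \<open>x\<close>\<close>

text \<open>
  The argument \<open>\<iota>\<close> is \<^const>\<open>lam\<close> or \<^const>\<open>mu\<close> and selects the variable: \<open>Y L lam\<close> is \<open>Y(\<lambda>)\<close> and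
  \<open>Y L mu\<close> is \<open>Y(\<mu>)\<close>.
\<close>

definition nu :: "complex \<Rightarrow> int \<Rightarrow> mero" where
  "nu L \<alpha> = Mero (\<lambda>z.
     (qpow L (- z - 1) * (qpow L (- of_int \<alpha>) - 1) + qpow L (z + 1) * (qpow L (of_int \<alpha>) - 1))
     / (exp L - inverse (exp L)))"

definition Y_coeff :: "complex \<Rightarrow> mero" where
  "Y_coeff L = Mero (\<lambda>z. (qpow L (- z - 1) + qpow L (z + 1)) / (exp L - inverse (exp L)))"

definition Y :: "complex \<Rightarrow> (mero \<Rightarrow> K) \<Rightarrow> (K, free_alg) tensor" where
  "Y L \<iota> = 1 \<otimes>\<^sub>C (gf * gk) - 1 \<otimes>\<^sub>C (ge * gk) + \<iota> (Y_coeff L) \<otimes>\<^sub>C (gk ^ 2 - 1)"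

definition qpoch :: "complex \<Rightarrow> complex \<Rightarrow> nat \<Rightarrow> complex" where
  "qpoch a q m = (\<Prod>j<m. 1 - a * q ^ j)"

definition x_coeff :: "complex \<Rightarrow> nat \<Rightarrow> nat \<Rightarrow> mero" where
  "x_coeff L l m = (let q = exp L in Mero (\<lambda>z.
     (- qpow L (- z)) ^ (l + m) / qpoch (qpow L (- 2 * z)) (q ^ 2) l *
     (q powi (int l ^ 2 - int l + 2 * int l * int m - 2 * int m) * (1 - q ^ 2) ^ (l + m) /
       (qpoch (q ^ 2) (q ^ 2) l * qpoch (q ^ 2) (q ^ 2) m))))"

definition x_term :: "complex \<Rightarrow> (mero \<Rightarrow> K) \<Rightarrow> nat \<times> nat \<Rightarrow> (K, free_alg) tensor" where
  "x_term L \<iota> = (\<lambda>(l, m). \<iota> (x_coeff L l m) \<otimes>\<^sub>C ((gf * gk_inv) ^ l * (ge * gk_inv) ^ m))"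

text \<open>
  \<^const>\<open>Sum_any\<close> sums the nonzero summands; on \<^term>\<open>AK L\<close> there are finitely many of them, because
  \<open>e\<close> and \<open>f\<close> act locally nilpotently.
\<close>

definition x_left :: "complex \<Rightarrow> (mero \<Rightarrow> K) \<Rightarrow> (K, functional) tensor \<Rightarrow> (K, functional) tensor" where
  "x_left L \<iota> t = Sum_any (\<lambda>i. lact L (x_term L \<iota> i) t)"

definition x_right :: "complex \<Rightarrow> (K, functional) tensor \<Rightarrow> (mero \<Rightarrow> K) \<Rightarrow> (K, functional) tensor" where
  "x_right L t \<iota> = Sum_any (\<lambda>i. ract L t (x_term L \<iota> i))"

definition x_inv_left :: "complex \<Rightarrow> (mero \<Rightarrow> K) \<Rightarrow> (K, functional) tensor \<Rightarrow> (K, functional) tensor" where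
  "x_inv_left L \<iota> = inv_into (AK L) (x_left L \<iota>)"

definition Ax :: "complex \<Rightarrow> int \<Rightarrow> int \<Rightarrow> (K, functional) tensor set" where
  "Ax L \<alpha> \<beta> = {x_right L (x_inv_left L mu b) lam | b. b \<in> AK_weight L \<alpha> \<beta>}"

end

theory Submission
  imports Defs
begin

text \<open>
  With \<open>F = f k\<^sup>-\<^sup>1\<close>, \<open>E = e k\<^sup>-\<^sup>1\<close> and the torus element
  \<open>D = d\<^sub>- (k\<^sup>-\<^sup>2 - 1) + d\<^sub>+ (k\<^sup>2 - 1)\<close>, where \<open>d\<^sub>\<plusminus> = q\<^bsup>\<plusminus>(\<lambda> + 1)\<^esup> / (q - q\<^sup>-\<^sup>1)\<close>, comparing the
  coefficients of the normally ordered monomials \<open>F\<^sup>l E\<^sup>m k\<^sup>j\<close> gives \<open>x Y = D x\<close>. On weight spaces \<open>D\<close>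
  acts by the scalars \<open>\<nu>\<close>, which are pairwise distinct and hence have invertible differences, so the
  eigenspaces of \<open>D\<close> are the weight spaces. Since \<open>x\<close> acts bijectively, it carries these eigenspaces
  to those of \<open>Y\<close>. Bijectivity holds because \<open>x\<close>
  specializes to the identity at \<open>q\<^sup>-\<^sup>\<lambda> = 0\<close>.
\<close>

section \<open>Computing in the quantized enveloping algebra\<close>

text \<open>The coefficient in \<open>Y\<close> splits as d_- + d_+. D keeps d_+ (k^2 - 1) and has
  d_- (k^-2 - 1) where \<open>Y\<close> has d_- (k^2 - 1). The power k^-2 arises when F is moved
  past powers of E: the commutator contributes k^-4, which meets the k^2 in f k = F k^2. The one
  relation x Y = D x serves both actions, but they compose in opposite orders: on the left x carries
  eigenvectors of \<open>Y\<close> to those of D, on the right it carries eigenvectors of D to those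
  of \<open>Y\<close>. This is why the inverse of x stands on the left and x itself on the right.
  Two obstacles shape the rest. K is a tensor product of two fields and is handled as a ring, so
  elements are inverted in F before they are mapped to K. And x is an infinite sum, so each identity
  about it is checked on a vector of A_K, with the sum cut off at a bound valid for that vector.
  Such a bound exists because k is diagonalizable, E and F multiply its eigenvalues by q and q^-1,
  and q is not a root of unity. Bijectivity is reduced in the same way to finite matrices over F,
  whose denominators are cleared by a common (q^(-2\<lambda>); q^2)_M.\<close>

lemma ring_free_ring: "ring free_ring"
proof (rule ringI)
  show "abelian_group free_ring"
  proof (rule abelian_groupI)
    fix x :: free_alg
    show "\<exists>y\<in>carrier free_ring. y \<oplus>\<^bsub>free_ring\<^esub> x = \<zero>\<^bsub>free_ring\<^esub>"
      by (rule bexI[of _ "- x"]) (simp_all add: free_ring_def)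
  qed (simp_all add: free_ring_def add_ac)
  show "monoid free_ring"
    by (rule monoidI) (simp_all add: free_ring_def mult.assoc)
qed (simp_all add: free_ring_def distrib_left distrib_right)

lemma ideal_Uq_ideal: "ideal (Uq_ideal q) free_ring"
  unfolding Uq_ideal_def by (rule ring.genideal_ideal[OF ring_free_ring]) (simp add: free_ring_def)

lemma Uq_class_hom: "Uq_class q \<in> Ring.ring_hom free_ring (Uq q)"
  using ideal.rcos_ring_hom[OF ideal_Uq_ideal, of q]
  by (simp add: Uq_def Uq_class_def[abs_def])

lemma carrier_Uq: "carrier (Uq q) = range (Uq_class q)"
  by (auto simp: Uq_def FactRing_def A_RCOSETS_def' Uq_class_def free_ring_def)

lemma Uq_class_carrier [simp]: "Uq_class q p \<in> carrier (Uq q)"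
  by (simp add: carrier_Uq)

lemma Uq_class_mult: "Uq_class q p \<otimes>\<^bsub>Uq q\<^esub> Uq_class q r = Uq_class q (p * r)"
  using ring_hom_mult[OF Uq_class_hom, of p r] by (simp add: free_ring_def)

lemma Uq_class_add: "Uq_class q p \<oplus>\<^bsub>Uq q\<^esub> Uq_class q r = Uq_class q (p + r)"
  using ring_hom_add[OF Uq_class_hom, of p r] by (simp add: free_ring_def)

text \<open>Computing with representatives keeps the ring operations of the type
  \<open>free_alg\<close> available to the simplifier. Equality of cosets, rather than membership of
  the difference in the ideal, is what the regular actions see, since they depend on a
  representative only through \<open>Uq_class\<close>.\<close>

definition qeq :: "complex \<Rightarrow> free_alg \<Rightarrow> free_alg \<Rightarrow> bool" where
  "qeq q p r \<longleftrightarrow> Uq_class q p = Uq_class q r"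

lemma qeq_refl [simp]: "qeq q p p"
  by (simp add: qeq_def)

lemma qeq_sym: "qeq q p r \<Longrightarrow> qeq q r p"
  by (simp add: qeq_def)

lemma qeq_trans [trans]: "qeq q p r \<Longrightarrow> qeq q r s \<Longrightarrow> qeq q p s"
  by (simp add: qeq_def)

lemma qeq_mult: "qeq q p p' \<Longrightarrow> qeq q r r' \<Longrightarrow> qeq q (p * r) (p' * r')"
  unfolding qeq_def by (metis Uq_class_mult)

lemma qeq_add: "qeq q p p' \<Longrightarrow> qeq q r r' \<Longrightarrow> qeq q (p + r) (p' + r')"
  unfolding qeq_def by (metis Uq_class_add)

lemma qeq_scale: "qeq q p p' \<Longrightarrow> qeq q (c *\<^sub>C p) (c *\<^sub>C p')"
  using qeq_mult[of q "c *\<^sub>C 1" "c *\<^sub>C 1" p p'] by (simp add: mult_scaleC_left)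

lemma qeq_diff:
  assumes "qeq q p p'" "qeq q r r'" shows "qeq q (p - r) (p' - r')"
proof -
  have "qeq q (p + (-1) *\<^sub>C r) (p' + (-1) *\<^sub>C r')"
    by (intro qeq_add qeq_scale assms)
  then show ?thesis by (simp add: cvs.scale_minus_left scaleC_one)
qed

text \<open>The difference lies in the generated ideal, so both cosets agree; the subtraction of the
  record \<open>free_ring\<close> has to be identified with that of the type.\<close>

lemma qeq_relation:
  assumes "p - r \<in> Uq_relations q" shows "qeq q p r"
proof -
  interpret R: ring free_ring by (rule ring_free_ring)
  have "\<ominus>\<^bsub>free_ring\<^esub> r = - r"
    by (rule R.minus_equality) (simp_all add: free_ring_def)
  then have "p \<ominus>\<^bsub>free_ring\<^esub> r = p - r"
    unfolding a_minus_def by (simp add: free_ring_def)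
  moreover have "p - r \<in> Uq_ideal q"
    unfolding Uq_ideal_def using R.genideal_self[of "Uq_relations q"] assms
    by (auto simp: free_ring_def)
  ultimately show ?thesis
    unfolding qeq_def Uq_class_def
    using R.quotient_eq_iff_same_a_r_cos[OF ideal_Uq_ideal, of p r q] by (simp add: free_ring_def)
qed

lemma qeq_basic:
  "qeq q (gk * gk_inv) 1" "qeq q (gk_inv * gk) 1"
  "qeq q (gk * ge) (q *\<^sub>C (ge * gk))" "qeq q (gk * gf) (inverse q *\<^sub>C (gf * gk))"
  "qeq q (ge * gf) (gf * ge + (1 / (q - inverse q)) *\<^sub>C (gk ^ 2 - gk_inv ^ 2))"
  by (rule qeq_relation; simp add: Uq_relations_def algebra_simps; fail)+

section \<open>Extension of scalars of a linear map\<close>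

text \<open>This is id \<otimes> \<phi>. Since \<open>tensor_lift\<close> returns zero for a map
  that is not bilinear, evaluation on pure tensors requires \<open>clinear \<phi>\<close>, whereas
  additivity holds in every case.\<close>

definition Kmap :: "(functional \<Rightarrow> functional) \<Rightarrow> (K, functional) tensor \<Rightarrow> (K, functional) tensor" where
  "Kmap \<phi> = tensor_lift (\<lambda>d a. d \<otimes>\<^sub>C \<phi> a)"

lemma Kmap_tensor:
  assumes "clinear \<phi>" shows "Kmap \<phi> (d \<otimes>\<^sub>C a) = d \<otimes>\<^sub>C \<phi> a"
proof -
  have "cbilinear (\<lambda>d a. (d::K) \<otimes>\<^sub>C \<phi> a)"
    using assms unfolding cbilinear_def clinear_iff by (simp add: tensor_bil)
  then show ?thesis unfolding Kmap_def by simp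
qed

lemma Kmap_add: "Kmap \<phi> (s + t) = Kmap \<phi> s + Kmap \<phi> t"
  unfolding Kmap_def by (rule cvs.linear_add[OF clinear_tensor_lift])

lemma Kscale_tensor: "Kscale c (d \<otimes>\<^sub>C a) = (c * d) \<otimes>\<^sub>C a"
proof -
  have "cbilinear (\<lambda>d a. (c * d) \<otimes>\<^sub>C (a::functional))"
    unfolding cbilinear_def clinear_iff by (simp add: tensor_bil distrib_left mult_scaleC_right)
  then show ?thesis unfolding Kscale_def by simp
qed

lemma Kscale_add: "Kscale c (s + t) = Kscale c s + Kscale c t"
  unfolding Kscale_def by (rule cvs.linear_add[OF clinear_tensor_lift])

text \<open>A module and not a vector space: K is the tensor product of two fields and is treated as
  a commutative ring throughout.\<close>

global_interpretation K: Modules.module Kscale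
proof
  fix a b :: K and x y :: "(K, functional) tensor"
  show "Kscale a (x + y) = Kscale a x + Kscale a y" by (rule Kscale_add)
  show "Kscale (a + b) x = Kscale a x + Kscale b x"
    by (induction x rule: tensor_induct) (simp_all add: Kscale_tensor Kscale_add distrib_right tensor_bil)
  show "Kscale a (Kscale b x) = Kscale (a * b) x"
    by (induction x rule: tensor_induct) (simp_all add: Kscale_tensor Kscale_add mult.assoc)
  show "Kscale 1 x = x"
    by (induction x rule: tensor_induct) (simp_all add: Kscale_tensor Kscale_add)
qed

lemma Kscale_scaleC_right: "Kscale c (d *\<^sub>C t) = d *\<^sub>C Kscale c t"
  unfolding Kscale_def by (rule cvs.linear_scale[OF clinear_tensor_lift])

lemma Kscale_scaleC: "Kscale (c *\<^sub>C 1) t = c *\<^sub>C t"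
  by (induction t rule: tensor_induct)
    (simp_all add: Kscale_tensor Kscale_add mult_scaleC_left tensor_bil scaleC_add_right)

lemma Kmap_Kscale:
  assumes "clinear \<phi>" shows "Kmap \<phi> (Kscale c t) = Kscale c (Kmap \<phi> t)"
  by (induction t rule: tensor_induct)
    (simp_all add: Kscale_tensor Kscale_add Kmap_add Kmap_tensor[OF assms])

lemma module_hom_Kmap: "clinear \<phi> \<Longrightarrow> Modules.module_hom Kscale Kscale (Kmap \<phi>)"
  by (rule Modules.module_hom.intro[OF K.module_axioms K.module_axioms], unfold_locales)
    (simp_all add: Kmap_add Kmap_Kscale)

lemma Kmap_comp:
  assumes "clinear \<phi>" "clinear \<psi>" shows "Kmap \<phi> (Kmap \<psi> t) = Kmap (\<lambda>a. \<phi> (\<psi> a)) t"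
proof -
  have *: "clinear (\<lambda>a. \<phi> (\<psi> a))" using assms by (simp add: clinear_iff)
  show ?thesis
    by (induction t rule: tensor_induct)
      (simp_all only: Kmap_add Kmap_tensor[OF assms(1)] Kmap_tensor[OF assms(2)] Kmap_tensor[OF *])
qed

lemma tensor_zero [simp]: "0 \<otimes>\<^sub>C a = 0" "b \<otimes>\<^sub>C 0 = 0"
  using tensor_bil(3)[of 0 0 a] tensor_bil(4)[of b 0 0] by simp_all

lemma tensor_sum_left: "(\<Sum>i\<in>I. c i) \<otimes>\<^sub>C a = (\<Sum>i\<in>I. c i \<otimes>\<^sub>C a)"
  by (induction I rule: infinite_finite_induct) (simp_all add: tensor_bil)

lemma tensor_sum_right: "c \<otimes>\<^sub>C (\<Sum>i\<in>I. a i) = (\<Sum>i\<in>I. c \<otimes>\<^sub>C a i)"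
  by (induction I rule: infinite_finite_induct) (simp_all add: tensor_bil)

lemma base_change_tensor: "a \<in> V \<Longrightarrow> c \<otimes>\<^sub>C a \<in> base_change V"
  unfolding base_change_def by (rule cvs.span_base) blast

lemma base_change_add: "s \<in> base_change V \<Longrightarrow> t \<in> base_change V \<Longrightarrow> s + t \<in> base_change V"
  unfolding base_change_def by (rule cvs.span_add)

lemma base_change_zero: "0 \<in> base_change V"
  unfolding base_change_def by (rule cvs.span_zero)

lemma base_change_sum: "(\<And>i. i \<in> I \<Longrightarrow> f i \<in> base_change V) \<Longrightarrow> sum f I \<in> base_change V"
  unfolding base_change_def by (rule cvs.span_sum)

text \<open>A complex scalar can be absorbed into the left factor of a pure tensor, so linear
  combinations reduce to sums of pure tensors.\<close>

lemma base_change_induct [consumes 1, case_names zero tensor add]: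
  assumes "t \<in> base_change V" and zero: "P 0"
    and tensor: "\<And>c a. a \<in> V \<Longrightarrow> P (c \<otimes>\<^sub>C a)"
    and add: "\<And>s t. s \<in> base_change V \<Longrightarrow> P s \<Longrightarrow> t \<in> base_change V \<Longrightarrow> P t \<Longrightarrow> P (s + t)"
  shows "P t"
proof -
  have "t \<in> base_change V \<and> P t"
    using assms(1) unfolding base_change_def
  proof (induction rule: cvs.span_induct_alt)
    case base
    show ?case by (simp add: zero cvs.span_zero)
  next
    case (step c x y)
    then obtain d a where x: "x = d \<otimes>\<^sub>C a" and a: "a \<in> V" by blast
    have "c *\<^sub>C x = (c *\<^sub>C d) \<otimes>\<^sub>C a" by (simp add: x tensor_bil)
    then show ?case
      using add[of "c *\<^sub>C x" y] tensor[OF a, of "c *\<^sub>C d"] base_change_tensor[OF a, of "c *\<^sub>C d"]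
        step base_change_add[of "c *\<^sub>C x" V y]
      by (simp add: base_change_def)
  qed
  then show ?thesis ..
qed

lemma base_change_Kscale: "t \<in> base_change V \<Longrightarrow> Kscale c t \<in> base_change V"
  by (induction t rule: base_change_induct)
    (simp_all add: base_change_zero base_change_tensor base_change_add Kscale_tensor Kscale_add)

lemma base_change_Kmap:
  assumes "clinear \<phi>" "\<And>a. a \<in> V \<Longrightarrow> \<phi> a \<in> W" "t \<in> base_change V"
  shows "Kmap \<phi> t \<in> base_change W"
  using assms(3)
  by (induction t rule: base_change_induct)
    (simp_all add: assms base_change_zero base_change_tensor base_change_add Kmap_tensor Kmap_add
      Modules.module_hom.zero[OF module_hom_Kmap])

lemma base_change_mono: "V \<subseteq> W \<Longrightarrow> base_change V \<subseteq> base_change W"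
  unfolding base_change_def by (intro cvs.span_mono) blast

text \<open>Serves to exchange \<open>act (p + r)\<close> for the sum of two actions and the like:
  such identities are available on the functionals in \<open>V\<close>, while both maps are linear
  on all functionals.\<close>

lemma Kmap_cong:
  assumes "clinear \<phi>" "clinear \<psi>" "\<And>a. a \<in> V \<Longrightarrow> \<phi> a = \<psi> a" "t \<in> base_change V"
  shows "Kmap \<phi> t = Kmap \<psi> t"
  using assms(4)
  by (induction t rule: base_change_induct)
    (simp_all add: assms Kmap_tensor Kmap_add Modules.module_hom.zero[OF module_hom_Kmap])

section \<open>Extending an action to coefficients in K\<close>

text \<open>The common form of \<open>lact\<close> and \<open>ract\<close>: they arise when
  \<open>act p\<close> is the left or the right action of the class of \<open>p\<close>.\<close>

definition Kact :: "(free_alg \<Rightarrow> functional \<Rightarrow> functional) \<Rightarrow> (K, free_alg) tensor \<Rightarrow>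
    (K, functional) tensor \<Rightarrow> (K, functional) tensor" where
  "Kact act y t = tensor_lift (\<lambda>c p. tensor_lift (\<lambda>d a. (c * d) \<otimes>\<^sub>C act p a) t) y"

text \<open>For \<open>tensor_lift\<close> to evaluate the outer expression it must be bilinear in
  \<open>c\<close> and \<open>p\<close>. Additivity in \<open>p\<close> is available on
  \<open>V\<close>, which is why bilinearity is proved by induction on \<open>t\<close> in the base
  change of \<open>V\<close>.\<close>

lemma Kact_tensor:
  assumes lin: "\<And>p. clinear (act p)"
    and "\<And>p r a. a \<in> V \<Longrightarrow> act (p + r) a = act p a + act r a"
    and "\<And>c p a. a \<in> V \<Longrightarrow> act (c *\<^sub>C p) a = c *\<^sub>C act p a"
    and t: "t \<in> base_change V"
  shows "Kact act (c \<otimes>\<^sub>C p) t = Kscale c (Kmap (act p) t)"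
proof -
  have *: "tensor_lift (\<lambda>d a. (c * d) \<otimes>\<^sub>C act p a) t = Kscale c (Kmap (act p) t)" for c p t
  proof (induction t rule: tensor_induct)
    case (tensor d a)
    have "cbilinear (\<lambda>d a. (c * d) \<otimes>\<^sub>C act p a)"
      using lin unfolding cbilinear_def clinear_iff
      by (simp add: tensor_bil distrib_left mult_scaleC_right)
    then show ?case by (simp add: Kmap_tensor lin Kscale_tensor)
  qed (simp add: cvs.linear_add[OF clinear_tensor_lift] Kmap_add Kscale_add)
  have "cbilinear (\<lambda>c p. Kscale c (Kmap (act p) t))"
    using t
  proof (induction t rule: base_change_induct)
    case zero
    show ?case
      unfolding cbilinear_def clinear_iff by (simp add: Modules.module_hom.zero[OF module_hom_Kmap[OF lin]])
  next
    case (tensor d a)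
    then show ?case
      unfolding cbilinear_def clinear_iff
      by (simp add: tensor_bil Kmap_tensor lin Kscale_tensor distrib_right mult_scaleC_left assms
          Kscale_add Kscale_scaleC_right)
  next
    case (add s t)
    then show ?case
      unfolding cbilinear_def clinear_iff Kmap_add Kscale_add
      by (simp only: scaleC_add_right) (simp add: add.assoc add.left_commute)
  qed
  then show ?thesis unfolding Kact_def * by simp
qed

lemma Kact_add: "Kact act (y + z) t = Kact act y t + Kact act z t"
  and Kact_diff: "Kact act (y - z) t = Kact act y t - Kact act z t"
  unfolding Kact_def
  by (rule cvs.linear_add[OF clinear_tensor_lift] cvs.linear_diff[OF clinear_tensor_lift])+

section \<open>Commutation up to a scalar\<close>

definition qcomm :: "complex \<Rightarrow> complex \<Rightarrow> free_alg \<Rightarrow> free_alg \<Rightarrow> bool" where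
  "qcomm q c x y \<longleftrightarrow> qeq q (x * y) (c *\<^sub>C (y * x))"

lemma qcomm_mult_right:
  assumes "qcomm q c x y" "qcomm q d x z" shows "qcomm q (c * d) x (y * z)"
proof -
  have "qeq q ((x * y) * z) ((c *\<^sub>C (y * x)) * z)"
    using assms by (intro qeq_mult) (simp_all add: qcomm_def)
  also have "(c *\<^sub>C (y * x)) * z = c *\<^sub>C (y * (x * z))"
    by (simp add: mult_scaleC_left mult.assoc)
  also have "qeq q (c *\<^sub>C (y * (x * z))) (c *\<^sub>C (y * (d *\<^sub>C (z * x))))"
    using assms by (intro qeq_mult qeq_scale) (simp_all add: qcomm_def)
  finally show ?thesis
    by (simp add: qcomm_def mult_scaleC_right scaleC_scaleC mult.assoc)
qed

lemma qcomm_mult_left: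
  assumes "qcomm q c x z" "qcomm q d y z" shows "qcomm q (c * d) (x * y) z"
proof -
  have "qeq q (x * (y * z)) (x * (d *\<^sub>C (z * y)))"
    using assms by (intro qeq_mult) (simp_all add: qcomm_def)
  also have "x * (d *\<^sub>C (z * y)) = d *\<^sub>C ((x * z) * y)"
    by (simp add: mult_scaleC_right mult.assoc)
  also have "qeq q (d *\<^sub>C ((x * z) * y)) (d *\<^sub>C ((c *\<^sub>C (z * x)) * y))"
    using assms by (intro qeq_mult qeq_scale) (simp_all add: qcomm_def)
  finally show ?thesis
    by (simp add: qcomm_def mult_scaleC_left scaleC_scaleC mult.assoc mult.commute)
qed

lemma qcomm_one: "qcomm q 1 x 1"
  by (simp add: qcomm_def scaleC_one)

lemma qcomm_power: "qcomm q c x y \<Longrightarrow> qcomm q (c ^ m) x (y ^ m)"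
  by (induction m) (simp_all add: qcomm_one qcomm_mult_right)

text \<open>Conjugation by k^-1: 1 = k k^-1 is inserted on the right, and its factor k is moved to
  the left past \<open>y\<close>, where it cancels.\<close>

lemma qcomm_inverse:
  assumes "qcomm q c gk y" "c \<noteq> 0" shows "qcomm q (inverse c) gk_inv y"
proof -
  have "qeq q (gk_inv * y * 1) (gk_inv * y * (gk * gk_inv))"
    by (intro qeq_mult qeq_refl qeq_sym[OF qeq_basic(1)])
  also have "gk_inv * y * (gk * gk_inv) = inverse c *\<^sub>C (gk_inv * (c *\<^sub>C (y * gk)) * gk_inv)"
    using assms(2) by (simp add: mult_scaleC_left mult_scaleC_right scaleC_scaleC mult.assoc scaleC_one)
  also have "qeq q \<dots> (inverse c *\<^sub>C (gk_inv * (gk * y) * gk_inv))"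
    using assms(1) by (intro qeq_mult qeq_scale qeq_refl) (simp add: qcomm_def qeq_sym)
  also have "inverse c *\<^sub>C (gk_inv * (gk * y) * gk_inv) = inverse c *\<^sub>C ((gk_inv * gk) * (y * gk_inv))"
    by (simp add: mult.assoc)
  also have "qeq q \<dots> (inverse c *\<^sub>C (1 * (y * gk_inv)))"
    by (intro qeq_mult qeq_scale qeq_refl qeq_basic)
  finally show ?thesis by (simp add: qcomm_def)
qed

abbreviation "gF \<equiv> gf * gk_inv"
abbreviation "gE \<equiv> ge * gk_inv"

lemma qcomm_k_kinv: "qcomm q 1 gk gk_inv"
  unfolding qcomm_def scaleC_one by (metis qeq_basic(1,2) qeq_sym qeq_trans)

lemma qcomm_k_E: "qcomm q q gk gE"
  using qcomm_mult_right[OF _ qcomm_k_kinv, of q q ge] qeq_basic(3) by (simp add: qcomm_def)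

lemma qcomm_k_F: "qcomm q (inverse q) gk gF"
  using qcomm_mult_right[OF _ qcomm_k_kinv, of q "inverse q" gf] qeq_basic(4) by (simp add: qcomm_def)

section \<open>Matrix coefficients\<close>

text \<open>In an eigenbasis of \<open>A\<close> a nonzero entry (i, j) of \<open>B m\<close> forces
  d_i = c^m d_j for the eigenvalues. As c is not a root of unity, this happens for at most one
  \<open>m\<close> per entry, and there are finitely many entries. With \<open>B m\<close> the image
  of y^m this is nilpotency of y.\<close>

lemma twisted_commuting_family_nilpotent:
  fixes A D P Q :: "complex mat" and B :: "nat \<Rightarrow> complex mat"
  assumes carr: "A \<in> carrier_mat n n" "D \<in> carrier_mat n n" "P \<in> carrier_mat n n" "Q \<in> carrier_mat n n"
    "\<And>m. B m \<in> carrier_mat n n"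
    and PQ: "P * Q = 1\<^sub>m n" "Q * P = 1\<^sub>m n" and A: "A = P * D * Q" and D: "diagonal_mat D"
    and D0: "\<And>i. i < n \<Longrightarrow> D $$ (i, i) \<noteq> 0"
    and c: "c \<noteq> 0" "\<And>m. m > 0 \<Longrightarrow> c ^ m \<noteq> 1"
    and AB: "\<And>m. A * B m = (c ^ m) \<cdot>\<^sub>m (B m * A)"
  shows "\<exists>N. \<forall>m\<ge>N. B m = 0\<^sub>m n n"
proof -
  define C where "C m = Q * B m * P" for m
  have C: "C m \<in> carrier_mat n n" for m
    unfolding C_def by (intro mult_carrier_mat[of _ n n] carr)
  have B: "B m = P * C m * Q" for m
  proof -
    have "P * C m * Q = (P * Q) * B m * (P * Q)"
      using carr(2-4) carr(5)[of m] by (simp add: C_def assoc_mult_mat[of _ n n _ n _ n])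
    then show ?thesis using carr(5)[of m] by (simp add: PQ)
  qed
  have DC: "D * C m = (c ^ m) \<cdot>\<^sub>m (C m * D)" for m
  proof -
    have "D * C m = (Q * P) * D * Q * B m * P"
      using carr(2-4) carr(5)[of m] by (simp add: C_def PQ assoc_mult_mat[of _ n n _ n _ n])
    also have "\<dots> = Q * (A * B m) * P"
      using carr(2-4) carr(5)[of m] by (simp add: A assoc_mult_mat[of _ n n _ n _ n])
    also have "\<dots> = Q * ((c ^ m) \<cdot>\<^sub>m (B m * A)) * P" by (simp only: AB)
    also have "\<dots> = (c ^ m) \<cdot>\<^sub>m (Q * B m * (P * D * Q) * P)"
      using carr(2-4) carr(5)[of m] unfolding A
      by (simp add: mult_smult_distrib[of _ n n _ n] mult_smult_assoc_mat[of _ n n _ n] assoc_mult_mat[of _ n n _ n _ n])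
    also have "Q * B m * (P * D * Q) * P = Q * B m * P * D * (Q * P)"
      using carr(2-4) carr(5)[of m] by (simp add: assoc_mult_mat[of _ n n _ n _ n])
    also have "\<dots> = C m * D" using carr(2-4) carr(5)[of m] by (simp add: PQ C_def)
    finally show ?thesis .
  qed
  have ent: "D $$ (i, i) * C m $$ (i, j) = c ^ m * (C m $$ (i, j) * D $$ (j, j))"
    if "i < n" "j < n" for i j m
  proof -
    have "(D * C m) $$ (i, j) = (\<Sum>k<n. D $$ (i, k) * C m $$ (k, j))"
      using that carr C[of m] by (simp add: scalar_prod_def atLeast0LessThan)
    also have "\<dots> = (\<Sum>k<n. if k = i then D $$ (i, i) * C m $$ (i, j) else 0)"
      by (rule sum.cong) (use that carr D in \<open>auto simp: diagonal_mat_def\<close>)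
    finally have 1: "(D * C m) $$ (i, j) = D $$ (i, i) * C m $$ (i, j)" using that by simp
    have "(C m * D) $$ (i, j) = (\<Sum>k<n. C m $$ (i, k) * D $$ (k, j))"
      using that carr C[of m] by (simp add: scalar_prod_def atLeast0LessThan)
    also have "\<dots> = (\<Sum>k<n. if k = j then C m $$ (i, j) * D $$ (j, j) else 0)"
      by (rule sum.cong) (use that carr D in \<open>auto simp: diagonal_mat_def\<close>)
    finally have 2: "(C m * D) $$ (i, j) = C m $$ (i, j) * D $$ (j, j)" using that by simp
    have "(D * C m) $$ (i, j) = (c ^ m \<cdot>\<^sub>m (C m * D)) $$ (i, j)" by (simp only: DC)
    also have "\<dots> = c ^ m * (C m * D) $$ (i, j)" using that carr C[of m] by simp
    finally show ?thesis by (simp only: 1 2)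
  qed
  have "\<exists>N. \<forall>m\<ge>N. C m $$ (i, j) = 0" if ij: "i < n" "j < n" for i j
  proof (cases "\<exists>k. C k $$ (i, j) \<noteq> 0")
    case True
    then obtain k where k: "C k $$ (i, j) \<noteq> 0" by blast
    \<comment> \<open>Two exponents with a nonzero entry would give c^(m - k) = 1.\<close>
    have "C m $$ (i, j) = 0" if "m \<ge> Suc k" for m
    proof (rule ccontr)
      assume m: "C m $$ (i, j) \<noteq> 0"
      have "D $$ (i, i) = c ^ k * D $$ (j, j)" "D $$ (i, i) = c ^ m * D $$ (j, j)"
        using ent[OF ij, of k] ent[OF ij, of m] k m by (simp_all add: mult.assoc mult.commute)
      then have "c ^ m = c ^ k" using D0[OF ij(2)] by simp
      moreover have "c ^ m = c ^ (m - k) * c ^ k" using that by (simp flip: power_add)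
      ultimately have "c ^ (m - k) = 1" using c(1) by simp
      then show False using c(2)[of "m - k"] that by simp
    qed
    then show ?thesis by blast
  qed blast
  then obtain f where f: "\<And>i j m. i < n \<Longrightarrow> j < n \<Longrightarrow> m \<ge> f i j \<Longrightarrow> C m $$ (i, j) = 0"
    by metis
  \<comment> \<open>The sum of the bounds dominates each of them.\<close>
  define N where "N = (\<Sum>i<n. \<Sum>j<n. f i j)"
  have fN: "f i j \<le> N" if "i < n" "j < n" for i j
  proof -
    have "f i j \<le> (\<Sum>j<n. f i j)" using that by (intro member_le_sum) auto
    also have "\<dots> \<le> N" unfolding N_def using that
      by (intro member_le_sum[of _ _ "\<lambda>i. \<Sum>j<n. f i j"]) auto
    finally show ?thesis .
  qed
  have "B m = 0\<^sub>m n n" if "m \<ge> N" for m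
  proof -
    have "C m = 0\<^sub>m n n"
    proof (rule eq_matI)
      fix i j assume "i < dim_row (0\<^sub>m n n :: complex mat)" "j < dim_col (0\<^sub>m n n :: complex mat)"
      then have ij: "i < n" "j < n" by simp_all
      then show "C m $$ (i, j) = 0\<^sub>m n n $$ (i, j)"
        using f[OF ij order_trans[OF fN[OF ij] that]] by simp
    qed (use C[of m] in auto)
    then show ?thesis using B[of m] carr by simp
  qed
  then show ?thesis by blast
qed

text \<open>Inserting \<open>P * Q\<close> on both sides of \<open>M\<close> passes to the basis of
  columns of \<open>P\<close> and the dual basis of rows of \<open>Q\<close>, in which
  \<open>M\<close> has the entries \<open>row Q i \<bullet> (M *\<^sub>v col P j)\<close>.\<close>

lemma scalar_prod_conjugate_expand:
  fixes M P Q :: "complex mat"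
  assumes carr: "M \<in> carrier_mat n n" "P \<in> carrier_mat n n" "Q \<in> carrier_mat n n"
    and PQ: "P * Q = 1\<^sub>m n" and v: "\<phi> \<in> carrier_vec n" "v \<in> carrier_vec n"
  shows "\<phi> \<bullet> (M *\<^sub>v v) = (\<Sum>i<n. \<Sum>j<n. ((transpose_mat P *\<^sub>v \<phi>) $ i * (Q *\<^sub>v v) $ j) *
    (row Q i \<bullet> (M *\<^sub>v col P j)))"
proof -
  have "M *\<^sub>v v = (P * Q) *\<^sub>v (M *\<^sub>v ((P * Q) *\<^sub>v v))"
    using carr v by (simp only: PQ) simp
  also have "\<dots> = P *\<^sub>v (Q *\<^sub>v (M *\<^sub>v (P *\<^sub>v (Q *\<^sub>v v))))"
    using carr v by simp
  finally have "\<phi> \<bullet> (M *\<^sub>v v) = (transpose_mat P *\<^sub>v \<phi>) \<bullet> (Q *\<^sub>v (M *\<^sub>v (P *\<^sub>v (Q *\<^sub>v v))))"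
    using carr v by (simp add: transpose_vec_mult_scalar[of P n n])
  also have "\<dots> = (\<Sum>i<n. (transpose_mat P *\<^sub>v \<phi>) $ i * (Q *\<^sub>v (M *\<^sub>v (P *\<^sub>v (Q *\<^sub>v v)))) $ i)"
    using carr by (simp add: scalar_prod_def atLeast0LessThan)
  also have "\<dots> = (\<Sum>i<n. (transpose_mat P *\<^sub>v \<phi>) $ i * (\<Sum>j<n. (row Q i \<bullet> (M *\<^sub>v col P j)) * (Q *\<^sub>v v) $ j))"
  proof (rule sum.cong[OF refl])
    fix i assume i: "i \<in> {..<n}"
    have "(Q *\<^sub>v (M *\<^sub>v (P *\<^sub>v (Q *\<^sub>v v)))) $ i = ((Q * (M * P)) *\<^sub>v (Q *\<^sub>v v)) $ i"
      using carr v by (simp add: assoc_mult_mat_vec[of _ n n _ n])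
    also have "\<dots> = (\<Sum>j<n. (Q * (M * P)) $$ (i, j) * (Q *\<^sub>v v) $ j)"
      using carr v i by (simp add: scalar_prod_def atLeast0LessThan del: index_mult_mat(1))
    also have "\<dots> = (\<Sum>j<n. (row Q i \<bullet> (M *\<^sub>v col P j)) * (Q *\<^sub>v v) $ j)"
    proof (rule sum.cong[OF refl])
      fix j assume j: "j \<in> {..<n}"
      have "col (M * P) j = M *\<^sub>v col P j"
        using carr j by (intro eq_vecI) auto
      then show "(Q * (M * P)) $$ (i, j) * (Q *\<^sub>v v) $ j = (row Q i \<bullet> (M *\<^sub>v col P j)) * (Q *\<^sub>v v) $ j"
        using carr i j by simp
    qed
    finally show "(transpose_mat P *\<^sub>v \<phi>) $ i * (Q *\<^sub>v (M *\<^sub>v (P *\<^sub>v (Q *\<^sub>v v)))) $ i =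
      (transpose_mat P *\<^sub>v \<phi>) $ i * (\<Sum>j<n. (row Q i \<bullet> (M *\<^sub>v col P j)) * (Q *\<^sub>v v) $ j)" by simp
  qed
  finally show ?thesis by (simp add: sum_distrib_left mult_ac)
qed

lemma functional_eqI:
  assumes "\<And>p. a (Uq_class (exp L) p) = b (Uq_class (exp L) p)"
    and "\<And>u. u \<notin> carrier (Uq (exp L)) \<Longrightarrow> a u = b u"
  shows "a = (b :: functional)"
proof
  fix u
  show "a u = b u"
    using assms by (cases "u \<in> carrier (Uq (exp L))") (auto simp: carrier_Uq)
qed

locale type1 =
  fixes L :: complex and n :: nat and \<rho> :: "free_alg set \<Rightarrow> complex mat"
  assumes rep: "type1_rep L n \<rho>"
begin

definition R :: "free_alg \<Rightarrow> complex mat" where "R p = \<rho> (Uq_class (exp L) p)"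

lemma hom: "\<rho> \<in> Ring.ring_hom (Uq (exp L)) (ring_mat TYPE(complex) n ())"
  using rep by (simp add: type1_rep_def)

lemma R_carrier [simp]: "R p \<in> carrier_mat n n"
  using ring_hom_closed[OF hom, of "Uq_class (exp L) p"] by (simp add: R_def ring_mat_def)

lemma R_mult: "R (p * r) = R p * R r"
  using ring_hom_mult[OF hom, of "Uq_class (exp L) p" "Uq_class (exp L) r"]
  by (simp add: R_def ring_mat_def Uq_class_mult)

text \<open>Complex linearity does not follow from \<open>ring_hom\<close>: it comes from the clause
  of \<open>type1_rep\<close> on multiples of the unit, together with multiplicativity.\<close>

lemma R_scale: "R (c *\<^sub>C p) = c \<cdot>\<^sub>m R p"
proof -
  have "R (c *\<^sub>C 1) = c \<cdot>\<^sub>m 1\<^sub>m n" using rep by (simp add: type1_rep_def R_def)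
  then show ?thesis
    using R_mult[of "c *\<^sub>C 1" p] mult_smult_assoc_mat[of "1\<^sub>m n" n n "R p" n c]
    by (simp add: mult_scaleC_left left_mult_one_mat[OF R_carrier])
qed

lemma R_cong: "qeq (exp L) p r \<Longrightarrow> R p = R r"
  by (simp add: qeq_def R_def)

definition mc :: "complex vec \<Rightarrow> complex vec \<Rightarrow> functional" where
  "mc = matrix_coeff L \<rho>"

lemma mc_Uq_class: "mc \<phi> v (Uq_class (exp L) p) = \<phi> \<bullet> (R p *\<^sub>v v)"
  by (simp add: mc_def matrix_coeff_def R_def)

lemma mc_outside: "u \<notin> carrier (Uq (exp L)) \<Longrightarrow> mc \<phi> v u = 0"
  by (simp add: mc_def matrix_coeff_def)

lemma mc_Aq: "\<phi> \<in> carrier_vec n \<Longrightarrow> v \<in> carrier_vec n \<Longrightarrow> mc \<phi> v \<in> Aq L"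
  unfolding Aq_def mc_def using rep by (intro cvs.span_base) blast

lemma lreg_mc:
  assumes "\<phi> \<in> carrier_vec n" "v \<in> carrier_vec n"
  shows "lreg L (Uq_class (exp L) p) (mc \<phi> v) = mc \<phi> (R p *\<^sub>v v)"
  by (rule functional_eqI[where L = L])
    (use assms in \<open>simp_all add: lreg_def mc_outside Uq_class_mult mc_Uq_class R_mult
      assoc_mult_mat_vec[OF R_carrier R_carrier]\<close>)

lemma rreg_mc:
  assumes "\<phi> \<in> carrier_vec n" "v \<in> carrier_vec n"
  shows "rreg L (mc \<phi> v) (Uq_class (exp L) p) = mc (transpose_mat (R p) *\<^sub>v \<phi>) v"
  by (rule functional_eqI[where L = L])
    (use assms in \<open>simp_all add: rreg_def mc_outside Uq_class_mult mc_Uq_class R_mult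
      assoc_mult_mat_vec[OF R_carrier R_carrier] transpose_vec_mult_scalar[of "R p" n n]
      mult_mat_vec_carrier[OF R_carrier]\<close>)

lemma mc_smult:
  assumes "\<phi> \<in> carrier_vec n" "v \<in> carrier_vec n"
  shows "mc (c \<cdot>\<^sub>v \<phi>) v = c *\<^sub>C mc \<phi> v" "mc \<phi> (c \<cdot>\<^sub>v v) = c *\<^sub>C mc \<phi> v"
proof -
  have "dim_row (R p) = n" "dim_col (R p) = n" for p
    by (rule carrier_matD[OF R_carrier])+
  then show "mc (c \<cdot>\<^sub>v \<phi>) v = c *\<^sub>C mc \<phi> v" "mc \<phi> (c \<cdot>\<^sub>v v) = c *\<^sub>C mc \<phi> v"
    using assms
    by (auto intro!: functional_eqI[where L = L] simp: mc_Uq_class mc_outside scaleC_fun_def scaleC_complex_def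
       mult_mat_vec[OF R_carrier])
qed

text \<open>The matrix coefficients of a pair of dual bases span all others. The standard basis
  gives a finite spanning set, an eigenbasis of k gives weight vectors.\<close>

lemma mc_expand:
  assumes "P \<in> carrier_mat n n" "Q \<in> carrier_mat n n" "P * Q = 1\<^sub>m n"
    "\<phi> \<in> carrier_vec n" "v \<in> carrier_vec n"
  shows "mc \<phi> v = (\<Sum>i<n. \<Sum>j<n. ((transpose_mat P *\<^sub>v \<phi>) $ i * (Q *\<^sub>v v) $ j) *\<^sub>C
    mc (row Q i) (col P j))"
proof -
  have *: "(\<Sum>i\<in>I. f i) u = (\<Sum>i\<in>I. f i u)" for I u and f :: "nat \<Rightarrow> functional"
    by (induction I rule: infinite_finite_induct) simp_all
  show ?thesis
    by (rule functional_eqI[where L = L])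
     (simp_all add: * scaleC_fun_def scaleC_complex_def mc_outside mc_Uq_class
       scalar_prod_conjugate_expand[OF R_carrier assms])
qed

definition coeffs :: "functional set" where
  "coeffs = (\<lambda>(i, j). mc (unit_vec n i) (unit_vec n j)) ` ({..<n} \<times> {..<n})"

lemma finite_coeffs: "finite coeffs"
  by (simp add: coeffs_def)

lemma coeffs_Aq: "coeffs \<subseteq> Aq L"
  by (auto simp: coeffs_def mc_Aq)

lemma mc_span_coeffs:
  assumes "\<phi> \<in> carrier_vec n" "v \<in> carrier_vec n"
  shows "mc \<phi> v \<in> cvs.span coeffs"
proof -
  have *: "row (1\<^sub>m n) i = unit_vec n i" "col (1\<^sub>m n) i = unit_vec n i" if "i < n" for i
    using that by (auto intro!: eq_vecI)
  have "mc \<phi> v = (\<Sum>i<n. \<Sum>j<n. ((transpose_mat (1\<^sub>m n) *\<^sub>v \<phi>) $ i * (1\<^sub>m n *\<^sub>v v) $ j) *\<^sub>C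
    mc (row (1\<^sub>m n) i) (col (1\<^sub>m n) j))"
    by (rule mc_expand) (use assms in auto)
  also have "\<dots> \<in> cvs.span coeffs"
    by (intro cvs.span_sum cvs.span_scale cvs.span_base) (auto simp: coeffs_def *)
  finally show ?thesis .
qed

text \<open>Columns of \<open>P\<close> are eigenvectors of k and rows of \<open>Q\<close> are
  eigenvectors of its transpose; the left and the right action of k on matrix coefficients see these
  respectively.\<close>

lemma diagonalization:
  obtains D P Q where "D \<in> carrier_mat n n" "P \<in> carrier_mat n n" "Q \<in> carrier_mat n n"
    "P * Q = 1\<^sub>m n" "Q * P = 1\<^sub>m n" "R gk = P * D * Q" "diagonal_mat D"
    "\<And>i. i < n \<Longrightarrow> \<exists>m::int. D $$ (i, i) = qpow L (of_int m / 2)"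
    "\<And>i. i < n \<Longrightarrow> R gk *\<^sub>v col P i = D $$ (i, i) \<cdot>\<^sub>v col P i"
    "\<And>i. i < n \<Longrightarrow> transpose_mat (R gk) *\<^sub>v row Q i = D $$ (i, i) \<cdot>\<^sub>v row Q i"
proof -
  obtain D where D: "diagonal_mat D" "similar_mat (R gk) D"
    using rep by (auto simp: type1_rep_def R_def)
  obtain n' P Q where 0: "{R gk, D, P, Q} \<subseteq> carrier_mat n' n'" "P * Q = 1\<^sub>m n'" "Q * P = 1\<^sub>m n'"
    "R gk = P * D * Q"
    using similar_matD[OF D(2)] by blast
  have "n' = n" using 0(1) carrier_matD(1)[OF R_carrier[of gk]] by auto
  note 1 = 0[unfolded this]
  have carr: "D \<in> carrier_mat n n" "P \<in> carrier_mat n n" "Q \<in> carrier_mat n n" using 1(1) by auto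
  have colD: "col D i = D $$ (i, i) \<cdot>\<^sub>v unit_vec n i" if "i < n" for i
    using that carr D(1) by (intro eq_vecI) (auto simp: diagonal_mat_def)
  have rowD: "row D i = D $$ (i, i) \<cdot>\<^sub>v unit_vec n i" if "i < n" for i
    using that carr D(1) by (intro eq_vecI) (auto simp: diagonal_mat_def)
  have unit: "M *\<^sub>v unit_vec n i = col M i" if "i < n" "M \<in> carrier_mat n n" for i and M :: "complex mat"
    using that by (intro eq_vecI) (auto simp: scalar_prod_def if_distrib sum.delta cong: if_cong)
  have ev: "R gk *\<^sub>v col P i = D $$ (i, i) \<cdot>\<^sub>v col P i" if i: "i < n" for i
  proof -
    have "R gk *\<^sub>v col P i = R gk *\<^sub>v (P *\<^sub>v unit_vec n i)" using unit i carr by simp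
    also have "\<dots> = (R gk * P) *\<^sub>v unit_vec n i"
      by (rule assoc_mult_mat_vec[symmetric, OF R_carrier]) (use carr in auto)
    also have "R gk * P = P * D * (Q * P)" using carr by (simp add: 1(4) assoc_mult_mat[of _ n n _ n _ n])
    also have "\<dots> = P * D" using carr by (simp add: 1(3))
    also have "(P * D) *\<^sub>v unit_vec n i = P *\<^sub>v (D *\<^sub>v unit_vec n i)"
      by (rule assoc_mult_mat_vec) (use carr in auto)
    also have "\<dots> = D $$ (i, i) \<cdot>\<^sub>v (P *\<^sub>v unit_vec n i)"
      using i carr by (simp add: unit colD mult_mat_vec[OF carr(2)])
    finally show ?thesis using unit i carr by simp
  qed
  have evT: "transpose_mat (R gk) *\<^sub>v row Q i = D $$ (i, i) \<cdot>\<^sub>v row Q i" if i: "i < n" for i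
  proof -
    let ?T = transpose_mat
    have "?T (R gk) *\<^sub>v row Q i = ?T (R gk) *\<^sub>v (?T Q *\<^sub>v unit_vec n i)"
      using unit[of i "?T Q"] i carr by simp
    also have "\<dots> = (?T (R gk) * ?T Q) *\<^sub>v unit_vec n i"
      by (rule assoc_mult_mat_vec[symmetric, of _ n n _ n]) (use carr in auto)
    also have "?T (R gk) * ?T Q = ?T (Q * R gk)"
      by (rule transpose_mult[symmetric, OF _ R_carrier]) (use carr in auto)
    also have "Q * R gk = (Q * P) * D * Q" using carr by (simp add: 1(4) assoc_mult_mat[of _ n n _ n _ n])
    also have "\<dots> = D * Q" using carr by (simp add: 1(3))
    also have "?T (D * Q) = ?T Q * ?T D"
      by (rule transpose_mult) (use carr in auto)
    also have "(?T Q * ?T D) *\<^sub>v unit_vec n i = ?T Q *\<^sub>v (?T D *\<^sub>v unit_vec n i)"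
      by (rule assoc_mult_mat_vec) (use carr in auto)
    also have "\<dots> = D $$ (i, i) \<cdot>\<^sub>v (?T Q *\<^sub>v unit_vec n i)"
      using i carr by (simp add: unit rowD mult_mat_vec[of "?T Q" n n])
    finally show ?thesis using unit[of i "?T Q"] i carr by simp
  qed
  have "\<exists>m::int. D $$ (i, i) = qpow L (of_int m / 2)" if i: "i < n" for i
  proof -
    \<comment> \<open>\<open>Q * P = 1\<close> forbids zero columns, so the type 1 condition on
      eigenvalues applies to every diagonal entry.\<close>
    have "col P i \<noteq> 0\<^sub>v n"
    proof
      assume "col P i = 0\<^sub>v n"
      then have "(Q * P) $$ (i, i) = 0" using carr i by simp
      then show False using i by (simp add: 1(3))
    qed
    then have "eigenvalue (R gk) (D $$ (i, i))"
      unfolding eigenvalue_def eigenvector_def using ev[OF i] carrier_matD(1)[OF R_carrier[of gk]] carr i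
      by (intro exI[of _ "col P i"]) auto
    then show ?thesis using rep by (simp add: type1_rep_def R_def)
  qed
  then show ?thesis using that carr 1 D(1) ev evT by blast
qed

text \<open>E and F commute with k up to q and q^-1, neither of which is a root of unity, so both
  act nilpotently. The trailing factor \<open>p\<close> lets the bound cover monomials that end in a
  power of k.\<close>

lemma R_monomial_zero:
  assumes q: "\<And>m. m > 0 \<Longrightarrow> exp L ^ m \<noteq> 1"
  shows "\<exists>N. \<forall>l m p. l \<ge> N \<or> m \<ge> N \<longrightarrow> R (gF ^ l * gE ^ m * p) = 0\<^sub>m n n"
proof -
  obtain D P Q where DPQ: "D \<in> carrier_mat n n" "P \<in> carrier_mat n n" "Q \<in> carrier_mat n n"
    "P * Q = 1\<^sub>m n" "Q * P = 1\<^sub>m n" "R gk = P * D * Q" "diagonal_mat D"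
    "\<And>i. i < n \<Longrightarrow> \<exists>m::int. D $$ (i, i) = qpow L (of_int m / 2)"
    using diagonalization by metis
  have D0: "D $$ (i, i) \<noteq> 0" if "i < n" for i
    using DPQ(8)[OF that] by (auto simp: qpow_def)
  have nil: "\<exists>N. \<forall>m\<ge>N. R (y ^ m) = 0\<^sub>m n n"
    if y: "qcomm (exp L) c gk y" and c: "c \<noteq> 0" "\<And>m. m > 0 \<Longrightarrow> c ^ m \<noteq> 1" for y c
  proof (rule twisted_commuting_family_nilpotent[OF R_carrier DPQ(1-3) R_carrier DPQ(4-7) D0 c])
    show "R gk * R (y ^ m) = c ^ m \<cdot>\<^sub>m (R (y ^ m) * R gk)" for m
      using R_cong qcomm_power[OF y, of m] by (simp add: qcomm_def R_scale flip: R_mult)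
  qed
  obtain N1 where N1: "\<And>m. m \<ge> N1 \<Longrightarrow> R (gE ^ m) = 0\<^sub>m n n"
    using nil[OF qcomm_k_E] q by auto
  have "inverse (exp L) ^ m \<noteq> 1" if "m > 0" for m
    using q[OF that] by (metis inverse_1 inverse_inverse_eq power_inverse)
  then obtain N2 where N2: "\<And>m. m \<ge> N2 \<Longrightarrow> R (gF ^ m) = 0\<^sub>m n n"
    using nil[OF qcomm_k_F] by auto
  have "R (gF ^ l * gE ^ m * p) = 0\<^sub>m n n" if "l \<ge> max N1 N2 \<or> m \<ge> max N1 N2" for l m p
  proof -
    have "R (gF ^ l) = 0\<^sub>m n n \<or> R (gE ^ m) = 0\<^sub>m n n" using that N1 N2 by auto
    moreover have "R (gF ^ l * gE ^ m * p) = R (gF ^ l) * R (gE ^ m) * R p" by (simp only: R_mult)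
    ultimately show ?thesis 
      by (auto simp: left_mult_zero_mat[OF R_carrier] right_mult_zero_mat[OF R_carrier]
         simp flip: assoc_mult_mat[OF R_carrier R_carrier R_carrier])
  qed
  then show ?thesis by blast
qed

lemma mc_zero_left: "mc (0\<^sub>v n) v = 0" if "v \<in> carrier_vec n"
  by (rule functional_eqI[where L = L]) (simp_all add: mc_Uq_class mc_outside mult_mat_vec_carrier[OF R_carrier] that)

lemma mc_zero_right: "mc \<phi> (0\<^sub>v n) = 0" if "\<phi> \<in> carrier_vec n"
proof (rule functional_eqI[where L = L])
  fix p
  have "R p *\<^sub>v 0\<^sub>v n = 0\<^sub>v n"
    using carrier_matD[OF R_carrier[of p]] by (intro eq_vecI) auto
  then show "mc \<phi> (0\<^sub>v n) (Uq_class (exp L) p) = 0 (Uq_class (exp L) p)"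
    using that by (simp add: mc_Uq_class)
qed (simp add: mc_outside)

text \<open>A coefficient formed from a row of \<open>Q\<close> and a column of \<open>P\<close> is
  a joint eigenvector of both actions of k: the row gives the weight \<alpha>, the column the weight
  \<beta>.\<close>

lemma mc_span_weights:
  assumes "\<phi> \<in> carrier_vec n" "v \<in> carrier_vec n"
  shows "mc \<phi> v \<in> cvs.span (\<Union>(\<alpha>, \<beta>). Aq_weight L \<alpha> \<beta>)"
proof -
  obtain D P Q where DPQ: "D \<in> carrier_mat n n" "P \<in> carrier_mat n n" "Q \<in> carrier_mat n n"
    "P * Q = 1\<^sub>m n" "Q * P = 1\<^sub>m n" "R gk = P * D * Q" "diagonal_mat D"
    "\<And>i. i < n \<Longrightarrow> \<exists>m::int. D $$ (i, i) = qpow L (of_int m / 2)"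
    "\<And>i. i < n \<Longrightarrow> R gk *\<^sub>v col P i = D $$ (i, i) \<cdot>\<^sub>v col P i"
    "\<And>i. i < n \<Longrightarrow> transpose_mat (R gk) *\<^sub>v row Q i = D $$ (i, i) \<cdot>\<^sub>v row Q i"
    using diagonalization by metis
  have "mc (row Q i) (col P j) \<in> (\<Union>(\<alpha>, \<beta>). Aq_weight L \<alpha> \<beta>)" if "i < n" "j < n" for i j
  proof -
    obtain a b :: int where ab: "D $$ (i, i) = qpow L (of_int a / 2)" "D $$ (j, j) = qpow L (of_int b / 2)"
      using DPQ(8) \<open>i < n\<close> \<open>j < n\<close> by metis
    have "row Q i \<in> carrier_vec n" "col P j \<in> carrier_vec n" using DPQ that by auto
    then have "mc (row Q i) (col P j) \<in> Aq_weight L a b"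
      using that by (simp add: Aq_weight_def mc_Aq lreg_mc rreg_mc DPQ(9,10) mc_smult ab)
    then show ?thesis by blast
  qed
  then have "(\<Sum>i<n. \<Sum>j<n. ((transpose_mat P *\<^sub>v \<phi>) $ i * (Q *\<^sub>v v) $ j) *\<^sub>C mc (row Q i) (col P j))
     \<in> cvs.span (\<Union>(\<alpha>, \<beta>). Aq_weight L \<alpha> \<beta>)"
    by (intro cvs.span_sum cvs.span_scale cvs.span_base) simp
  then show ?thesis using mc_expand[OF DPQ(2,3,4) assms] by simp
qed

end

lemma Aq_span_weights: "Aq L \<subseteq> cvs.span (\<Union>(\<alpha>, \<beta>). Aq_weight L \<alpha> \<beta>)"
  unfolding Aq_def
proof (rule cvs.span_minimal[OF _ cvs.subspace_span], safe)
  fix n \<rho> and \<phi> v :: "complex vec"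
  assume *: "type1_rep L n \<rho>" "\<phi> \<in> carrier_vec n" "v \<in> carrier_vec n"
  interpret type1 L n \<rho> using *(1) by unfold_locales
  show "matrix_coeff L \<rho> \<phi> v \<in> cvs.span (\<Union>(\<alpha>, \<beta>). Aq_weight L \<alpha> \<beta>)"
    using mc_span_weights[OF *(2,3)] by (simp add: mc_def)
qed

section \<open>Local finiteness of the regular actions\<close>

text \<open>A finite system with invariant span and one bound \<open>N\<close> for all of
  \<open>S\<close>. Both the truncation of x and its matrix on the span of \<open>S\<close> rest on
  it.\<close>

definition lfin :: "complex \<Rightarrow> (free_alg \<Rightarrow> functional \<Rightarrow> functional) \<Rightarrow> functional set \<Rightarrow> nat \<Rightarrow> bool" where
  "lfin L act S N \<longleftrightarrow> finite S \<and> S \<subseteq> Aq L \<and> (\<forall>p. \<forall>s\<in>S. act p s \<in> cvs.span S) \<and>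
     (\<forall>l m p. \<forall>s\<in>S. l \<ge> N \<or> m \<ge> N \<longrightarrow> act (gF ^ l * gE ^ m * p) s = 0)"

lemma lfin_union:
  assumes "lfin L act S N" "lfin L act T M" shows "lfin L act (S \<union> T) (max N M)"
proof -
  have "cvs.span S \<subseteq> cvs.span (S \<union> T)" "cvs.span T \<subseteq> cvs.span (S \<union> T)"
    by (intro cvs.span_mono; blast)+
  then show ?thesis using assms unfolding lfin_def by (auto 4 3)
qed

text \<open>A matrix coefficient lies in the span of the entries of its representation, for which
  such a system is assumed; linear combinations are handled by unions of systems.\<close>

lemma Aq_lfin:
  assumes mc: "\<And>n \<rho>. type1_rep L n \<rho> \<Longrightarrow> \<exists>N. lfin L act (type1.coeffs L n \<rho>) N"
    and "a \<in> Aq L"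
  shows "\<exists>S N. lfin L act S N \<and> a \<in> cvs.span S"
  using assms(2) unfolding Aq_def
proof (induction rule: cvs.span_induct_alt)
  case base
  show ?case by (rule exI[of _ "{}"]) (simp add: lfin_def zero_fun_def)
next
  case (step c x y)
  then obtain n \<rho> \<phi> v where x: "x = matrix_coeff L \<rho> \<phi> v" and
    *: "type1_rep L n \<rho>" "\<phi> \<in> carrier_vec n" "v \<in> carrier_vec n" by blast
  interpret type1 L n \<rho> using *(1) by unfold_locales
  obtain N where N: "lfin L act coeffs N" using mc[OF *(1)] by blast
  obtain S M where S: "lfin L act S M" "y \<in> cvs.span S" using step by blast
  have "x \<in> cvs.span coeffs" using mc_span_coeffs[OF *(2,3)] by (simp add: x mc_def)
  then have "c *\<^sub>C x + y \<in> cvs.span (coeffs \<union> S)"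
    using S(2) cvs.span_mono[of S "coeffs \<union> S"] cvs.span_mono[of coeffs "coeffs \<union> S"]
    by (intro cvs.span_add cvs.span_scale) auto
  then show ?case using lfin_union[OF N S(1)] by blast
qed

lemma (in type1) lfin_lreg:
  assumes q: "\<And>m. m > 0 \<Longrightarrow> exp L ^ m \<noteq> 1"
  shows "\<exists>N. lfin L (\<lambda>p. lreg L (Uq_class (exp L) p)) coeffs N"
proof -
  obtain N where N: "\<And>l m p. l \<ge> N \<or> m \<ge> N \<Longrightarrow> R (gF ^ l * gE ^ m * p) = 0\<^sub>m n n"
    using R_monomial_zero[OF q] by blast
  have [simp]: "0\<^sub>m n n *\<^sub>v unit_vec n j = (0\<^sub>v n :: complex vec)" for j
    by (intro eq_vecI) auto
  show ?thesis
    unfolding lfin_def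
    by (rule exI[of _ N], intro conjI finite_coeffs coeffs_Aq)
      (auto simp: coeffs_def lreg_mc N mc_zero_right
        intro!: mc_span_coeffs[unfolded coeffs_def] mult_mat_vec_carrier[OF R_carrier])
qed

lemma (in type1) lfin_rreg:
  assumes q: "\<And>m. m > 0 \<Longrightarrow> exp L ^ m \<noteq> 1"
  shows "\<exists>N. lfin L (\<lambda>p a. rreg L a (Uq_class (exp L) p)) coeffs N"
proof -
  obtain N where N: "\<And>l m p. l \<ge> N \<or> m \<ge> N \<Longrightarrow> R (gF ^ l * gE ^ m * p) = 0\<^sub>m n n"
    using R_monomial_zero[OF q] by blast
  have [simp]: "0\<^sub>m n n *\<^sub>v unit_vec n j = (0\<^sub>v n :: complex vec)" for j
    by (intro eq_vecI) auto
  have [simp]: "transpose_mat (R p) *\<^sub>v unit_vec n j \<in> carrier_vec n" for p j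
    by (rule mult_mat_vec_carrier[of _ n n]) auto
  show ?thesis
    unfolding lfin_def
    by (rule exI[of _ N], intro conjI finite_coeffs coeffs_Aq)
      (auto simp: coeffs_def rreg_mc N mc_zero_left intro!: mc_span_coeffs[unfolded coeffs_def])
qed

section \<open>Rational functions of \<open>q\<^sup>-\<^sup>\<lambda>\<close>\<close>

text \<open>Every coefficient occurring below is a rational function of t = q^(-\<lambda>). The
  specialization t = 0 makes sense only on the side of polynomials, hence the passage between the
  two.\<close>

definition tpoly :: "complex \<Rightarrow> complex poly \<Rightarrow> mero" where
  "tpoly L p = Mero (\<lambda>z. poly p (qpow L (- z)))"

lemma tpoly_meromorphic: "(\<lambda>z. poly p (qpow L (- z))) meromorphic_on A"
  unfolding qpow_def poly_altdef by (rule analytic_on_imp_meromorphic_on) (auto intro!: analytic_intros)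

lemma mero_eq_refl: "f meromorphic_on UNIV \<Longrightarrow> mero_eq f f"
  by (simp add: mero_eq_def)

lemmas mero_eq_tpoly = mero_eq_refl[OF tpoly_meromorphic]

lemma tpoly_add: "tpoly L (p + r) = tpoly L p + tpoly L r"
  by (simp add: tpoly_def plus_mero.abs_eq[OF mero_eq_tpoly mero_eq_tpoly])

lemma tpoly_mult: "tpoly L (p * r) = tpoly L p * tpoly L r"
  by (simp add: tpoly_def times_mero.abs_eq[OF mero_eq_tpoly mero_eq_tpoly])

lemma tpoly_smult: "tpoly L (Polynomial.smult c p) = c *\<^sub>C tpoly L p"
  by (simp add: tpoly_def scaleC_mero.abs_eq[OF mero_eq_tpoly])

lemma tpoly_0: "tpoly L 0 = 0"
  by (simp add: tpoly_def zero_mero_def)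

lemma tpoly_1: "tpoly L 1 = 1"
  by (simp add: tpoly_def one_mero_def)

lemma tpoly_hom: "comm_ring_hom (tpoly L)"
  by unfold_locales (simp_all add: tpoly_add tpoly_mult tpoly_0 tpoly_1)

lemma tpoly_divide:
  "tpoly L p / tpoly L r = Mero (\<lambda>z. poly p (qpow L (- z)) / poly r (qpow L (- z)))"
  by (simp add: tpoly_def divide_mero.abs_eq[OF mero_eq_tpoly mero_eq_tpoly])

text \<open>A function that is zero in F vanishes on a punctured disc around 0. On the ray z = s / L
  the value q^(-z) is exp (- s), which takes infinitely many values for small positive s, too many
  to be roots of a nonzero polynomial.\<close>

lemma tpoly_eq_0:
  assumes "L \<noteq> 0" "tpoly L p = 0" shows "p = 0"
proof (rule ccontr)
  assume "p \<noteq> 0"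
  have "mero_eq (\<lambda>z. poly p (qpow L (- z))) (\<lambda>_. 0)"
    using assms(2) mero_eq_tpoly[of p L] mero_eq_refl[of "\<lambda>_. 0"]
      Quotient3_rel[OF Quotient3_mero, of "\<lambda>z. poly p (qpow L (- z))" "\<lambda>_. 0"]
    unfolding tpoly_def zero_mero_def by (simp add: meromorphic_on_const)
  then have "\<forall>\<^sub>\<approx>z\<in>UNIV. poly p (qpow L (- z)) = 0"
    by (simp add: mero_eq_def)
  then have "eventually (\<lambda>z. poly p (qpow L (- z)) = 0) (at 0)"
    by (rule eventually_cosparse_imp_eventually_at) simp
  then obtain d where d: "d > 0" "\<And>z. z \<noteq> 0 \<Longrightarrow> norm z < d \<Longrightarrow> poly p (qpow L (- z)) = 0"
    by (auto simp: eventually_at dist_norm)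
  define S where "S = {0<..<d * norm L}"
  have "(\<lambda>s. exp (- complex_of_real s)) ` S \<subseteq> {t. poly p t = 0}"
  proof clarify
    fix s assume s: "s \<in> S"
    have "norm (of_real s / L) < d" "of_real s / L \<noteq> 0"
      using s assms(1) by (auto simp: S_def norm_divide field_simps)
    then have "poly p (qpow L (- (of_real s / L))) = 0" by (rule d(2)[rotated])
    then show "poly p (exp (- complex_of_real s)) = 0" using assms(1) by (simp add: qpow_def)
  qed
  moreover have "inj_on (\<lambda>s. exp (- complex_of_real s)) S"
    by (rule inj_onI) (simp add: exp_of_real flip: of_real_minus)
  moreover have "infinite S" using d(1) assms(1) by (simp add: S_def infinite_Ioo)
  ultimately show False
    using poly_roots_finite[OF \<open>p \<noteq> 0\<close>] by (metis finite_imageD finite_subset)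
qed

definition tvar :: "complex \<Rightarrow> mero" where "tvar L = tpoly L [:0, 1:]"

lemma tvar_nonzero: "L \<noteq> 0 \<Longrightarrow> tvar L \<noteq> 0"
  unfolding tvar_def using tpoly_eq_0 by fastforce

text \<open>The coefficients of \<open>k\<^sup>-\<^sup>2 - 1\<close> and \<open>k\<^sup>2 - 1\<close> in the element of the torus to which \<open>x\<close> conjugates \<open>Y\<close>.\<close>

definition dminus :: "complex \<Rightarrow> mero" where
  "dminus L = (1 / (exp L * (exp L - inverse (exp L)))) *\<^sub>C tvar L"

definition dplus :: "complex \<Rightarrow> mero" where
  "dplus L = (exp L / (exp L - inverse (exp L))) *\<^sub>C inverse (tvar L)"

text \<open>Elements of F are classes of functions. Writing Laurent combinations of t as
  \<open>Mero\<close> of one function lets the identities for \<open>Y_coeff\<close> and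
  \<open>nu\<close> be checked pointwise.\<close>

lemma Mero_tvar_combination:
  "a *\<^sub>C tvar L + b *\<^sub>C inverse (tvar L) = Mero (\<lambda>z. a * qpow L (- z) + b / qpow L (- z))"
proof -
  have m: "(\<lambda>z. qpow L (- z)) meromorphic_on UNIV"
    using tpoly_meromorphic[of "[:0, 1:]" L UNIV] by simp
  have mi: "(\<lambda>z. inverse (qpow L (- z))) meromorphic_on UNIV"
    using m by (rule meromorphic_on_inverse)
  have t: "tvar L = Mero (\<lambda>z. qpow L (- z))" by (simp add: tvar_def tpoly_def)
  show ?thesis
    unfolding t inverse_mero.abs_eq[OF mero_eq_refl[OF m]]
      scaleC_mero.abs_eq[OF mero_eq_refl[OF m]] scaleC_mero.abs_eq[OF mero_eq_refl[OF mi]]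
    by (subst plus_mero.abs_eq) (auto intro!: mero_eq_refl meromorphic_intros m mi simp: divide_inverse)
qed

lemma qpow_diff_one: "qpow L (- z - 1) = qpow L (- z) / exp L" "qpow L (z + 1) = exp L / qpow L (- z)"
  by (simp_all add: qpow_def algebra_simps exp_add exp_diff exp_minus field_simps)

lemma Y_coeff_eq: "Y_coeff L = dminus L + dplus L"
  unfolding Y_coeff_def dminus_def dplus_def Mero_tvar_combination qpow_diff_one
  by (rule arg_cong[of _ _ Mero]) (simp add: fun_eq_iff add_divide_distrib mult_ac)

text \<open>The right-hand side is the value of D where k^2 acts by q^\<alpha>, which explains the
  formula for \<nu>.\<close>

lemma nu_eq: "nu L \<alpha> = (qpow L (- of_int \<alpha>) - 1) *\<^sub>C dminus L + (qpow L (of_int \<alpha>) - 1) *\<^sub>C dplus L"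
  unfolding nu_def dminus_def dplus_def scaleC_scaleC Mero_tvar_combination qpow_diff_one
  by (rule arg_cong[of _ _ Mero]) (simp add: fun_eq_iff add_divide_distrib mult_ac)

lemma exp_nonroot_imp:
  fixes L :: complex
  assumes q: "\<forall>n>0. exp L ^ n \<noteq> 1"
  shows "L \<noteq> 0" "exp L - inverse (exp L) \<noteq> 0"
proof -
  show "L \<noteq> 0" using q[rule_format, of 1] by auto
  show "exp L - inverse (exp L) \<noteq> 0"
  proof
    assume "exp L - inverse (exp L) = 0"
    then have "exp L * exp L = exp L * inverse (exp L)" by simp
    then have "exp L ^ 2 = 1" by (simp add: power2_eq_square)
    then show False using q[rule_format, of 2] by simp
  qed
qed

lemma qpow_of_int: "qpow L (of_int \<alpha>) = exp L powi \<alpha>"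
  by (simp add: qpow_def exp_power_int mult.commute)

text \<open>Multiplied by t, the difference becomes the polynomial b + a t^2 with constants a and b.
  Its vanishing forces b = 0, that is q^\<alpha> = q^\<beta>, which is excluded since q is not a
  root of unity.\<close>

lemma nu_diff_nonzero:
  assumes q: "\<forall>n>0. exp L ^ n \<noteq> 1" and "\<alpha> \<noteq> \<beta>"
  shows "nu L \<alpha> - nu L \<beta> \<noteq> 0"
proof
  note L = exp_nonroot_imp[OF q]
  let ?D = "exp L - inverse (exp L)"
  define a where "a = (qpow L (- of_int \<alpha>) - qpow L (- of_int \<beta>)) / (exp L * ?D)"
  define b where "b = (qpow L (of_int \<alpha>) - qpow L (of_int \<beta>)) * exp L / ?D"
  assume "nu L \<alpha> - nu L \<beta> = 0"
  moreover have "nu L \<alpha> - nu L \<beta> = a *\<^sub>C tvar L + b *\<^sub>C inverse (tvar L)"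
  proof -
    have "nu L \<alpha> - nu L \<beta> = (qpow L (- of_int \<alpha>) - qpow L (- of_int \<beta>)) *\<^sub>C dminus L
        + (qpow L (of_int \<alpha>) - qpow L (of_int \<beta>)) *\<^sub>C dplus L"
      by (simp add: nu_eq cvs.scale_left_diff_distrib)
    then show ?thesis by (simp add: dminus_def dplus_def scaleC_scaleC a_def b_def)
  qed
  ultimately have "(a *\<^sub>C tvar L + b *\<^sub>C inverse (tvar L)) * tvar L = 0" by simp
  moreover have "(a *\<^sub>C tvar L + b *\<^sub>C inverse (tvar L)) * tvar L = tpoly L [:b, 0, a:]"
  proof -
    have 1: "[:b, 0, a:] = Polynomial.smult b 1 + Polynomial.smult a ([:0, 1:] * [:0, 1:])" by (simp add: one_pCons)
    show ?thesis
      unfolding 1 tpoly_add tpoly_smult tpoly_mult tpoly_1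
      using tvar_nonzero[OF L(1)] by (simp add: distrib_right mult_scaleC_left tvar_def)
  qed
  ultimately have "tpoly L [:b, 0, a:] = 0" by metis
  then have "[:b, 0, a:] = 0" by (rule tpoly_eq_0[OF L(1)])
  then have eq: "exp L powi \<alpha> = exp L powi \<beta>" using L(2) by (simp add: b_def qpow_of_int)
  have *: "exp L powi n \<noteq> 1" if "n \<noteq> 0" for n
  proof (cases "n > 0")
    case True
    then show ?thesis using q[rule_format, of "nat n"] by (simp add: power_int_def)
  next
    case False
    then show ?thesis using q[rule_format, of "nat (- n)"] that by (simp add: power_int_def power_inverse)
  qed
  have "exp L powi (\<alpha> - \<beta>) = 1" using eq by (simp add: power_int_diff)
  then show False using * assms(2) by fastforce
qed

section \<open>The coefficients of \<open>x\<close>\<close>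

text \<open>The factor of \<open>x_coeff\<close> that does not depend on \<lambda>.\<close>

definition cst :: "complex \<Rightarrow> nat \<Rightarrow> nat \<Rightarrow> complex" where
  "cst q l m = q powi (int l ^ 2 - int l + 2 * int l * int m - 2 * int m) * (1 - q ^ 2) ^ (l + m) /
     (qpoch (q ^ 2) (q ^ 2) l * qpoch (q ^ 2) (q ^ 2) m)"

text \<open>The denominator (t^2; q^2)_l of \<open>x_coeff\<close> as a polynomial in t. Its value 1
  at t = 0 is what makes the specialization possible.\<close>

definition poch_poly :: "complex \<Rightarrow> nat \<Rightarrow> complex poly" where
  "poch_poly q l = (\<Prod>j<l. [:1, 0, - ((q ^ 2) ^ j):])"

lemma poly_poch_poly: "poly (poch_poly q l) t = qpoch (t ^ 2) (q ^ 2) l"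
  by (simp add: poch_poly_def qpoch_def poly_prod power2_eq_square mult_ac)

lemma poch_poly_nonzero: "poch_poly q l \<noteq> 0"
  using poly_poch_poly[of q l 0] by (auto simp: qpoch_def)

lemma x_coeff_eq:
  "x_coeff L l m = cst (exp L) l m *\<^sub>C ((- tvar L) ^ (l + m) / tpoly L (poch_poly (exp L) l))"
proof -
  interpret comm_ring_hom "tpoly L" by (rule tpoly_hom)
  have sq: "qpow L (- 2 * z) = qpow L (- z) ^ 2" for z
    by (simp add: qpow_def flip: exp_of_nat_mult) (simp add: mult_ac)
  have "cst (exp L) l m *\<^sub>C ((- tvar L) ^ (l + m) / tpoly L (poch_poly (exp L) l)) =
    cst (exp L) l m *\<^sub>C (tpoly L ((- [:0, 1:]) ^ (l + m)) / tpoly L (poch_poly (exp L) l))"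
    by (simp add: tvar_def hom_power hom_uminus del: minus_pCons)
  also have "\<dots> = tpoly L (Polynomial.smult (cst (exp L) l m) ((- [:0, 1:]) ^ (l + m))) / tpoly L (poch_poly (exp L) l)"
    by (simp add: tpoly_smult divide_inverse mult_scaleC_left)
  also have "\<dots> = x_coeff L l m"
    unfolding tpoly_divide x_coeff_def Let_def poly_poch_poly sq
    by (rule arg_cong[of _ _ Mero]) (simp add: fun_eq_iff cst_def mult_ac)
  finally show ?thesis by simp
qed

lemma qpoch_Suc: "qpoch a q (Suc m) = qpoch a q m * (1 - a * q ^ m)"
  by (simp add: qpoch_def)

context
  fixes q :: complex
  assumes q0: "q \<noteq> 0" and q: "\<forall>n>0. q ^ n \<noteq> 1"
begin

lemma one_minus_q2: "1 - q ^ 2 \<noteq> 0"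
  and one_minus_qm: "1 - q ^ 2 * (q ^ 2) ^ m \<noteq> 0"
proof -
  show "1 - q ^ 2 \<noteq> 0" using q[rule_format, of 2] by simp
  have "q ^ (2 * Suc m) \<noteq> 1" by (rule q[rule_format]) simp
  moreover have "q ^ (2 * Suc m) = q ^ 2 * (q ^ 2) ^ m" by (simp only: power_mult power_Suc)
  ultimately show "1 - q ^ 2 * (q ^ 2) ^ m \<noteq> 0" by simp
qed

lemma powi_even: "q powi (2 * int l) = (q ^ 2) ^ l"
  by (metis of_nat_mult of_nat_numeral power_int_of_nat power_mult)

lemma cst_Suc_right:
  "cst q l (Suc m) = cst q l m * ((q ^ 2) ^ l / q ^ 2 * (1 - q ^ 2) / (1 - q ^ 2 * (q ^ 2) ^ m))"
proof -
  have "q powi (int l ^ 2 - int l + 2 * int l * int (Suc m) - 2 * int (Suc m)) =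
    q powi ((int l ^ 2 - int l + 2 * int l * int m - 2 * int m) + (2 * int l) - 2)"
    by (simp add: algebra_simps)
  also have "\<dots> = q powi (int l ^ 2 - int l + 2 * int l * int m - 2 * int m) * (q ^ 2) ^ l / q ^ 2"
    using q0 by (simp only: power_int_add power_int_diff simp_thms powi_even) simp
  finally show ?thesis
    unfolding cst_def qpoch_Suc by (simp only: add_Suc add_Suc_right power_Suc) (simp add: mult_ac)
qed

lemma cst_Suc_left:
  "cst q (Suc l) m = cst q l m * ((q ^ 2) ^ l * (q ^ 2) ^ m * (1 - q ^ 2) / (1 - q ^ 2 * (q ^ 2) ^ l))"
proof -
  have "q powi (int (Suc l) ^ 2 - int (Suc l) + 2 * int (Suc l) * int m - 2 * int m) =
    q powi ((int l ^ 2 - int l + 2 * int l * int m - 2 * int m) + 2 * int l + 2 * int m)"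
    by (simp add: algebra_simps power2_eq_square)
  also have "\<dots> = q powi (int l ^ 2 - int l + 2 * int l * int m - 2 * int m) * (q ^ 2) ^ l * (q ^ 2) ^ m"
    using q0 by (simp only: power_int_add power_int_diff simp_thms powi_even)
  finally show ?thesis
    unfolding cst_def qpoch_Suc by (simp only: add_Suc add_Suc_right power_Suc) (simp add: mult_ac)
qed

end

text \<open>\<open>gco\<close> and \<open>hco\<close> arise from moving F to the left past E^m.
  After i factors have been passed, the relation E F = q^2 F E + q / (q - q^-1) (1 - k^-4) is
  applied with the factor q^(2i), and moving k^-4 to the right past E^i turns its part into q^(2i)
  q^(-4i) = q^(-2i). \<open>gco\<close> collects the terms without k, \<open>hco\<close> those with
  k^-4.\<close>

definition gco :: "complex \<Rightarrow> nat \<Rightarrow> complex" where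
  "gco q m = q / (q - inverse q) * (\<Sum>i<m. (q ^ 2) ^ i)"

definition hco :: "complex \<Rightarrow> nat \<Rightarrow> complex" where
  "hco q m = q / (q - inverse q) * (\<Sum>i<m. inverse (q ^ 2) ^ i)"

context
  fixes L :: complex
  assumes q: "\<forall>n>0. exp L ^ n \<noteq> 1"
begin

private abbreviation "u l \<equiv> ((exp L) ^ 2) ^ l"
private abbreviation "D \<equiv> exp L - inverse (exp L)"

lemma x_coeff_Suc_right:
  "x_coeff L l (Suc m) = (- (u l / exp L ^ 2 * (1 - exp L ^ 2) / (1 - exp L ^ 2 * u m))) *\<^sub>C
     (tvar L * x_coeff L l m)"
  unfolding x_coeff_eq cst_Suc_right[OF exp_not_eq_zero q]
  by (simp add: mult_scaleC_left mult_scaleC_right scaleC_scaleC cvs.scale_minus_left cvs.scale_minus_right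
      divide_inverse mult_ac)

text \<open>Neighbouring coefficients are rewritten as multiples of \<open>x_coeff L l m\<close>, so
  that comparing coefficients becomes an identity of complex numbers. For m = 0 the factor 1 -
  q^(2m) vanishes, in agreement with the value 0 outside the range.\<close>

lemma x_coeff_pred_right:
  "(if m = 0 then 0 else x_coeff L l (m - 1)) =
    (- ((1 - u m) * exp L ^ 2 / (u l * (1 - exp L ^ 2)))) *\<^sub>C (inverse (tvar L) * x_coeff L l m)"
proof (cases m)
  case (Suc m')
  have t: "tvar L \<noteq> 0" using tvar_nonzero exp_nonroot_imp[OF q] by blast
  show ?thesis
    using t one_minus_q2[OF exp_not_eq_zero q] one_minus_qm[OF exp_not_eq_zero q, of m']
    by (simp add: Suc x_coeff_Suc_right mult_scaleC_right scaleC_scaleC scaleC_one flip: mult.assoc)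
qed simp

text \<open>Passing from l - 1 to l adds the factor 1 - q^(2l - 2) t^2 to the denominator, hence the
  two terms in 1/t and t. At l = 0 the factor 1 - q^(2l) supplies the boundary value.\<close>

lemma x_coeff_pred_left:
  "(if l = 0 then 0 else x_coeff L (l - 1) m) =
    (- ((1 - u l) * exp L ^ 2 / (u l * u m * (1 - exp L ^ 2)))) *\<^sub>C
      (inverse (tvar L) * x_coeff L l m - (u l / exp L ^ 2) *\<^sub>C (tvar L * x_coeff L l m))"
proof (cases l)
  case (Suc l')
  have L: "L \<noteq> 0" using exp_nonroot_imp[OF q] by blast
  have t: "tvar L \<noteq> 0" using tvar_nonzero L by blast
  let ?W = "tpoly L (poch_poly (exp L) l')"
  \<comment> \<open>The last factor of (t^2; q^2)_l.\<close>
  let ?v = "1 - u l' *\<^sub>C (tvar L ^ 2)"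
  have nz: "?W \<noteq> 0" "tpoly L (poch_poly (exp L) l) \<noteq> 0"
    using tpoly_eq_0[OF L] poch_poly_nonzero by blast+
  have W: "tpoly L (poch_poly (exp L) l) = ?W * ?v"
  proof -
    have "poch_poly (exp L) l = poch_poly (exp L) l' * (1 + Polynomial.smult (- u l') ([:0, 1:] * [:0, 1:]))"
      by (simp add: Suc poch_poly_def one_pCons)
    then show ?thesis
      by (simp only: tpoly_mult tpoly_add tpoly_1 tpoly_smult)
        (simp add: tvar_def power2_eq_square cvs.scale_minus_left)
  qed
  then have v: "?v \<noteq> 0" using nz by auto
  have 1: "?v * x_coeff L l m = (- (u l' * u m * (1 - exp L ^ 2) / (1 - exp L ^ 2 * u l'))) *\<^sub>C
     (tvar L * x_coeff L l' m)"
  proof -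
    have "?v * x_coeff L l m = cst (exp L) l m *\<^sub>C (((- tvar L) ^ (l + m) / ?W) * (?v / ?v))"
      unfolding x_coeff_eq W by (simp add: mult_scaleC_right)
    also have "\<dots> = cst (exp L) l m *\<^sub>C ((- tvar L) ^ (l + m) / ?W)" using v by simp
    also have "\<dots> = (- (u l' * u m * (1 - exp L ^ 2) / (1 - exp L ^ 2 * u l'))) *\<^sub>C
        (tvar L * x_coeff L l' m)"
      unfolding x_coeff_eq Suc cst_Suc_left[OF exp_not_eq_zero q]
      by (simp add: mult_scaleC_left mult_scaleC_right scaleC_scaleC cvs.scale_minus_left cvs.scale_minus_right
          divide_inverse mult_ac)
    finally show ?thesis .
  qed
  have 2: "inverse (tvar L) * x_coeff L l m - (u l / exp L ^ 2) *\<^sub>C (tvar L * x_coeff L l m) =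
    inverse (tvar L) * (?v * x_coeff L l m)"
    using t by (simp add: Suc algebra_simps mult_scaleC_right mult_scaleC_left power2_eq_square)
  have neg: "(a - 1) / (1 - a) = - 1" if "a \<noteq> 1" for a :: complex
    using that by (simp add: nonzero_divide_eq_eq)
  have 3: "- ((1 - u l) * exp L ^ 2 / (u l * u m * (1 - exp L ^ 2))) *
    - (u l' * u m * (1 - exp L ^ 2) / (1 - exp L ^ 2 * u l')) = 1"
    using one_minus_q2[OF exp_not_eq_zero q] one_minus_qm[OF exp_not_eq_zero q, of l']
    by (simp add: Suc neg)
  show ?thesis
    unfolding 2 1 mult_scaleC_right scaleC_scaleC 3
    using t Suc by (simp add: scaleC_one flip: mult.assoc)
qed simp

lemma gco_Suc: "gco (exp L) (Suc m) = exp L / D * ((exp L ^ 2 * u m - 1) / (exp L ^ 2 - 1))"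
  using geometric_sum[of "exp L ^ 2" "Suc m"] q[rule_format, of 2] by (simp add: gco_def del: sum.lessThan_Suc)

lemma hco_Suc: "hco (exp L) (Suc m) = exp L / D * ((1 / (exp L ^ 2 * u m) - 1) / (1 / exp L ^ 2 - 1))"
proof -
  have "inverse (exp L ^ 2) \<noteq> 1" using q[rule_format, of 2] by (metis inverse_1 inverse_inverse_eq zero_less_numeral)
  then show ?thesis
    using geometric_sum[of "inverse (exp L ^ 2)" "Suc m"]
    by (simp add: hco_def power_inverse divide_inverse del: sum.lessThan_Suc)
qed

text \<open>The coefficient of F^l E^m k^-2 in x Y = D x. On the left only F moved past E^(m + 1)
  produces it; on the right the power of q comes from moving k^-2 past F^l E^m.\<close>

lemma x_coeff_kinv2:
  "- hco (exp L) (Suc m) *\<^sub>C x_coeff L l (Suc m) = (u l / u m) *\<^sub>C (dminus L * x_coeff L l m)"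
proof -
  let ?Q = "exp L" let ?U = "u l" let ?W = "u m"
  have nz: "?Q \<noteq> 0" "?U \<noteq> 0" "?W \<noteq> 0" "1 - ?Q ^ 2 \<noteq> 0" "1 - ?Q ^ 2 * ?W \<noteq> 0" "D \<noteq> 0"
    using one_minus_q2[OF exp_not_eq_zero q] one_minus_qm[OF exp_not_eq_zero q, of m] exp_nonroot_imp[OF q]
    by auto
  have "(- hco ?Q (Suc m)) * (- (?U / ?Q ^ 2 * (1 - ?Q ^ 2) / (1 - ?Q ^ 2 * ?W))) =
      (?U / ?W) * (1 / (?Q * D))"
  proof -
    have h: "(1 / (?Q ^ 2 * ?W) - 1) / (1 / ?Q ^ 2 - 1) = (1 - ?Q ^ 2 * ?W) / (?W * (1 - ?Q ^ 2))"
      using nz by (simp add: divide_simps)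
    show ?thesis unfolding hco_Suc h using nz by (simp add: divide_simps power2_eq_square)
  qed
  then show ?thesis
    by (simp add: x_coeff_Suc_right dminus_def mult_scaleC_left scaleC_scaleC)
qed

text \<open>The coefficient of F^l E^m k^2 in x Y = D x. The four terms on the left come from F
  moved past E^m, from its commutator with E^(m + 1), from the summand - e k of \<open>Y\<close>,
  and from its summand with k^2. All are combinations of t and 1/t times
  \<open>x_coeff L l m\<close>; the multiples of t cancel and those of 1/t add up to the multiple of
  d_+.\<close>

lemma x_coeff_k2:
  "u m *\<^sub>C (if l = 0 then 0 else x_coeff L (l - 1) m) + gco (exp L) (Suc m) *\<^sub>C x_coeff L l (Suc m) -
     (if m = 0 then 0 else x_coeff L l (m - 1)) + Y_coeff L * x_coeff L l m =
   (u m / u l) *\<^sub>C (dplus L * x_coeff L l m)"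
proof -
  let ?Q = "exp L" let ?U = "u l" let ?W = "u m"
  define A where "A = tvar L * x_coeff L l m"
  define B where "B = inverse (tvar L) * x_coeff L l m"
  have nz: "?Q \<noteq> 0" "?U \<noteq> 0" "?W \<noteq> 0" "1 - ?Q ^ 2 \<noteq> 0" "1 - ?Q ^ 2 * ?W \<noteq> 0"
    using one_minus_q2[OF exp_not_eq_zero q] one_minus_qm[OF exp_not_eq_zero q, of m]
    by auto
  have D: "D = - (1 - ?Q ^ 2) / ?Q" using nz by (simp add: divide_simps power2_eq_square)
  \<comment> \<open>The scalars that relate the coefficients at (l - 1, m), (l, m - 1) and (l, m +
    1) to the one at (l, m).\<close>
  define d where "d = - ((1 - ?U) * ?Q ^ 2 / (?U * ?W * (1 - ?Q ^ 2)))"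
  define b where "b = - ((1 - ?W) * ?Q ^ 2 / (?U * (1 - ?Q ^ 2)))"
  define a where "a = - (?U / ?Q ^ 2 * (1 - ?Q ^ 2) / (1 - ?Q ^ 2 * ?W))"
  have ga: "gco ?Q (Suc m) * a = - (?U / (?Q * D))"
  proof -
    have h: "(?Q ^ 2 * ?W - 1) / (?Q ^ 2 - 1) = (1 - ?Q ^ 2 * ?W) / (1 - ?Q ^ 2)"
      by (metis minus_diff_eq minus_divide_divide)
    show ?thesis unfolding gco_Suc h D a_def using nz by (simp add: divide_simps power2_eq_square)
  qed
  have cB: "?W * d - b + ?Q / D = ?W / ?U * (?Q / D)"
    unfolding D d_def b_def using nz by (simp add: divide_simps) (simp add: algebra_simps power2_eq_square)
  have cA: "- (?W * d * (?U / ?Q ^ 2)) + gco ?Q (Suc m) * a + 1 / (?Q * D) = 0"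
    unfolding ga D d_def using nz by (simp add: divide_simps) (simp add: algebra_simps power2_eq_square)
  have "?W *\<^sub>C (if l = 0 then 0 else x_coeff L (l - 1) m) + gco ?Q (Suc m) *\<^sub>C x_coeff L l (Suc m) -
     (if m = 0 then 0 else x_coeff L l (m - 1)) + Y_coeff L * x_coeff L l m =
     (?W * d) *\<^sub>C (B - (?U / ?Q ^ 2) *\<^sub>C A) + (gco ?Q (Suc m) * a) *\<^sub>C A - b *\<^sub>C B +
     ((1 / (?Q * D)) *\<^sub>C A + (?Q / D) *\<^sub>C B)"
    unfolding x_coeff_pred_left x_coeff_pred_right x_coeff_Suc_right Y_coeff_eq dminus_def dplus_def
    by (simp only: A_def B_def a_def b_def d_def scaleC_scaleC distrib_right mult_scaleC_left)
  also have "\<dots> = (?W * d - b + ?Q / D) *\<^sub>C B +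
      (- (?W * d * (?U / ?Q ^ 2)) + gco ?Q (Suc m) * a + 1 / (?Q * D)) *\<^sub>C A"
    by (simp only: cvs.scale_right_diff_distrib cvs.scale_left_diff_distrib scaleC_add_left scaleC_scaleC
        cvs.scale_minus_left) (simp add: algebra_simps)
  also have "\<dots> = (?W / ?U) *\<^sub>C (dplus L * x_coeff L l m)"
    unfolding cA cB by (simp add: B_def dplus_def mult_scaleC_left scaleC_scaleC)
  finally show ?thesis .
qed

end

text \<open>After clearing denominators the coefficients become polynomials in \<open>q\<^sup>-\<^sup>\<lambda>\<close>, of which only the
  leading one survives at \<open>q\<^sup>-\<^sup>\<lambda> = 0\<close>.\<close>

lemma x_coeff_polynomial:
  assumes "L \<noteq> 0" "l \<le> N"
  shows "\<exists>p. tpoly L (poch_poly (exp L) N) * x_coeff L l m = tpoly L p \<and>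
    poly p 0 = (if l = 0 \<and> m = 0 then 1 else 0)"
proof -
  interpret comm_ring_hom "tpoly L" by (rule tpoly_hom)
  \<comment> \<open>The factors of the common denominator that (t^2; q^2)_l does not
    contain.\<close>
  let ?r = "\<Prod>j\<in>{l..<N}. [:1, 0, - ((exp L ^ 2) ^ j):]"
  let ?p = "Polynomial.smult (cst (exp L) l m) ((- [:0, 1:]) ^ (l + m)) * ?r"
  have "poch_poly (exp L) N = poch_poly (exp L) l * ?r"
    unfolding poch_poly_def using assms(2)
    by (simp add: lessThan_atLeast0 prod.atLeastLessThan_concat)
  moreover have "tpoly L (poch_poly (exp L) l) \<noteq> 0"
    using tpoly_eq_0[OF assms(1)] poch_poly_nonzero by blast
  ultimately have "tpoly L (poch_poly (exp L) N) * x_coeff L l m =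
    cst (exp L) l m *\<^sub>C ((- tvar L) ^ (l + m) * tpoly L ?r)"
    by (simp add: x_coeff_eq hom_mult mult_scaleC_right)
  also have "\<dots> = tpoly L ?p"
    by (simp add: tpoly_mult tpoly_smult tvar_def hom_power hom_uminus mult_scaleC_left del: minus_pCons)
  finally have 1: "tpoly L (poch_poly (exp L) N) * x_coeff L l m = tpoly L ?p" .
  have "poly ?p 0 = (if l = 0 \<and> m = 0 then 1 else 0)"
    by (auto simp: poly_prod cst_def qpoch_def)
  with 1 show ?thesis by blast
qed

section \<open>Normal ordering\<close>

definition femono :: "nat \<Rightarrow> nat \<Rightarrow> free_alg" where
  "femono l m = gF ^ l * gE ^ m"

context
  fixes q :: complex
  assumes q0: "q \<noteq> 0"
begin

lemma qeq_mult_left: "qeq q x y \<Longrightarrow> qeq q (p * x) (p * y)"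
  by (rule qeq_mult[OF qeq_refl])

lemma qeq_mult_right: "qeq q x y \<Longrightarrow> qeq q (x * p) (y * p)"
  by (rule qeq_mult[OF _ qeq_refl])

lemma qcomm_kinv_e: "qcomm q (inverse q) gk_inv ge"
  using qcomm_inverse[of q q ge] qeq_basic(3)[of q] q0 by (simp add: qcomm_def)

lemma qcomm_kinv_f: "qcomm q q gk_inv gf"
  using qcomm_inverse[of q "inverse q" gf] qeq_basic(4)[of q] q0 by (simp add: qcomm_def)

lemma qcomm_kinv_E: "qcomm q (inverse q) gk_inv gE"
  using qcomm_inverse[OF qcomm_k_E] q0 by simp

lemma qcomm_kinv_F: "qcomm q q gk_inv gF"
  using qcomm_inverse[OF qcomm_k_F] q0 by simp

lemma kinv_k_cancel: "qeq q (gk_inv ^ (m + n) * gk ^ n) (gk_inv ^ m)"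
proof (induction n)
  case (Suc n)
  have "gk_inv ^ (m + Suc n) * gk ^ Suc n = gk_inv ^ (m + n) * (gk_inv * gk) * gk ^ n"
    by (simp only: add_Suc_right power_Suc2[of gk_inv] power_Suc[of gk] mult.assoc)
  also have "qeq q \<dots> (gk_inv ^ (m + n) * 1 * gk ^ n)"
    by (intro qeq_mult_right qeq_mult_left qeq_basic)
  also have "\<dots> = gk_inv ^ (m + n) * gk ^ n" by simp
  also note Suc
  finally show ?case .
qed simp

lemma k_kinv_cancel: "qeq q (gk ^ n * gk_inv ^ (n + m)) (gk_inv ^ m)"
proof (induction n)
  case (Suc n)
  have "gk ^ Suc n * gk_inv ^ (Suc n + m) = gk ^ n * (gk * gk_inv) * gk_inv ^ (n + m)"
    by (simp add: power_Suc2 mult.assoc del: power_Suc) (simp add: power_commutes)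
  also have "qeq q \<dots> (gk ^ n * 1 * gk_inv ^ (n + m))"
    by (intro qeq_mult_right qeq_mult_left qeq_basic)
  also have "\<dots> = gk ^ n * gk_inv ^ (n + m)" by simp
  also note Suc
  finally show ?case .
qed simp

text \<open>The relation for e f - f e, multiplied by q k^-2 once the inverses stand on the right;
  k^2 - k^-2 thereby becomes 1 - k^-4.\<close>

lemma E_F: "qeq q (gE * gF) (q ^ 2 *\<^sub>C (gF * gE) + (q / (q - inverse q)) *\<^sub>C (1 - gk_inv ^ 4))"
proof -
  let ?c = "1 / (q - inverse q)"
  have fe: "qeq q (gf * ge * gk_inv ^ 2) (q *\<^sub>C (gF * gE))"
  proof -
    have "gf * ge * gk_inv ^ 2 = q *\<^sub>C (gf * (inverse q *\<^sub>C (ge * gk_inv)) * gk_inv)"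
      using q0 by (simp add: mult_scaleC_left mult_scaleC_right scaleC_scaleC scaleC_one mult.assoc power2_eq_square)
    also have "qeq q \<dots> (q *\<^sub>C (gf * (gk_inv * ge) * gk_inv))"
      using qcomm_kinv_e unfolding qcomm_def
      by (intro qeq_scale qeq_mult_right qeq_mult_left qeq_sym[of q "gk_inv * ge"])
    finally show ?thesis by (simp add: mult.assoc)
  qed
  have kk: "qeq q (gk ^ 2 * gk_inv ^ 2) 1"
    using k_kinv_cancel[of 2 0] by simp
  have "gE * gF = ge * (gk_inv * gf) * gk_inv" by (simp add: mult.assoc)
  also have "qeq q \<dots> (ge * (q *\<^sub>C (gf * gk_inv)) * gk_inv)"
    using qcomm_kinv_f unfolding qcomm_def by (intro qeq_mult_right qeq_mult_left)
  also have "\<dots> = q *\<^sub>C ((ge * gf) * gk_inv ^ 2)"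
    by (simp add: mult_scaleC_left mult_scaleC_right mult.assoc power2_eq_square)
  also have "qeq q \<dots> (q *\<^sub>C ((gf * ge + ?c *\<^sub>C (gk ^ 2 - gk_inv ^ 2)) * gk_inv ^ 2))"
    by (intro qeq_scale qeq_mult_right qeq_basic)
  also have "\<dots> = q *\<^sub>C (gf * ge * gk_inv ^ 2 + ?c *\<^sub>C (gk ^ 2 * gk_inv ^ 2 - gk_inv ^ 4))"
    by (simp add: distrib_right mult_scaleC_left left_diff_distrib flip: power_add)
  also have "qeq q \<dots> (q *\<^sub>C (q *\<^sub>C (gF * gE) + ?c *\<^sub>C (1 - gk_inv ^ 4)))"
    by (intro qeq_scale qeq_add qeq_diff fe kk qeq_refl)
  finally show ?thesis
    by (simp add: scaleC_add_right scaleC_scaleC power2_eq_square)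
qed

text \<open>Induction by one more E in front: its commutator with F contributes the next summand of
  each geometric sum.\<close>

lemma Epow_F:
  "qeq q (gE ^ m * gF) ((q ^ 2) ^ m *\<^sub>C (gF * gE ^ m) + gco q m *\<^sub>C gE ^ (m - 1) -
     hco q m *\<^sub>C (gE ^ (m - 1) * gk_inv ^ 4))"
proof (induction m)
  case 0
  show ?case by (simp add: gco_def hco_def scaleC_one)
next
  case (Suc m)
  let ?\<kappa> = "q / (q - inverse q)"
  let ?P = "gE ^ m"
  \<comment> \<open>For m = 0 the truncated exponent m - 1 is harmless because
    \<open>gco q 0\<close> and \<open>hco q 0\<close> are empty sums.\<close>
  have pred: "gco q m *\<^sub>C (gE * gE ^ (m - 1)) = gco q m *\<^sub>C ?P"
    "hco q m *\<^sub>C (gE * gE ^ (m - 1) * x) = hco q m *\<^sub>C (?P * x)" for x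
    by (cases m; simp add: gco_def hco_def; fail)+
  have kP: "qeq q (gk_inv ^ 4 * ?P) ((inverse (q ^ 2) ^ m * inverse (q ^ 2) ^ m) *\<^sub>C (?P * gk_inv ^ 4))"
  proof -
    have 1: "qcomm q (inverse q ^ m) gk_inv ?P" by (rule qcomm_power[OF qcomm_kinv_E])
    have "qcomm q (inverse q ^ m * (inverse q ^ m * (inverse q ^ m * inverse q ^ m)))
       (gk_inv * (gk_inv * (gk_inv * gk_inv))) ?P"
      by (intro qcomm_mult_left 1)
    moreover have "inverse q ^ m * (inverse q ^ m * (inverse q ^ m * inverse q ^ m)) =
      inverse (q ^ 2) ^ m * inverse (q ^ 2) ^ m"
      by (simp add: power2_eq_square power_mult_distrib mult_ac)
    moreover have "gk_inv * (gk_inv * (gk_inv * gk_inv)) = gk_inv ^ 4" by (simp add: numeral_eq_Suc)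
    ultimately show ?thesis by (simp add: qcomm_def)
  qed
  have EFP: "qeq q (gE * gF * ?P) (q ^ 2 *\<^sub>C (gF * gE ^ Suc m) + ?\<kappa> *\<^sub>C ?P -
      (?\<kappa> * (inverse (q ^ 2) ^ m * inverse (q ^ 2) ^ m)) *\<^sub>C (?P * gk_inv ^ 4))"
  proof -
    have "qeq q (gE * gF * ?P) ((q ^ 2 *\<^sub>C (gF * gE) + ?\<kappa> *\<^sub>C (1 - gk_inv ^ 4)) * ?P)"
      by (rule qeq_mult_right[OF E_F])
    also have "\<dots> = q ^ 2 *\<^sub>C (gF * gE ^ Suc m) + ?\<kappa> *\<^sub>C (?P - gk_inv ^ 4 * ?P)"
      by (simp add: distrib_right mult_scaleC_left left_diff_distrib mult.assoc)
    also have "qeq q \<dots> (q ^ 2 *\<^sub>C (gF * gE ^ Suc m) + ?\<kappa> *\<^sub>C (?P -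
        (inverse (q ^ 2) ^ m * inverse (q ^ 2) ^ m) *\<^sub>C (?P * gk_inv ^ 4)))"
      by (intro qeq_add qeq_scale qeq_diff kP qeq_refl)
    finally show ?thesis by (simp add: cvs.scale_right_diff_distrib scaleC_scaleC add_diff_eq)
  qed
  have "gE ^ Suc m * gF = gE * (?P * gF)" by (simp add: mult.assoc)
  also have "qeq q \<dots> (gE * ((q ^ 2) ^ m *\<^sub>C (gF * ?P) + gco q m *\<^sub>C gE ^ (m - 1) -
     hco q m *\<^sub>C (gE ^ (m - 1) * gk_inv ^ 4)))"
    by (rule qeq_mult_left[OF Suc])
  also have "\<dots> = (q ^ 2) ^ m *\<^sub>C (gE * gF * ?P) + gco q m *\<^sub>C ?P - hco q m *\<^sub>C (?P * gk_inv ^ 4)"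
    by (simp only: distrib_left right_diff_distrib mult_scaleC_right mult.assoc[symmetric] pred)
  also have "qeq q \<dots> ((q ^ 2) ^ m *\<^sub>C (q ^ 2 *\<^sub>C (gF * gE ^ Suc m) + ?\<kappa> *\<^sub>C ?P -
      (?\<kappa> * (inverse (q ^ 2) ^ m * inverse (q ^ 2) ^ m)) *\<^sub>C (?P * gk_inv ^ 4)) +
      gco q m *\<^sub>C ?P - hco q m *\<^sub>C (?P * gk_inv ^ 4))"
    by (intro qeq_add qeq_diff qeq_scale EFP qeq_refl)
  also have "\<dots> = (q ^ 2) ^ Suc m *\<^sub>C (gF * gE ^ Suc m) + gco q (Suc m) *\<^sub>C ?P -
      hco q (Suc m) *\<^sub>C (?P * gk_inv ^ 4)"
  proof -
    have 1: "(q ^ 2) ^ m * (?\<kappa> * (inverse (q ^ 2) ^ m * inverse (q ^ 2) ^ m)) = ?\<kappa> * inverse (q ^ 2) ^ m"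
      using q0 by (simp add: power_inverse)
    show ?thesis
      unfolding scaleC_add_right cvs.scale_right_diff_distrib scaleC_scaleC 1
      by (simp add: gco_def hco_def distrib_left scaleC_add_left mult_ac)
  qed
  finally show ?case by simp
qed

lemma e_k: "qeq q (ge * gk) (gE * gk ^ 2)"
proof -
  have "ge * 1 * gk = ge * gk" by simp
  moreover have "qeq q (ge * 1 * gk) (ge * (gk_inv * gk) * gk)"
    by (intro qeq_mult_right qeq_mult_left qeq_sym[OF qeq_basic(2)])
  moreover have "ge * (gk_inv * gk) * gk = gE * gk ^ 2" by (simp add: mult.assoc power2_eq_square)
  ultimately show ?thesis by simp
qed

lemma f_k: "qeq q (gf * gk) (gF * gk ^ 2)"
proof -
  have "gf * 1 * gk = gf * gk" by simp
  moreover have "qeq q (gf * 1 * gk) (gf * (gk_inv * gk) * gk)"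
    by (intro qeq_mult_right qeq_mult_left qeq_sym[OF qeq_basic(2)])
  moreover have "gf * (gk_inv * gk) * gk = gF * gk ^ 2" by (simp add: mult.assoc power2_eq_square)
  ultimately show ?thesis by simp
qed

lemma femono_e_k: "qeq q (femono l m * (ge * gk)) (femono l (Suc m) * gk ^ 2)"
proof -
  have "qeq q (femono l m * (ge * gk)) (femono l m * (gE * gk ^ 2))"
    by (rule qeq_mult_left[OF e_k])
  also have "femono l m * (gE * gk ^ 2) = femono l (Suc m) * gk ^ 2"
    unfolding femono_def power_Suc2 by (simp add: mult.assoc)
  finally show ?thesis .
qed

text \<open>The only source of k^-2 when x Y is put into normal order: k^-4 from the commutator
  meets k^2 from f k = F k^2.\<close>

lemma femono_f_k:
  "qeq q (femono l m * (gf * gk)) ((q ^ 2) ^ m *\<^sub>C (femono (Suc l) m * gk ^ 2) +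
     gco q m *\<^sub>C (femono l (m - 1) * gk ^ 2) - hco q m *\<^sub>C (femono l (m - 1) * gk_inv ^ 2))"
proof -
  have "qeq q (femono l m * (gf * gk)) (femono l m * (gF * gk ^ 2))"
    by (rule qeq_mult_left[OF f_k])
  also have "femono l m * (gF * gk ^ 2) = gF ^ l * (gE ^ m * gF) * gk ^ 2"
    by (simp add: femono_def mult.assoc)
  also have "qeq q \<dots> (gF ^ l * ((q ^ 2) ^ m *\<^sub>C (gF * gE ^ m) + gco q m *\<^sub>C gE ^ (m - 1) -
     hco q m *\<^sub>C (gE ^ (m - 1) * gk_inv ^ 4)) * gk ^ 2)"
    by (intro qeq_mult_right qeq_mult_left Epow_F)
  also have "\<dots> = (q ^ 2) ^ m *\<^sub>C (femono (Suc l) m * gk ^ 2) +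
     gco q m *\<^sub>C (femono l (m - 1) * gk ^ 2) - hco q m *\<^sub>C (femono l (m - 1) * (gk_inv ^ 4 * gk ^ 2))"
    unfolding femono_def power_Suc2
    by (simp add: distrib_left distrib_right right_diff_distrib left_diff_distrib mult_scaleC_left
        mult_scaleC_right mult.assoc)
  also have "qeq q \<dots> ((q ^ 2) ^ m *\<^sub>C (femono (Suc l) m * gk ^ 2) +
     gco q m *\<^sub>C (femono l (m - 1) * gk ^ 2) - hco q m *\<^sub>C (femono l (m - 1) * gk_inv ^ 2))"
    using kinv_k_cancel[of 2 2] by (intro qeq_add qeq_diff qeq_scale qeq_mult_left qeq_refl) simp
  finally show ?thesis .
qed

lemma k2_femono:
  "qeq q (gk ^ 2 * femono l m) (((q ^ 2) ^ m / (q ^ 2) ^ l) *\<^sub>C (femono l m * gk ^ 2))"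
proof -
  have 1: "qcomm q (inverse q ^ l * q ^ m) gk (femono l m)"
    unfolding femono_def by (intro qcomm_mult_right qcomm_power qcomm_k_E qcomm_k_F)
  have "qcomm q (inverse q ^ l * q ^ m * (inverse q ^ l * q ^ m)) (gk * gk) (femono l m)"
    by (intro qcomm_mult_left 1)
  moreover have "inverse q ^ l * q ^ m * (inverse q ^ l * q ^ m) = (q ^ 2) ^ m / (q ^ 2) ^ l"
    using q0 by (simp add: power2_eq_square power_mult_distrib field_simps)
  ultimately show ?thesis by (simp add: qcomm_def power2_eq_square)
qed

lemma kinv2_femono:
  "qeq q (gk_inv ^ 2 * femono l m) (((q ^ 2) ^ l / (q ^ 2) ^ m) *\<^sub>C (femono l m * gk_inv ^ 2))"
proof -
  have 1: "qcomm q (q ^ l * inverse q ^ m) gk_inv (femono l m)"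
    unfolding femono_def by (intro qcomm_mult_right qcomm_power qcomm_kinv_E qcomm_kinv_F)
  have "qcomm q (q ^ l * inverse q ^ m * (q ^ l * inverse q ^ m)) (gk_inv * gk_inv) (femono l m)"
    by (intro qcomm_mult_left 1)
  moreover have "q ^ l * inverse q ^ m * (q ^ l * inverse q ^ m) = (q ^ 2) ^ l / (q ^ 2) ^ m"
    using q0 by (simp add: power2_eq_square power_mult_distrib field_simps)
  ultimately show ?thesis by (simp add: qcomm_def power2_eq_square)
qed

end

section \<open>Coordinates in finite-dimensional subspaces\<close>

definition Kcomb :: "functional list \<Rightarrow> (nat \<Rightarrow> K) \<Rightarrow> (K, functional) tensor" where
  "Kcomb bs c = (\<Sum>j<length bs. c j \<otimes>\<^sub>C (bs ! j))"

text \<open>A tensor involves finitely many functionals, each a combination of finitely many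
  elements of \<open>W\<close>.\<close>

lemma base_change_finite:
  assumes "V \<subseteq> cvs.span W" "t \<in> base_change V"
  shows "\<exists>S. finite S \<and> S \<subseteq> W \<and> t \<in> base_change (cvs.span S)"
  using assms(2)
proof (induction t rule: base_change_induct)
  case zero
  show ?case by (rule exI[of _ "{}"]) (simp add: base_change_zero)
next
  case (tensor c a)
  then have "a \<in> cvs.span W" using assms(1) by blast
  then obtain S r where S: "finite S" "S \<subseteq> W" "a = (\<Sum>x\<in>S. r x *\<^sub>C x)"
    unfolding cvs.span_explicit by blast
  have "a \<in> cvs.span S"
    unfolding S(3) by (intro cvs.span_sum cvs.span_scale cvs.span_base)
  then show ?case using S(1,2) base_change_tensor[of a "cvs.span S" c] by blast
next
  case (add s t)
  then obtain S T where ST: "finite S" "S \<subseteq> W" "s \<in> base_change (cvs.span S)"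
    "finite T" "T \<subseteq> W" "t \<in> base_change (cvs.span T)" by blast
  have "base_change (cvs.span S) \<subseteq> base_change (cvs.span (S \<union> T))"
    "base_change (cvs.span T) \<subseteq> base_change (cvs.span (S \<union> T))"
    by (intro base_change_mono cvs.span_mono; blast)+
  then have "s + t \<in> base_change (cvs.span (S \<union> T))"
    using ST by (intro base_change_add) auto
  then show ?case using ST by (intro exI[of _ "S \<union> T"]) auto
qed

text \<open>The coordinate forms are extended from the basis to all functionals, so that they can be
  applied inside the tensor product.\<close>

lemma finite_basis:
  assumes "finite (S :: functional set)"
  obtains bs \<phi> where "distinct bs" "set bs \<subseteq> S" "cvs.span (set bs) = cvs.span S"
    "\<And>i. clinear (\<phi> i)"
    "\<And>i j. i < length bs \<Longrightarrow> j < length bs \<Longrightarrow> \<phi> i (bs ! j) = (if i = j then 1 else 0 :: complex)"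
proof -
  obtain B where B: "B \<subseteq> S" "cvs.independent B" "S \<subseteq> cvs.span B"
    using cvs.maximal_independent_subset[of S] by blast
  have "finite B" using B(1) assms finite_subset by blast
  then obtain bs where bs: "set bs = B" "distinct bs" using finite_distinct_list by blast
  have "\<exists>\<phi>. clinear \<phi> \<and> (\<forall>x\<in>B. \<phi> x = (if x = bs ! i then 1 else 0 :: complex))" for i
    by (rule cvs.linear_independent_extend[OF B(2)])
  then have "\<forall>i. \<exists>\<phi>. clinear \<phi> \<and> (\<forall>x\<in>B. \<phi> x = (if x = bs ! i then 1 else 0 :: complex))"
    by blast
  from choice[OF this] obtain \<phi> where \<phi>: "\<And>i. clinear (\<phi> i)"
    "\<And>i x. x \<in> B \<Longrightarrow> \<phi> i x = (if x = bs ! i then 1 else 0 :: complex)"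
    by blast
  have "cvs.span B = cvs.span S"
    unfolding cvs.span_eq using B(1,3) cvs.span_superset[of S] by blast
  moreover have "\<phi> i (bs ! j) = (if i = j then 1 else 0)" if "i < length bs" "j < length bs" for i j
    using that bs \<phi>(2)[of "bs ! j" i] nth_mem[of j bs] by (auto simp: nth_eq_iff_index_eq)
  ultimately show ?thesis using that[of bs \<phi>] bs B(1) \<phi>(1) by blast
qed

lemma span_dual_expansion:
  assumes \<phi>: "\<And>i. clinear (\<phi> i)"
    "\<And>i j. i < length bs \<Longrightarrow> j < length bs \<Longrightarrow> \<phi> i (bs ! j) = (if i = j then 1 else 0 :: complex)"
    and "a \<in> cvs.span (set bs)"
  shows "a = (\<Sum>i<length bs. \<phi> i a *\<^sub>C (bs ! i :: functional))"
  using assms(3)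
proof (induction rule: cvs.span_induct_alt)
  case base
  show ?case by (simp only: cvs.linear_0[OF \<phi>(1)] cvs.scale_zero_left sum.neutral_const)
next
  case (step c x y)
  then obtain j where j: "j < length bs" "x = bs ! j" by (auto simp: in_set_conv_nth)
  have "(\<Sum>i<length bs. \<phi> i x *\<^sub>C bs ! i) = (\<Sum>i<length bs. if i = j then x else 0)"
    by (rule sum.cong) (use j \<phi>(2) in \<open>auto simp: scaleC_one\<close>)
  then have "(\<Sum>i<length bs. \<phi> i x *\<^sub>C bs ! i) = x" using j by simp
  then have "c *\<^sub>C x + y = c *\<^sub>C (\<Sum>i<length bs. \<phi> i x *\<^sub>C bs ! i) + (\<Sum>i<length bs. \<phi> i y *\<^sub>C bs ! i)"
    using step by simp
  also have "\<dots> = (\<Sum>i<length bs. \<phi> i (c *\<^sub>C x + y) *\<^sub>C bs ! i)"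
    by (simp add: cvs.linear_add[OF \<phi>(1)] cvs.linear_scale[OF \<phi>(1)] scaleC_add_left sum.distrib
        cvs.scale_sum_right scaleC_scaleC scaleC_complex_def)
  finally show ?case .
qed

lemma base_change_Kcomb:
  assumes "\<And>i. clinear (\<phi> i)"
    "\<And>i j. i < length bs \<Longrightarrow> j < length bs \<Longrightarrow> \<phi> i (bs ! j) = (if i = j then 1 else 0 :: complex)"
    and "t \<in> base_change (cvs.span (set bs))"
  shows "\<exists>c. t = Kcomb bs c"
  using assms(3)
proof (induction t rule: base_change_induct)
  case zero
  show ?case by (rule exI[of _ "\<lambda>_. 0"]) (simp add: Kcomb_def)
next
  case (tensor c a)
  have "c \<otimes>\<^sub>C a = c \<otimes>\<^sub>C (\<Sum>i<length bs. \<phi> i a *\<^sub>C (bs ! i))"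
    using span_dual_expansion[OF assms(1,2) tensor] by simp
  also have "\<dots> = Kcomb bs (\<lambda>i. \<phi> i a *\<^sub>C c)"
    by (simp add: Kcomb_def tensor_sum_right tensor_bil)
  finally show ?case by blast
next
  case (add s t)
  then obtain c d where "s = Kcomb bs c" "t = Kcomb bs d" by blast
  then have "s + t = Kcomb bs (\<lambda>i. c i + d i)"
    by (simp add: Kcomb_def tensor_bil sum.distrib)
  then show ?case by blast
qed

text \<open>A complex basis stays independent over K: the map sending d \<otimes> a to \<phi>_i(a) d
  takes values in K and extracts the i-th coordinate.\<close>

lemma Kcomb_eq_0D:
  assumes \<phi>: "\<And>i. clinear (\<phi> i)"
    "\<And>i j. i < length bs \<Longrightarrow> j < length bs \<Longrightarrow> \<phi> i (bs ! j) = (if i = j then 1 else 0 :: complex)"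
    and "Kcomb bs c = 0" and i: "i < length bs"
  shows "c i = 0"
proof -
  have bil: "cbilinear (\<lambda>(d::K) a. \<phi> i a *\<^sub>C d)"
    using \<phi>(1)[of i] unfolding cbilinear_def clinear_iff
    by (simp add: scaleC_add_left scaleC_add_right scaleC_scaleC scaleC_complex_def mult.commute)
  have "0 = tensor_lift (\<lambda>(d::K) a. \<phi> i a *\<^sub>C d) (Kcomb bs c)"
    by (simp add: assms(3) cvs.linear_0[OF clinear_tensor_lift])
  also have "\<dots> = (\<Sum>j<length bs. \<phi> i (bs ! j) *\<^sub>C c j)"
    unfolding Kcomb_def cvs.linear_sum[OF clinear_tensor_lift] by (simp add: tensor_lift_tensor[OF bil])
  also have "\<dots> = (\<Sum>j<length bs. if j = i then c i else 0)"
    by (rule sum.cong) (use i \<phi>(2) in \<open>auto simp: scaleC_one\<close>)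
  finally show ?thesis using i by simp
qed

text \<open>Up to the factor \<open>d\<close> the matrix consists of polynomials in t and is the
  identity at t = 0. Its determinant has the value 1 there, so it is not the zero polynomial and is
  invertible in F.\<close>

lemma tpoly_matrix_inverse:
  fixes m :: "nat \<Rightarrow> nat \<Rightarrow> mero"
  assumes L: "L \<noteq> 0"
    and m: "\<And>i j. i < n \<Longrightarrow> j < n \<Longrightarrow> tpoly L d * m i j = tpoly L (p i j)"
    and p: "\<And>i j. i < n \<Longrightarrow> j < n \<Longrightarrow> poly (p i j) 0 = (if i = j then 1 else 0)"
  obtains w where
    "\<forall>i<n. \<forall>j<n. (\<Sum>k<n. m i k * w k j) = (if i = j then 1 else 0)"
    "\<forall>i<n. \<forall>j<n. (\<Sum>k<n. w i k * m k j) = (if i = j then 1 else 0)"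
proof -
  interpret T: comm_ring_hom "tpoly L" by (rule tpoly_hom)
  have E: "comm_ring_hom (\<lambda>p :: complex poly. poly p 0)" by unfold_locales simp_all
  define P where "P = mat n n (\<lambda>(i, j). p i j)"
  have P: "P \<in> carrier_mat n n" by (simp add: P_def)
  have "map_mat (\<lambda>p. poly p 0) P = 1\<^sub>m n"
    by (rule eq_matI) (auto simp: P_def p)
  then have "poly (det P) 0 = 1" using comm_ring_hom.hom_det[OF E, of P] by simp
  then have D: "tpoly L (det P) \<noteq> 0" using tpoly_eq_0[OF L] by fastforce
  \<comment> \<open>Cramer's rule, with the cleared denominator \<open>d\<close> put back.\<close>
  define w where "w i j = tpoly L d * tpoly L (adj_mat P $$ (i, j)) / tpoly L (det P)" for i j
  have adj: "adj_mat P \<in> carrier_mat n n" by (rule adj_mat(1)[OF P])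
  have ent: "(A * B) $$ (i, j) = (\<Sum>k<n. A $$ (i, k) * B $$ (k, j))"
    if "A \<in> carrier_mat n n" "B \<in> carrier_mat n n" "i < n" "j < n" for A B :: "complex poly mat" and i j
    using that by (simp add: scalar_prod_def atLeast0LessThan)
  have "(\<Sum>k<n. m i k * w k j) = (if i = j then 1 else 0)" if ij: "i < n" "j < n" for i j
  proof -
    have "(\<Sum>k<n. m i k * w k j) = (\<Sum>k<n. tpoly L (P $$ (i, k)) * tpoly L (adj_mat P $$ (k, j))) / tpoly L (det P)"
      unfolding sum_divide_distrib by (rule sum.cong) (use ij in \<open>auto simp: w_def P_def m[symmetric] mult_ac\<close>)
    also have "\<dots> = tpoly L ((P * adj_mat P) $$ (i, j)) / tpoly L (det P)"
      by (simp add: ent[OF P adj ij] T.hom_sum T.hom_mult)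
    also have "\<dots> = (if i = j then 1 else 0)"
      unfolding adj_mat(2)[OF P] using ij D by simp
    finally show ?thesis .
  qed
  moreover have "(\<Sum>k<n. w i k * m k j) = (if i = j then 1 else 0)" if ij: "i < n" "j < n" for i j
  proof -
    have "(\<Sum>k<n. w i k * m k j) = (\<Sum>k<n. tpoly L (adj_mat P $$ (i, k)) * tpoly L (P $$ (k, j))) / tpoly L (det P)"
      unfolding sum_divide_distrib by (rule sum.cong) (use ij in \<open>auto simp: w_def P_def m[symmetric] mult_ac\<close>)
    also have "\<dots> = tpoly L ((adj_mat P * P) $$ (i, j)) / tpoly L (det P)"
      by (simp add: ent[OF adj P ij] T.hom_sum T.hom_mult)
    also have "\<dots> = (if i = j then 1 else 0)"
      unfolding adj_mat(3)[OF P] using ij D by simp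
    finally show ?thesis .
  qed
  ultimately show ?thesis using that by blast
qed

section \<open>The regular actions\<close>

text \<open>The left and the right regular action are treated at once: they differ only in the order in
  which they compose, and the relations used below are identities in the quantized enveloping algebra.\<close>

locale regular_action =
  fixes L :: complex and act :: "free_alg \<Rightarrow> functional \<Rightarrow> functional" and \<iota> :: "mero \<Rightarrow> K"
  assumes q: "\<forall>n>0. exp L ^ n \<noteq> 1"
    and act_clinear: "clinear (act p)"
    and act_add: "a \<in> Aq L \<Longrightarrow> act (p + r) a = act p a + act r a"
    and act_scale: "a \<in> Aq L \<Longrightarrow> act (c *\<^sub>C p) a = c *\<^sub>C act p a"
    and act_one: "a \<in> Aq L \<Longrightarrow> act 1 a = a"
    and act_mult: "(\<forall>p r a. act (p * r) a = act p (act r a)) \<or> (\<forall>p r a. act (p * r) a = act r (act p a))"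
    and act_cong: "qeq (exp L) p r \<Longrightarrow> act p = act r"
    and act_lfin: "a \<in> Aq L \<Longrightarrow> \<exists>S N. lfin L act S N \<and> a \<in> cvs.span S"
    and \<iota>_hom: "comm_ring_hom \<iota>"
    and \<iota>_scale: "\<iota> (c *\<^sub>C f) = c *\<^sub>C \<iota> f"
begin

sublocale \<iota>: comm_ring_hom \<iota> by (rule \<iota>_hom)

lemma L0: "L \<noteq> 0"
  using exp_nonroot_imp[OF q] by blast

lemma Aq_subspace: "cvs.subspace (Aq L)"
  unfolding Aq_def by (rule cvs.subspace_span)

lemma act_span:
  assumes "\<And>s. s \<in> S \<Longrightarrow> act p s \<in> V" "cvs.subspace V" "a \<in> cvs.span S"
  shows "act p a \<in> V"
  using assms(3)
proof (induction rule: cvs.span_induct_alt)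
  case base
  show ?case using cvs.subspace_0[OF assms(2)] by (simp only: cvs.linear_0[OF act_clinear])
next
  case (step c x y)
  then show ?case
    unfolding cvs.linear_add[OF act_clinear] cvs.linear_scale[OF act_clinear]
    using assms(1,2) by (intro cvs.subspace_add cvs.subspace_scale)
qed

lemma act_Aq:
  assumes "a \<in> Aq L" shows "act p a \<in> Aq L"
proof -
  obtain S N where S: "lfin L act S N" "a \<in> cvs.span S" using act_lfin[OF assms] by blast
  have "act p a \<in> cvs.span S"
    by (rule act_span[OF _ cvs.subspace_span S(2)]) (use S(1) in \<open>auto simp: lfin_def\<close>)
  also have "cvs.span S \<subseteq> Aq L"
    using S(1) Aq_subspace by (simp add: lfin_def cvs.span_minimal)
  finally show ?thesis .
qed

definition A :: "free_alg \<Rightarrow> (K, functional) tensor \<Rightarrow> (K, functional) tensor" where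
  "A p = Kmap (act p)"

sublocale A: Modules.module_hom Kscale Kscale "A p" for p
  unfolding A_def by (rule module_hom_Kmap[OF act_clinear])

lemma A_AK: "t \<in> AK L \<Longrightarrow> A p t \<in> AK L"
  unfolding A_def by (rule base_change_Kmap[OF act_clinear act_Aq])

lemma A_cong: "qeq (exp L) p r \<Longrightarrow> A p = A r"
  by (simp add: A_def act_cong)

context
  fixes t assumes t: "t \<in> AK L"
begin

lemma A_plus: "A (p + r) t = A p t + A r t"
proof -
  have *: "clinear (\<lambda>a. act p a + act r a)"
    using act_clinear[of p] act_clinear[of r] by (simp add: clinear_iff scaleC_add_right add_ac)
  have "A (p + r) t = Kmap (\<lambda>a. act p a + act r a) t"
    unfolding A_def by (rule Kmap_cong[OF act_clinear * act_add t])
  also have "\<dots> = A p t + A r t"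
    unfolding A_def
    by (induction t rule: tensor_induct) (simp_all only: Kmap_tensor[OF *] Kmap_tensor[OF act_clinear] Kmap_add tensor_bil add_ac)
  finally show ?thesis .
qed

lemma A_scale_left: "A (c *\<^sub>C p) t = c *\<^sub>C A p t"
proof -
  have *: "clinear (\<lambda>a. c *\<^sub>C act p a)"
    using act_clinear[of p] by (simp add: clinear_iff scaleC_add_right scaleC_scaleC mult.commute)
  have "A (c *\<^sub>C p) t = Kmap (\<lambda>a. c *\<^sub>C act p a) t"
    unfolding A_def by (rule Kmap_cong[OF act_clinear * act_scale t])
  also have "\<dots> = c *\<^sub>C A p t"
    unfolding A_def
    by (induction t rule: tensor_induct)
      (simp_all add: Kmap_tensor * act_clinear Kmap_add tensor_bil scaleC_add_right)
  finally show ?thesis .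
qed

lemma A_minus: "A (p - r) t = A p t - A r t"
  using A_plus[of p "(- 1) *\<^sub>C r"] A_scale_left[of "- 1" r] by (simp add: cvs.scale_minus_left scaleC_one)

lemma A_one: "A 1 t = t"
proof -
  have *: "clinear (\<lambda>a :: functional. a)" by (simp add: clinear_iff)
  have "A 1 t = Kmap (\<lambda>a. a) t"
    unfolding A_def by (rule Kmap_cong[OF act_clinear * act_one t])
  also have "\<dots> = t"
    by (induction t rule: tensor_induct) (simp_all add: Kmap_tensor * Kmap_add)
  finally show ?thesis .
qed

end

definition vanish :: "nat \<Rightarrow> (K, functional) tensor \<Rightarrow> bool" where
  "vanish N t \<longleftrightarrow> (\<forall>l m p. l \<ge> N \<or> m \<ge> N \<longrightarrow> A (femono l m * p) t = 0)"

lemma vanish_mono: "vanish N t \<Longrightarrow> N \<le> M \<Longrightarrow> vanish M t"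
  unfolding vanish_def by (meson order_trans)

lemma vanish_span:
  assumes "lfin L act S N" "t \<in> base_change (cvs.span S)" shows "vanish N t"
  using assms(2)
proof (induction t rule: base_change_induct)
  case zero
  show ?case by (simp add: vanish_def A.zero)
next
  case (tensor c a)
  have "act (femono l m * p) a = 0" if "l \<ge> N \<or> m \<ge> N" for l m p
  proof -
    have "act (femono l m * p) s \<in> {0}" if "s \<in> S" for s
      using assms(1) that \<open>l \<ge> N \<or> m \<ge> N\<close> unfolding lfin_def femono_def by auto
    then have "act (femono l m * p) a \<in> {0}"
      by (rule act_span[OF _ cvs.subspace_single_0 tensor])
    then show ?thesis by blast
  qed
  then show ?case by (simp add: vanish_def A_def Kmap_tensor[OF act_clinear])
next
  case (add s t)
  then show ?case by (simp add: vanish_def A.add)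
qed

lemma AK_lfin:
  assumes "t \<in> AK L" shows "\<exists>S N. lfin L act S N \<and> t \<in> base_change (cvs.span S)"
  using assms
proof (induction t rule: base_change_induct)
  case zero
  show ?case by (rule exI[of _ "{}"]) (simp add: lfin_def base_change_zero)
next
  case (tensor c a)
  then show ?case using act_lfin base_change_tensor by blast
next
  case (add s t)
  then obtain S N T M where *: "lfin L act S N" "s \<in> base_change (cvs.span S)"
    "lfin L act T M" "t \<in> base_change (cvs.span T)" by blast
  have "base_change (cvs.span S) \<subseteq> base_change (cvs.span (S \<union> T))"
    "base_change (cvs.span T) \<subseteq> base_change (cvs.span (S \<union> T))"
    by (intro base_change_mono cvs.span_mono; blast)+
  then have "s + t \<in> base_change (cvs.span (S \<union> T))"
    using * by (intro base_change_add) auto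
  then show ?case using lfin_union[OF *(1,3)] by blast
qed

lemma AK_vanish: "t \<in> AK L \<Longrightarrow> \<exists>N. vanish N t"
  using AK_lfin vanish_span by blast

text \<open>F acts through \<iota>, hence by functions of one of the two variables alone.\<close>

definition smul :: "mero \<Rightarrow> (K, functional) tensor \<Rightarrow> (K, functional) tensor" where
  "smul f = Kscale (\<iota> f)"

lemma smul_simps:
  "smul f (s + t) = smul f s + smul f t" "smul f (s - t) = smul f s - smul f t"
  "smul (f + g) t = smul f t + smul g t" "smul (f - g) t = smul f t - smul g t"
  "smul f (smul g t) = smul (f * g) t" "smul f (c *\<^sub>C t) = smul (c *\<^sub>C f) t"
  "c *\<^sub>C smul f t = smul (c *\<^sub>C f) t"
  "smul 0 t = 0" "smul f 0 = 0" "smul 1 t = t"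
proof -
  show "c *\<^sub>C smul f t = smul (c *\<^sub>C f) t"
    unfolding smul_def \<iota>_scale Kscale_scaleC[symmetric] K.scale_scale by (simp add: mult_scaleC_left)
  then show "smul f (c *\<^sub>C t) = smul (c *\<^sub>C f) t"
    by (simp add: smul_def Kscale_scaleC_right)
qed (simp_all add: smul_def K.scale_right_distrib K.scale_right_diff_distrib K.scale_left_distrib
   K.scale_left_diff_distrib \<iota>.hom_add \<iota>.hom_minus \<iota>.hom_mult)

lemma smul_minus: "smul (- f) t = - smul f t"
  by (simp add: smul_def \<iota>.hom_uminus)

lemma smul_AK: "t \<in> AK L \<Longrightarrow> smul f t \<in> AK L"
  unfolding smul_def by (rule base_change_Kscale)

lemma A_smul: "A p (smul f t) = smul f (A p t)"
  by (simp add: smul_def A.scale)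

section \<open>The operators given by x, Y and D\<close>

definition xop :: "(K, functional) tensor \<Rightarrow> (K, functional) tensor" where
  "xop t = Sum_any (\<lambda>(l, m). smul (x_coeff L l m) (A (femono l m) t))"

definition Yop :: "(K, functional) tensor \<Rightarrow> (K, functional) tensor" where
  "Yop t = A (gf * gk) t - A (ge * gk) t + smul (Y_coeff L) (A (gk ^ 2 - 1) t)"

definition Dop :: "(K, functional) tensor \<Rightarrow> (K, functional) tensor" where
  "Dop t = smul (dminus L) (A (gk_inv ^ 2 - 1) t) + smul (dplus L) (A (gk ^ 2 - 1) t)"

lemma smul_Kscale: "smul f (Kscale c t) = Kscale c (smul f t)"
  by (simp add: smul_def K.scale_scale mult.commute)

lemma module_hom_Yop: "Modules.module_hom Kscale Kscale Yop"
  by (rule Modules.module_hom.intro[OF K.module_axioms K.module_axioms], unfold_locales)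
    (simp_all add: Yop_def A.add A.scale smul_simps smul_Kscale K.scale_right_distrib
      K.scale_right_diff_distrib)

lemma module_hom_Dop: "Modules.module_hom Kscale Kscale Dop"
  by (rule Modules.module_hom.intro[OF K.module_axioms K.module_axioms], unfold_locales)
    (simp_all add: Dop_def A.add A.scale smul_simps smul_Kscale K.scale_right_distrib)

lemma Yop_AK: "t \<in> AK L \<Longrightarrow> Yop t \<in> AK L"
proof -
  assume t: "t \<in> AK L"
  have "A (gf * gk) t + Kscale (- 1) (A (ge * gk) t) + smul (Y_coeff L) (A (gk ^ 2 - 1) t) \<in> AK L"
    by (intro base_change_add base_change_Kscale smul_AK A_AK t)
  then show ?thesis by (simp add: Yop_def)
qed

lemma Dop_AK: "t \<in> AK L \<Longrightarrow> Dop t \<in> AK L"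
  unfolding Dop_def by (intro base_change_add smul_AK A_AK)

text \<open>Any range beyond the vanishing index may be used, so that several vectors can be
  expanded over the same range.\<close>

lemma xop_finite:
  assumes "vanish N t" "N \<le> M"
  shows "xop t = (\<Sum>l<M. \<Sum>m<M. smul (x_coeff L l m) (A (femono l m) t))"
proof -
  have "A (femono l m) t = 0" if "l \<ge> M \<or> m \<ge> M" for l m
  proof -
    have "A (femono l m * 1) t = 0" using vanish_mono[OF assms] that unfolding vanish_def by blast
    then show ?thesis by simp
  qed
  then have "{i. (case i of (l, m) \<Rightarrow> smul (x_coeff L l m) (A (femono l m) t)) \<noteq> 0} \<subseteq> {..<M} \<times> {..<M}"
    by (auto simp: smul_simps not_le[symmetric])
  then have "xop t = (\<Sum>(l, m)\<in>{..<M} \<times> {..<M}. smul (x_coeff L l m) (A (femono l m) t))"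
    unfolding xop_def by (intro Sum_any.expand_superset) auto
  then show ?thesis by (simp add: sum.cartesian_product)
qed

lemma xop_AK: "t \<in> AK L \<Longrightarrow> xop t \<in> AK L"
proof -
  assume t: "t \<in> AK L"
  then obtain N where N: "vanish N t" using AK_vanish by blast
  show ?thesis
    unfolding xop_finite[OF N order_refl] by (intro base_change_sum smul_AK A_AK t)
qed

text \<open>Applied to scalars of K and to the operators of the regular action on the other side,
  which commute with every \<open>A p\<close>.\<close>

lemma xop_hom:
  assumes \<Phi>: "Modules.module_hom Kscale Kscale \<Phi>" and comm: "\<And>p. A p (\<Phi> t) = \<Phi> (A p t)"
    and t: "t \<in> AK L"
  shows "xop (\<Phi> t) = \<Phi> (xop t)"
proof -
  obtain N where N: "vanish N t" using t AK_vanish by blast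
  have "vanish N (\<Phi> t)" using N by (simp add: vanish_def comm Modules.module_hom.zero[OF \<Phi>])
  then show ?thesis
    unfolding xop_finite[OF N order_refl] xop_finite[OF \<open>vanish N (\<Phi> t)\<close> order_refl]
    by (simp add: comm Modules.module_hom.sum[OF \<Phi>] smul_def Modules.module_hom.scale[OF \<Phi>])
qed

lemma xop_Kscale: "t \<in> AK L \<Longrightarrow> xop (Kscale c t) = Kscale c (xop t)"
proof (rule xop_hom)
  show "Modules.module_hom Kscale Kscale (Kscale c)"
    by (rule Modules.module_hom.intro[OF K.module_axioms K.module_axioms], unfold_locales)
      (simp_all add: K.scale_right_distrib mult.commute)
qed (simp add: A.scale)

lemma xop_diff:
  assumes "s \<in> AK L" "t \<in> AK L" shows "xop (s - t) = xop s - xop t"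
proof -
  obtain N M where "vanish N s" "vanish M t" using assms AK_vanish by blast
  then have v: "vanish (max N M) s" "vanish (max N M) t" by (auto intro: vanish_mono)
  then have "vanish (max N M) (s - t)" by (simp add: vanish_def A.diff)
  then show ?thesis
    unfolding xop_finite[OF v(1) order_refl] xop_finite[OF v(2) order_refl]
      xop_finite[OF \<open>vanish (max N M) (s - t)\<close> order_refl]
    by (simp add: A.diff smul_simps sum_subtractf)
qed

section \<open>The intertwining relation x Y = D x\<close>

text \<open>Reindexing within a fixed range: the term at M drops out by assumption and the one at 0
  has coefficient 0.\<close>

lemma sum_shift_up:
  assumes "Z M = 0"
  shows "(\<Sum>l<M. smul (f l) (Z (Suc l))) = (\<Sum>l<M. smul (if l = 0 then 0 else f (l - 1)) (Z l))"
proof -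
  define G where "G l = smul (if l = 0 then 0 else f (l - 1)) (Z l)" for l
  have "(\<Sum>l<M. G (Suc l)) = (\<Sum>l<M. G l)"
    using sum.lessThan_Suc_shift[of G M] assms by (simp add: G_def smul_simps)
  then show ?thesis by (simp add: G_def)
qed

lemma sum_shift_down:
  assumes "f 0 = 0" "Z (M - 1) = 0"
  shows "(\<Sum>m<M. smul (f m) (Z (m - 1))) = (\<Sum>m<M. smul (f (Suc m)) (Z m))"
  using sum.lessThan_Suc_shift[of "\<lambda>m. smul (f m) (Z (m - 1))" M] assms by (simp add: smul_simps)

text \<open>The truncated relation x Y = D x. All products are formed inside \<open>A\<close>,
  before an order of composition is chosen, so the identity serves both actions. The bound is strict
  since shifting m by one needs the monomials at M - 1 to vanish.\<close>

lemma intertwining_sum: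
  assumes t: "t \<in> AK L" and N: "vanish N t" and M: "M > N"
  shows "(\<Sum>l<M. \<Sum>m<M. smul (x_coeff L l m) (A (femono l m * (gf * gk)) t - A (femono l m * (ge * gk)) t +
      smul (Y_coeff L) (A (femono l m * (gk ^ 2 - 1)) t))) =
    (\<Sum>l<M. \<Sum>m<M. smul (x_coeff L l m) (smul (dminus L) (A ((gk_inv ^ 2 - 1) * femono l m) t) +
      smul (dplus L) (A ((gk ^ 2 - 1) * femono l m) t)))"
proof -
  define c where "c = x_coeff L"
  \<comment> \<open>The values of the normally ordered monomials F^l E^m k^j for j = 2, -2,
    0.\<close>
  define Zp where "Zp l m = A (femono l m * gk ^ 2) t" for l m
  define Zm where "Zm l m = A (femono l m * gk_inv ^ 2) t" for l m
  define Z0 where "Z0 l m = A (femono l m) t" for l m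
  define u where "u l = (exp L ^ 2) ^ l" for l
  define g where "g = gco (exp L)"
  define h where "h = hco (exp L)"
  have zero: "Zp l m = 0" "Zm l m = 0" if "l \<ge> N \<or> m \<ge> N" for l m
    using N that unfolding vanish_def Zp_def Zm_def by blast+
  have zero': "Zp l (M - 1) = 0" "Zm l (M - 1) = 0" for l
  proof -
    have "N \<le> M - 1" using M by linarith
    then show "Zp l (M - 1) = 0" "Zm l (M - 1) = 0" using zero by blast+
  qed
  have gh0: "g 0 = 0" "h 0 = 0" by (simp_all add: g_def h_def gco_def hco_def)
  note e0 = exp_not_eq_zero[of L]
  have f_k: "A (femono l m * (gf * gk)) t = u m *\<^sub>C Zp (Suc l) m + g m *\<^sub>C Zp l (m - 1) - h m *\<^sub>C Zm l (m - 1)" for l m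
    unfolding A_cong[OF femono_f_k[OF e0]]
    by (simp add: A_plus[OF t] A_minus[OF t] A_scale_left[OF t] Zp_def Zm_def u_def g_def h_def)
  have e_k: "A (femono l m * (ge * gk)) t = Zp l (Suc m)" for l m
    unfolding A_cong[OF femono_e_k[OF e0]] by (simp add: Zp_def)
  have k2: "A (femono l m * (gk ^ 2 - 1)) t = Zp l m - Z0 l m" for l m
    by (simp add: right_diff_distrib A_minus[OF t] Zp_def Z0_def)
  have k2': "A ((gk ^ 2 - 1) * femono l m) t = (u m / u l) *\<^sub>C Zp l m - Z0 l m" for l m
    unfolding left_diff_distrib A_minus[OF t] A_cong[OF k2_femono[OF e0]] A_scale_left[OF t]
    by (simp add: Zp_def Z0_def u_def)
  have kinv2': "A ((gk_inv ^ 2 - 1) * femono l m) t = (u l / u m) *\<^sub>C Zm l m - Z0 l m" for l m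
    unfolding left_diff_distrib A_minus[OF t] A_cong[OF kinv2_femono[OF e0]] A_scale_left[OF t]
    by (simp add: Zm_def Z0_def u_def)
  have "smul (c l m) (A (femono l m * (gf * gk)) t - A (femono l m * (ge * gk)) t +
      smul (Y_coeff L) (A (femono l m * (gk ^ 2 - 1)) t)) =
    smul (u m *\<^sub>C c l m) (Zp (Suc l) m) + smul (g m *\<^sub>C c l m) (Zp l (m - 1)) -
    smul (h m *\<^sub>C c l m) (Zm l (m - 1)) - smul (c l m) (Zp l (Suc m)) +
    smul (Y_coeff L * c l m) (Zp l m) - smul (Y_coeff L * c l m) (Z0 l m)" for l m
    by (simp only: f_k e_k k2 smul_simps add_diff_eq mult.commute[of "Y_coeff L"])
  note summand = this
  have shift_l: "(\<Sum>l<M. \<Sum>m<M. smul (u m *\<^sub>C c l m) (Zp (Suc l) m)) =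
    (\<Sum>l<M. \<Sum>m<M. smul (u m *\<^sub>C (if l = 0 then 0 else c (l - 1) m)) (Zp l m))"
  proof -
    have "(\<Sum>l<M. \<Sum>m<M. smul (u m *\<^sub>C c l m) (Zp (Suc l) m)) =
      (\<Sum>m<M. \<Sum>l<M. smul (u m *\<^sub>C c l m) (Zp (Suc l) m))" by (rule sum.swap)
    also have "\<dots> = (\<Sum>m<M. \<Sum>l<M. smul (if l = 0 then 0 else u m *\<^sub>C c (l - 1) m) (Zp l m))"
      by (rule sum.cong[OF refl], rule sum_shift_up) (use M zero in auto)
    also have "\<dots> = (\<Sum>l<M. \<Sum>m<M. smul (if l = 0 then 0 else u m *\<^sub>C c (l - 1) m) (Zp l m))"
      by (rule sum.swap)
    also have "\<dots> = (\<Sum>l<M. \<Sum>m<M. smul (u m *\<^sub>C (if l = 0 then 0 else c (l - 1) m)) (Zp l m))"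
      by (intro sum.cong refl) simp
    finally show ?thesis .
  qed
  have "(\<Sum>l<M. \<Sum>m<M. smul (c l m) (A (femono l m * (gf * gk)) t - A (femono l m * (ge * gk)) t +
      smul (Y_coeff L) (A (femono l m * (gk ^ 2 - 1)) t))) =
    (\<Sum>l<M. \<Sum>m<M. smul (u m *\<^sub>C c l m) (Zp (Suc l) m)) + (\<Sum>l<M. \<Sum>m<M. smul (g m *\<^sub>C c l m) (Zp l (m - 1))) -
    (\<Sum>l<M. \<Sum>m<M. smul (h m *\<^sub>C c l m) (Zm l (m - 1))) - (\<Sum>l<M. \<Sum>m<M. smul (c l m) (Zp l (Suc m))) +
    (\<Sum>l<M. \<Sum>m<M. smul (Y_coeff L * c l m) (Zp l m)) - (\<Sum>l<M. \<Sum>m<M. smul (Y_coeff L * c l m) (Z0 l m))"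
    by (simp only: summand sum.distrib sum_subtractf)
  also have "(\<Sum>l<M. \<Sum>m<M. smul (u m *\<^sub>C c l m) (Zp (Suc l) m)) =
    (\<Sum>l<M. \<Sum>m<M. smul (u m *\<^sub>C (if l = 0 then 0 else c (l - 1) m)) (Zp l m))"
    by (rule shift_l)
  also have "(\<Sum>l<M. \<Sum>m<M. smul (g m *\<^sub>C c l m) (Zp l (m - 1))) =
    (\<Sum>l<M. \<Sum>m<M. smul (g (Suc m) *\<^sub>C c l (Suc m)) (Zp l m))"
    by (rule sum.cong[OF refl], rule sum_shift_down) (use zero' in \<open>simp_all add: gh0\<close>)
  also have "(\<Sum>l<M. \<Sum>m<M. smul (h m *\<^sub>C c l m) (Zm l (m - 1))) =
    (\<Sum>l<M. \<Sum>m<M. smul (h (Suc m) *\<^sub>C c l (Suc m)) (Zm l m))"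
    by (rule sum.cong[OF refl], rule sum_shift_down) (use zero' in \<open>simp_all add: gh0\<close>)
  also have "(\<Sum>l<M. \<Sum>m<M. smul (c l m) (Zp l (Suc m))) =
    (\<Sum>l<M. \<Sum>m<M. smul (if m = 0 then 0 else c l (m - 1)) (Zp l m))"
    by (rule sum.cong[OF refl], rule sum_shift_up) (use M zero in auto)
  \<comment> \<open>Collecting the terms with equal monomials leaves the left sides of the two
    recursions for \<open>x_coeff\<close>.\<close>
  also have "(\<Sum>l<M. \<Sum>m<M. smul (u m *\<^sub>C (if l = 0 then 0 else c (l - 1) m)) (Zp l m)) +
      (\<Sum>l<M. \<Sum>m<M. smul (g (Suc m) *\<^sub>C c l (Suc m)) (Zp l m)) -
      (\<Sum>l<M. \<Sum>m<M. smul (h (Suc m) *\<^sub>C c l (Suc m)) (Zm l m)) -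
      (\<Sum>l<M. \<Sum>m<M. smul (if m = 0 then 0 else c l (m - 1)) (Zp l m)) +
      (\<Sum>l<M. \<Sum>m<M. smul (Y_coeff L * c l m) (Zp l m)) - (\<Sum>l<M. \<Sum>m<M. smul (Y_coeff L * c l m) (Z0 l m)) =
    (\<Sum>l<M. \<Sum>m<M. smul (u m *\<^sub>C (if l = 0 then 0 else c (l - 1) m) + g (Suc m) *\<^sub>C c l (Suc m) -
        (if m = 0 then 0 else c l (m - 1)) + Y_coeff L * c l m) (Zp l m) +
      smul (- h (Suc m) *\<^sub>C c l (Suc m)) (Zm l m) - smul (Y_coeff L * c l m) (Z0 l m))"
    by (simp only: smul_simps(3,4) cvs.scale_minus_left smul_minus sum.distrib sum_subtractf
        sum_negf) (simp add: algebra_simps)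
  \<comment> \<open>Besides the two recursions, the coefficients of F^l E^m itself agree because
    \<open>Y_coeff\<close> is d_- + d_+.\<close>
  also have "\<dots> = (\<Sum>l<M. \<Sum>m<M. smul (c l m) (smul (dminus L) (A ((gk_inv ^ 2 - 1) * femono l m) t) +
      smul (dplus L) (A ((gk ^ 2 - 1) * femono l m) t)))"
    unfolding k2' kinv2' c_def u_def g_def h_def x_coeff_k2[OF q] x_coeff_kinv2[OF q]
    by (intro sum.cong refl)
      (simp add: smul_simps Y_coeff_eq algebra_simps mult_scaleC_right)
  finally show ?thesis by (simp only: c_def)
qed

text \<open>For a left action, x (Y t) = (x Y) t = (D x) t = D (x t).\<close>

lemma xop_Yop_left:
  assumes comp: "\<And>p r a. act (p * r) a = act p (act r a)" and t: "t \<in> AK L"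
  shows "xop (Yop t) = Dop (xop t)"
proof -
  obtain N1 N2 where "vanish N1 t" "vanish N2 (Yop t)" using AK_vanish[OF t] AK_vanish[OF Yop_AK[OF t]] by blast
  then have v: "vanish (max N1 N2) t" "vanish (max N1 N2) (Yop t)" by (auto intro: vanish_mono)
  have AA: "A p (A r s) = A (p * r) s" for p r s
    by (simp add: A_def Kmap_comp act_clinear flip: comp)
  let ?M = "Suc (max N1 N2)"
  have "xop (Yop t) = (\<Sum>l<?M. \<Sum>m<?M. smul (x_coeff L l m) (A (femono l m * (gf * gk)) t - A (femono l m * (ge * gk)) t +
      smul (Y_coeff L) (A (femono l m * (gk ^ 2 - 1)) t)))"
    unfolding xop_finite[OF v(2) le_SucI[OF order_refl]]
    by (simp only: Yop_def A.add A.diff A_smul AA)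
  also have "\<dots> = (\<Sum>l<?M. \<Sum>m<?M. smul (x_coeff L l m) (smul (dminus L) (A ((gk_inv ^ 2 - 1) * femono l m) t) +
      smul (dplus L) (A ((gk ^ 2 - 1) * femono l m) t)))"
    by (rule intertwining_sum[OF t v(1)]) simp
  also have "\<dots> = (\<Sum>l<?M. \<Sum>m<?M. Dop (smul (x_coeff L l m) (A (femono l m) t)))"
    by (simp only: Dop_def A_smul AA smul_simps mult.commute)
  also have "\<dots> = Dop (xop t)"
    unfolding xop_finite[OF v(1) le_SucI[OF order_refl]] Modules.module_hom.sum[OF module_hom_Dop] ..
  finally show ?thesis .
qed

text \<open>For a right action, (t x) Y = t (x Y) = t (D x) = (t D) x, so that \<open>Y\<close> and
  D change places.\<close>

lemma xop_Yop_right: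
  assumes comp: "\<And>p r a. act (p * r) a = act r (act p a)" and t: "t \<in> AK L"
  shows "Yop (xop t) = xop (Dop t)"
proof -
  obtain N1 N2 where "vanish N1 t" "vanish N2 (Dop t)" using AK_vanish[OF t] AK_vanish[OF Dop_AK[OF t]] by blast
  then have v: "vanish (max N1 N2) t" "vanish (max N1 N2) (Dop t)" by (auto intro: vanish_mono)
  have AA: "A r (A p s) = A (p * r) s" for p r s
    by (simp add: A_def Kmap_comp act_clinear flip: comp)
  let ?M = "Suc (max N1 N2)"
  have "Yop (xop t) = (\<Sum>l<?M. \<Sum>m<?M. Yop (smul (x_coeff L l m) (A (femono l m) t)))"
    unfolding xop_finite[OF v(1) le_SucI[OF order_refl]] Modules.module_hom.sum[OF module_hom_Yop] ..
  also have "\<dots> = (\<Sum>l<?M. \<Sum>m<?M. smul (x_coeff L l m) (A (femono l m * (gf * gk)) t - A (femono l m * (ge * gk)) t +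
      smul (Y_coeff L) (A (femono l m * (gk ^ 2 - 1)) t)))"
    by (simp only: Yop_def A_smul AA smul_simps mult.commute)
  also have "\<dots> = (\<Sum>l<?M. \<Sum>m<?M. smul (x_coeff L l m) (smul (dminus L) (A ((gk_inv ^ 2 - 1) * femono l m) t) +
      smul (dplus L) (A ((gk ^ 2 - 1) * femono l m) t)))"
    by (rule intertwining_sum[OF t v(1)]) simp
  also have "\<dots> = xop (Dop t)"
    unfolding xop_finite[OF v(2) le_SucI[OF order_refl]]
    by (simp only: Dop_def A.add A.diff A_smul AA)
  finally show ?thesis .
qed

text \<open>At \<open>q\<^sup>-\<^sup>\<lambda> = 0\<close> the matrix of \<open>x\<close> on a finite-dimensional invariant subspace is the identity, so its
  determinant is a nonzero rational function of \<open>q\<^sup>-\<^sup>\<lambda>\<close>.\<close>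

lemma xop_matrix:
  assumes "t \<in> AK L"
  obtains bs c and \<phi> :: "nat \<Rightarrow> functional \<Rightarrow> complex" and m w where "t = Kcomb bs c" "set bs \<subseteq> Aq L"
    "\<forall>i. clinear (\<phi> i)"
    "\<forall>i<length bs. \<forall>j<length bs. \<phi> i (bs ! j) = (if i = j then 1 else 0)"
    "\<forall>c. xop (Kcomb bs c) = Kcomb bs (\<lambda>i. \<Sum>j<length bs. \<iota> (m i j) * c j)"
    "\<forall>i<length bs. \<forall>j<length bs. (\<Sum>k<length bs. m i k * w k j) = (if i = j then 1 else 0)"
    "\<forall>i<length bs. \<forall>j<length bs. (\<Sum>k<length bs. w i k * m k j) = (if i = j then 1 else 0)"
proof -
  obtain S N where S: "lfin L act S N" and tS: "t \<in> base_change (cvs.span S)"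
    using AK_lfin[OF assms] by blast
  obtain bs \<phi> where bs: "distinct bs" "set bs \<subseteq> S" "cvs.span (set bs) = cvs.span S"
    and \<phi>: "\<And>i. clinear (\<phi> i)"
    "\<And>i j. i < length bs \<Longrightarrow> j < length bs \<Longrightarrow> \<phi> i (bs ! j) = (if i = j then 1 else 0 :: complex)"
    using finite_basis[of S] S unfolding lfin_def by metis
  let ?n = "length bs"
  let ?M = "Suc N"
  have bsA: "set bs \<subseteq> Aq L" using bs(2) S by (auto simp: lfin_def)
  obtain c where c: "t = Kcomb bs c"
    using base_change_Kcomb[OF \<phi>] tS bs(3) by metis
  \<comment> \<open>The matrix of x in the basis \<open>bs\<close>, with entries in F.\<close>
  define m where "m i j = (\<Sum>l<?M. \<Sum>k<?M. \<phi> i (act (femono l k) (bs ! j)) *\<^sub>C x_coeff L l k)" for i j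
  have act_bs: "act p (bs ! j) = (\<Sum>i<?n. \<phi> i (act p (bs ! j)) *\<^sub>C (bs ! i))" if "j < ?n" for p j
    by (rule span_dual_expansion[OF \<phi>]) (use nth_mem[OF that] bs(2,3) S in \<open>auto simp: lfin_def\<close>)
  have xop_basis: "xop (d \<otimes>\<^sub>C (bs ! j)) = (\<Sum>i<?n. (\<iota> (m i j) * d) \<otimes>\<^sub>C (bs ! i))" if j: "j < ?n" for d j
  proof -
    have "vanish N (d \<otimes>\<^sub>C (bs ! j))"
      by (rule vanish_span[OF S], rule base_change_tensor, rule cvs.span_base) (use j bs in auto)
    then have "xop (d \<otimes>\<^sub>C (bs ! j)) = (\<Sum>l<?M. \<Sum>k<?M. smul (x_coeff L l k) (d \<otimes>\<^sub>C act (femono l k) (bs ! j)))"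
      by (simp only: xop_finite[OF _ le_SucI[OF order_refl]] A_def Kmap_tensor[OF act_clinear])
    also have "\<dots> = (\<Sum>l<?M. \<Sum>k<?M. \<Sum>i<?n. (\<iota> (\<phi> i (act (femono l k) (bs ! j)) *\<^sub>C x_coeff L l k) * d) \<otimes>\<^sub>C (bs ! i))"
    proof (intro sum.cong refl)
      fix l k
      have "smul (x_coeff L l k) (d \<otimes>\<^sub>C act (femono l k) (bs ! j)) =
        smul (x_coeff L l k) (d \<otimes>\<^sub>C (\<Sum>i<?n. \<phi> i (act (femono l k) (bs ! j)) *\<^sub>C (bs ! i)))"
        using act_bs[OF j] by metis
      then show "smul (x_coeff L l k) (d \<otimes>\<^sub>C act (femono l k) (bs ! j)) =
        (\<Sum>i<?n. (\<iota> (\<phi> i (act (femono l k) (bs ! j)) *\<^sub>C x_coeff L l k) * d) \<otimes>\<^sub>C (bs ! i))"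
        by (simp add: tensor_sum_right smul_def K.scale_sum_right tensor_bil Kscale_scaleC_right
            Kscale_tensor \<iota>_scale mult_scaleC_left)
    qed
    also have "\<dots> = (\<Sum>i<?n. (\<iota> (m i j) * d) \<otimes>\<^sub>C (bs ! i))"
      unfolding m_def \<iota>.hom_sum sum_distrib_right tensor_sum_left
      by (rule trans[OF sum.cong[OF refl sum.swap] sum.swap])
    finally show ?thesis .
  qed
  have xop_sum: "xop (\<Sum>j\<in>J. f j) = (\<Sum>j\<in>J. xop (f j))" if "\<And>j. j \<in> J \<Longrightarrow> f j \<in> AK L" for J :: "nat set" and f
    using that
  proof (induction J rule: infinite_finite_induct)
    case (insert x J)
    have "xop (f x) = xop ((f x + sum f J) - sum f J)" by simp
    also have "\<dots> = xop (f x + sum f J) - xop (sum f J)"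
      using insert by (intro xop_diff base_change_add base_change_sum) auto
    finally show ?case using insert by simp
  qed (use xop_diff[OF base_change_zero base_change_zero] in simp_all)
  have xT: "xop (Kcomb bs c) = Kcomb bs (\<lambda>i. \<Sum>j<?n. \<iota> (m i j) * c j)" for c
  proof -
    have "xop (Kcomb bs c) = (\<Sum>j<?n. xop (c j \<otimes>\<^sub>C (bs ! j)))"
      unfolding Kcomb_def by (rule xop_sum) (use bsA in \<open>auto intro!: base_change_tensor\<close>)
    also have "\<dots> = (\<Sum>j<?n. \<Sum>i<?n. (\<iota> (m i j) * c j) \<otimes>\<^sub>C (bs ! i))"
      by (intro sum.cong refl xop_basis) simp
    also have "\<dots> = Kcomb bs (\<lambda>i. \<Sum>j<?n. \<iota> (m i j) * c j)"
      unfolding Kcomb_def tensor_sum_left by (rule sum.swap)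
    finally show ?thesis .
  qed
  \<comment> \<open>One denominator (t^2; q^2)_M serves all coefficients that occur in the
    matrix.\<close>
  have "\<exists>p. \<forall>l k. l \<le> ?M \<longrightarrow> tpoly L (poch_poly (exp L) ?M) * x_coeff L l k = tpoly L (p l k) \<and>
    poly (p l k) 0 = (if l = 0 \<and> k = 0 then 1 else 0)"
    using x_coeff_polynomial[OF L0, of _ ?M] by metis
  then obtain p where p: "\<And>l k. l \<le> ?M \<Longrightarrow> tpoly L (poch_poly (exp L) ?M) * x_coeff L l k = tpoly L (p l k)"
    "\<And>l k. l \<le> ?M \<Longrightarrow> poly (p l k) 0 = (if l = 0 \<and> k = 0 then 1 else 0)" by blast
  define P where "P i j = (\<Sum>l<?M. \<Sum>k<?M. Polynomial.smult (\<phi> i (act (femono l k) (bs ! j))) (p l k))" for i j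
  interpret T: comm_ring_hom "tpoly L" by (rule tpoly_hom)
  have 1: "tpoly L (poch_poly (exp L) ?M) * m i j = tpoly L (P i j)" for i j
    unfolding m_def P_def sum_distrib_left T.hom_sum
    by (intro sum.cong refl) (simp add: mult_scaleC_right p(1) tpoly_smult)
  have 2: "poly (P i j) 0 = (if i = j then 1 else 0)" if ij: "i < ?n" "j < ?n" for i j
  proof -
    \<comment> \<open>At t = 0 only the index (0, 0) survives, and its monomial acts as the
      identity.\<close>
    have "poly (P i j) 0 = (\<Sum>l<?M. \<Sum>k<?M. if k = 0 then (if l = 0 then \<phi> i (act (femono 0 0) (bs ! j)) else 0) else 0)"
      unfolding P_def poly_sum by (intro sum.cong refl) (auto simp: p(2))
    also have "\<dots> = \<phi> i (act 1 (bs ! j))" by (simp add: femono_def del: sum.lessThan_Suc)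
    also have "\<dots> = \<phi> i (bs ! j)" using act_one bsA ij nth_mem by (metis subsetD)
    finally show ?thesis using \<phi>(2) ij by simp
  qed
  obtain w where w: "\<forall>i<?n. \<forall>j<?n. (\<Sum>k<?n. m i k * w k j) = (if i = j then 1 else 0)"
    "\<forall>i<?n. \<forall>j<?n. (\<Sum>k<?n. w i k * m k j) = (if i = j then 1 else 0)"
    by (rule tpoly_matrix_inverse[OF L0 1 2])
  show ?thesis by (rule that[of bs c \<phi> m w, OF c bsA _ _ _ w]) (use \<phi> xT in auto)
qed

lemma Kcomb_cong: "(\<And>i. i < length bs \<Longrightarrow> c i = d i) \<Longrightarrow> Kcomb bs c = Kcomb bs d"
  unfolding Kcomb_def by (rule sum.cong) auto

text \<open>The inverse matrix is found over F; \<iota> carries the matrix identity to K, where the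
  coordinates live.\<close>

lemma matrix_apply_inverse:
  fixes n :: nat
  assumes "\<And>i j. i < n \<Longrightarrow> j < n \<Longrightarrow> (\<Sum>k<n. m i k * w k j) = (if i = j then 1 else 0)" "i < n"
  shows "(\<Sum>k<n. \<iota> (m i k) * (\<Sum>j<n. \<iota> (w k j) * c j)) = c i"
proof -
  have "(\<Sum>k<n. \<iota> (m i k) * (\<Sum>j<n. \<iota> (w k j) * c j)) = (\<Sum>j<n. \<iota> (\<Sum>k<n. m i k * w k j) * c j)"
    unfolding sum_distrib_left \<iota>.hom_sum sum_distrib_right
    by (subst sum.swap) (simp add: \<iota>.hom_mult mult.assoc)
  also have "\<dots> = (\<Sum>j<n. if j = i then c j else 0)"
    by (rule sum.cong) (auto simp: assms)
  also have "\<dots> = c i" using assms(2) by simp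
  finally show ?thesis .
qed

lemma xop_eq_0D:
  assumes "t \<in> AK L" "xop t = 0" shows "t = 0"
proof -
  obtain bs c and \<phi> :: "nat \<Rightarrow> functional \<Rightarrow> complex" and m w where *: "t = Kcomb bs c" "set bs \<subseteq> Aq L"
    "\<forall>i. clinear (\<phi> i)"
    "\<forall>i<length bs. \<forall>j<length bs. \<phi> i (bs ! j) = (if i = j then 1 else 0)"
    "\<forall>c. xop (Kcomb bs c) = Kcomb bs (\<lambda>i. \<Sum>j<length bs. \<iota> (m i j) * c j)"
    "\<forall>i<length bs. \<forall>j<length bs. (\<Sum>k<length bs. m i k * w k j) = (if i = j then 1 else 0)"
    "\<forall>i<length bs. \<forall>j<length bs. (\<Sum>k<length bs. w i k * m k j) = (if i = j then 1 else 0)"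
    by (rule xop_matrix[OF assms(1)])
  have "Kcomb bs (\<lambda>i. \<Sum>j<length bs. \<iota> (m i j) * c j) = 0"
    using assms(2) by (simp only: *(1) *(5)[rule_format])
  note z = Kcomb_eq_0D[OF *(3,4)[rule_format] this]
  have "c i = 0" if i: "i < length bs" for i
    using matrix_apply_inverse[where m = w and w = m and c = c, OF *(7)[rule_format] i] z by simp
  then show ?thesis by (simp add: *(1) Kcomb_def)
qed

lemma xop_inj: "inj_on xop (AK L)"
proof (rule inj_onI)
  fix s t assume st: "s \<in> AK L" "t \<in> AK L" "xop s = xop t"
  have "s + Kscale (- 1) t \<in> AK L" using st by (intro base_change_add base_change_Kscale)
  then have "s - t \<in> AK L" by simp
  then have "s - t = 0" by (rule xop_eq_0D) (use st xop_diff in simp)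
  then show "s = t" by simp
qed

lemma xop_surj:
  assumes "t \<in> AK L" shows "\<exists>s\<in>AK L. xop s = t"
proof -
  obtain bs c and \<phi> :: "nat \<Rightarrow> functional \<Rightarrow> complex" and m w where *: "t = Kcomb bs c" "set bs \<subseteq> Aq L"
    "\<forall>i. clinear (\<phi> i)"
    "\<forall>i<length bs. \<forall>j<length bs. \<phi> i (bs ! j) = (if i = j then 1 else 0)"
    "\<forall>c. xop (Kcomb bs c) = Kcomb bs (\<lambda>i. \<Sum>j<length bs. \<iota> (m i j) * c j)"
    "\<forall>i<length bs. \<forall>j<length bs. (\<Sum>k<length bs. m i k * w k j) = (if i = j then 1 else 0)"
    "\<forall>i<length bs. \<forall>j<length bs. (\<Sum>k<length bs. w i k * m k j) = (if i = j then 1 else 0)"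
    by (rule xop_matrix[OF assms])
  have "xop (Kcomb bs (\<lambda>k. \<Sum>j<length bs. \<iota> (w k j) * c j)) = t"
    unfolding *(1) *(5)[rule_format] by (rule Kcomb_cong) (rule matrix_apply_inverse[OF *(6)[rule_format]])
  moreover have "Kcomb bs d \<in> AK L" for d
    unfolding Kcomb_def by (intro base_change_sum base_change_tensor) (use *(2) in auto)
  ultimately show ?thesis by blast
qed

section \<open>Eigenvalues of D and the link to the given actions\<close>

lemma act_k2:
  assumes "a \<in> Aq L" "act gk a = \<kappa> *\<^sub>C a" "\<kappa> \<noteq> 0"
  shows "act (gk ^ 2) a = \<kappa> ^ 2 *\<^sub>C a" "act (gk_inv ^ 2) a = inverse (\<kappa> ^ 2) *\<^sub>C a"
proof -
  have sq: "act (p ^ 2) x = act p (act p x)" for p x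
    using act_mult by (auto simp: power2_eq_square)
  show "act (gk ^ 2) a = \<kappa> ^ 2 *\<^sub>C a"
    by (simp only: sq assms(2) cvs.linear_scale[OF act_clinear] scaleC_scaleC power2_eq_square[of \<kappa>])
  \<comment> \<open>For either order of composition one of the two relations gives that k^-1 undoes
    k on \<open>a\<close>.\<close>
  have "act (gk * gk_inv) a = a" "act (gk_inv * gk) a = a"
    using act_cong[OF qeq_basic(1)] act_cong[OF qeq_basic(2)] act_one[OF assms(1)] by simp_all
  then have "a = act gk_inv (act gk a)" using act_mult by auto
  then have "a = \<kappa> *\<^sub>C act gk_inv a"
    by (simp add: assms(2) cvs.linear_scale[OF act_clinear])
  then have "act gk_inv a = inverse \<kappa> *\<^sub>C a"
    using assms(3) by (metis left_inverse scaleC_one scaleC_scaleC)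
  then show "act (gk_inv ^ 2) a = inverse (\<kappa> ^ 2) *\<^sub>C a"
    by (simp only: sq cvs.linear_scale[OF act_clinear] scaleC_scaleC power2_eq_square[of \<kappa>]
        inverse_mult_distrib)
qed

lemma Dop_weight:
  assumes a: "a \<in> Aq L" "act gk a = qpow L (of_int \<beta> / 2) *\<^sub>C a"
  shows "Dop (c \<otimes>\<^sub>C a) = (\<iota> (nu L \<beta>) * c) \<otimes>\<^sub>C a"
proof -
  have nz: "qpow L (of_int \<beta> / 2) \<noteq> 0" by (simp add: qpow_def)
  have sq: "qpow L (of_int \<beta> / 2) ^ 2 = qpow L (of_int \<beta>)" "inverse (qpow L (of_int \<beta>)) = qpow L (- of_int \<beta>)"
    by (simp_all add: qpow_def exp_minus flip: exp_of_nat_mult)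
  have t: "c \<otimes>\<^sub>C a \<in> AK L" by (rule base_change_tensor[OF a(1)])
  note k2 = act_k2[OF a nz, unfolded sq]
  have "A (gk ^ 2) (c \<otimes>\<^sub>C a) = qpow L (of_int \<beta>) *\<^sub>C (c \<otimes>\<^sub>C a)"
    "A (gk_inv ^ 2) (c \<otimes>\<^sub>C a) = qpow L (- of_int \<beta>) *\<^sub>C (c \<otimes>\<^sub>C a)"
    by (simp_all add: A_def Kmap_tensor[OF act_clinear] k2 tensor_bil)
  then have "Dop (c \<otimes>\<^sub>C a) = smul (nu L \<beta>) (c \<otimes>\<^sub>C a)"
    unfolding Dop_def A_minus[OF t] A_one[OF t]
    by (simp add: smul_simps nu_eq cvs.scale_left_diff_distrib scaleC_one)
  then show ?thesis by (simp add: smul_def Kscale_tensor)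
qed

lemma Kact_AK: "t \<in> AK L \<Longrightarrow> Kact act (c \<otimes>\<^sub>C p) t = Kscale c (A p t)"
  unfolding A_def by (rule Kact_tensor[OF act_clinear act_add act_scale])

lemma Kact_Y: "t \<in> AK L \<Longrightarrow> Kact act (Y L \<iota>) t = Yop t"
  by (simp add: Y_def Kact_add Kact_diff Kact_AK Yop_def smul_def)

lemma Kact_x: "t \<in> AK L \<Longrightarrow> Sum_any (\<lambda>i. Kact act (x_term L \<iota> i) t) = xop t"
  unfolding xop_def x_term_def by (simp add: Kact_AK case_prod_unfold smul_def femono_def)

end

section \<open>The regular actions on the quantized function algebra\<close>

lemma (in type1) R_add: "R (p + r) = R p + R r"
  using ring_hom_add[OF hom, of "Uq_class (exp L) p" "Uq_class (exp L) r"]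
  by (simp add: R_def ring_mat_def Uq_class_add)

lemma smult_mult_mat_vec:
  fixes M :: "complex mat"
  assumes "M \<in> carrier_mat n n" "v \<in> carrier_vec n"
  shows "(c \<cdot>\<^sub>m M) *\<^sub>v v = c \<cdot>\<^sub>v (M *\<^sub>v v)"
  using assms by (intro eq_vecI) (auto simp: scalar_prod_def sum_distrib_left mult.assoc)

text \<open>Functionals are arbitrary functions on cosets; those in \<open>Aq L\<close> are linear
  because matrix coefficients are, and this makes both actions linear in the acting element.\<close>

lemma Aq_additive:
  assumes "a \<in> Aq L"
  shows "a (Uq_class (exp L) (p + r)) = a (Uq_class (exp L) p) + a (Uq_class (exp L) r)"
    "a (Uq_class (exp L) (c *\<^sub>C p)) = c * a (Uq_class (exp L) p)"
    "u \<notin> carrier (Uq (exp L)) \<Longrightarrow> a u = 0"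
proof -
  have "(\<forall>p r c. a (Uq_class (exp L) (p + r)) = a (Uq_class (exp L) p) + a (Uq_class (exp L) r) \<and>
    a (Uq_class (exp L) (c *\<^sub>C p)) = c * a (Uq_class (exp L) p)) \<and> (\<forall>u. u \<notin> carrier (Uq (exp L)) \<longrightarrow> a u = 0)"
    using assms unfolding Aq_def
  proof (induction rule: cvs.span_induct_alt)
    case base
    show ?case by simp
  next
    case (step d x y)
    then obtain n \<rho> \<phi> v where x: "x = matrix_coeff L \<rho> \<phi> v" and
      *: "type1_rep L n \<rho>" "\<phi> \<in> carrier_vec n" "v \<in> carrier_vec n" by blast
    interpret type1 L n \<rho> using *(1) by unfold_locales
    have x: "x = mc \<phi> v" by (simp add: x mc_def)
    show ?case using step.IH *
      by (simp add: scaleC_fun_def scaleC_complex_def x mc_Uq_class mc_outside R_add R_scale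
          add_mult_distrib_mat_vec[OF R_carrier R_carrier] scalar_prod_add_distrib[of _ n]
          mult_mat_vec_carrier[OF R_carrier] smult_mult_mat_vec[OF R_carrier] algebra_simps)
  qed
  then show "a (Uq_class (exp L) (p + r)) = a (Uq_class (exp L) p) + a (Uq_class (exp L) r)"
    "a (Uq_class (exp L) (c *\<^sub>C p)) = c * a (Uq_class (exp L) p)"
    "u \<notin> carrier (Uq (exp L)) \<Longrightarrow> a u = 0" by blast+
qed

lemma comm_ring_hom_lam: "comm_ring_hom lam"
  by unfold_locales (simp_all add: lam_def one_tensor_def tensor_bil tensor_times_tensor)

lemma comm_ring_hom_mu: "comm_ring_hom mu"
  by unfold_locales (simp_all add: mu_def one_tensor_def tensor_bil tensor_times_tensor)

lemma clinear_lreg: "clinear (lreg L u)"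
  by (auto simp: clinear_iff lreg_def fun_eq_iff scaleC_fun_def scaleC_complex_def)

lemma clinear_rreg: "clinear (\<lambda>a. rreg L a u)"
  by (auto simp: clinear_iff rreg_def fun_eq_iff scaleC_fun_def scaleC_complex_def)

lemma lreg_apply: "lreg L (Uq_class (exp L) p) a (Uq_class (exp L) r) = a (Uq_class (exp L) (r * p))"
  by (simp add: lreg_def Uq_class_mult)

lemma rreg_apply: "rreg L a (Uq_class (exp L) p) (Uq_class (exp L) r) = a (Uq_class (exp L) (p * r))"
  by (simp add: rreg_def Uq_class_mult)

lemma reg_outside:
  assumes "u \<notin> carrier (Uq (exp L))" shows "lreg L v a u = 0" "rreg L a v u = 0"
  using assms by (simp_all add: lreg_def rreg_def)

lemma regular_action_left:
  assumes q: "\<forall>n>0. exp L ^ n \<noteq> 1"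
  shows "regular_action L (\<lambda>p. lreg L (Uq_class (exp L) p)) mu"
proof (rule regular_action.intro[OF q clinear_lreg])
  show "\<exists>S N. lfin L (\<lambda>p. lreg L (Uq_class (exp L) p)) S N \<and> a \<in> cvs.span S" if "a \<in> Aq L" for a
    by (rule Aq_lfin[OF _ that]) (use type1.lfin_lreg[OF type1.intro] q in blast)
  show "mu (c *\<^sub>C f) = c *\<^sub>C mu f" for c f by (simp add: mu_def tensor_bil)
  show "comm_ring_hom mu" by (rule comm_ring_hom_mu)
qed (auto intro!: functional_eqI[where L = L] simp: lreg_apply reg_outside qeq_def distrib_left mult_scaleC_right
    Aq_additive scaleC_fun_def scaleC_complex_def mult.assoc)

lemma regular_action_right:
  assumes q: "\<forall>n>0. exp L ^ n \<noteq> 1"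
  shows "regular_action L (\<lambda>p a. rreg L a (Uq_class (exp L) p)) lam"
proof (rule regular_action.intro[OF q clinear_rreg])
  show "\<exists>S N. lfin L (\<lambda>p a. rreg L a (Uq_class (exp L) p)) S N \<and> a \<in> cvs.span S" if "a \<in> Aq L" for a
    by (rule Aq_lfin[OF _ that]) (use type1.lfin_rreg[OF type1.intro] q in blast)
  show "lam (c *\<^sub>C f) = c *\<^sub>C lam f" for c f by (simp add: lam_def tensor_bil)
  show "comm_ring_hom lam" by (rule comm_ring_hom_lam)
qed (auto intro!: functional_eqI[where L = L] simp: rreg_apply reg_outside qeq_def distrib_right mult_scaleC_left
    Aq_additive scaleC_fun_def scaleC_complex_def mult.assoc)

lemma lreg_mult:
  "lreg L (Uq_class (exp L) (p * r)) a = lreg L (Uq_class (exp L) p) (lreg L (Uq_class (exp L) r) a)"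
  by (rule functional_eqI[where L = L]) (simp_all add: lreg_apply reg_outside mult.assoc)

lemma rreg_mult:
  "rreg L a (Uq_class (exp L) (p * r)) = rreg L (rreg L a (Uq_class (exp L) p)) (Uq_class (exp L) r)"
  by (rule functional_eqI[where L = L]) (simp_all add: rreg_apply reg_outside mult.assoc)

lemma lreg_rreg_commute:
  "lreg L (Uq_class (exp L) p) (rreg L a (Uq_class (exp L) r)) =
   rreg L (lreg L (Uq_class (exp L) p) a) (Uq_class (exp L) r)"
  by (rule functional_eqI[where L = L]) (simp_all add: lreg_apply rreg_apply reg_outside mult.assoc)

lemma Kcomb_inject:
  assumes \<phi>: "\<And>i. clinear (\<phi> i)"
    "\<And>i j. i < length bs \<Longrightarrow> j < length bs \<Longrightarrow> \<phi> i (bs ! j) = (if i = j then 1 else 0 :: complex)"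
    and "Kcomb bs c = Kcomb bs d" and i: "i < length bs"
  shows "c i = d i"
proof -
  have "(a - b) \<otimes>\<^sub>C v = a \<otimes>\<^sub>C v - b \<otimes>\<^sub>C v" for a b :: K and v :: functional
    using tensor_bil(1)[of "a - b" b v] by simp
  then have "Kcomb bs (\<lambda>i. c i - d i) = 0"
    using assms(3) by (simp add: Kcomb_def sum_subtractf)
  from Kcomb_eq_0D[OF \<phi> this i] show ?thesis by simp
qed

lemma Kscale_Kcomb: "Kscale k (Kcomb bs c) = Kcomb bs (\<lambda>j. k * c j)"
  by (simp add: Kcomb_def K.scale_sum_right Kscale_tensor)

section \<open>Weight spaces and joint eigenspaces\<close>

context
  fixes L :: complex
  assumes q: "\<forall>n>0. exp L ^ n \<noteq> 1"
begin

interpretation l: regular_action L "\<lambda>p. lreg L (Uq_class (exp L) p)" mu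
  by (rule regular_action_left[OF q])

interpretation r: regular_action L "\<lambda>p a. rreg L a (Uq_class (exp L) p)" lam
  by (rule regular_action_right[OF q])

text \<open>By associativity of the enveloping algebra. It lets x, \<open>Y\<close> and D of one
  side be moved past those of the other.\<close>

lemma A_commute: "l.A p (r.A s t) = r.A s (l.A p t)"
  unfolding l.A_def r.A_def by (simp add: Kmap_comp clinear_lreg clinear_rreg lreg_rreg_commute)

lemma A_Yop_commute: "r.A p (l.Yop t) = l.Yop (r.A p t)"
  by (simp add: l.Yop_def r.A.add r.A.diff r.A.scale l.smul_def A_commute)

lemma A_Dop_commute: "l.A p (r.Dop t) = r.Dop (l.A p t)"
  by (simp add: r.Dop_def l.A.add l.A.diff l.A.scale r.smul_def A_commute)

text \<open>Weight vectors span \<open>Aq L\<close>, and a basis selected from finitely many of them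
  again consists of weight vectors.\<close>

lemma weight_decomposition:
  assumes "t \<in> AK L"
  obtains bs c and \<phi> :: "nat \<Rightarrow> functional \<Rightarrow> complex" where "t = Kcomb bs c"
    "set bs \<subseteq> (\<Union>(\<alpha>, \<beta>). Aq_weight L \<alpha> \<beta>)" "\<forall>i. clinear (\<phi> i)"
    "\<forall>i<length bs. \<forall>j<length bs. \<phi> i (bs ! j) = (if i = j then 1 else 0)"
proof -
  obtain S where S: "finite S" "S \<subseteq> (\<Union>(\<alpha>, \<beta>). Aq_weight L \<alpha> \<beta>)" "t \<in> base_change (cvs.span S)"
    using base_change_finite[OF Aq_span_weights assms] by blast
  show ?thesis
  proof (rule finite_basis[OF S(1)])
    fix bs and \<phi> :: "nat \<Rightarrow> functional \<Rightarrow> complex"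
    assume bs: "distinct bs" "set bs \<subseteq> S" "cvs.span (set bs) = cvs.span S"
      and \<phi>: "\<And>i. clinear (\<phi> i)"
      "\<And>i j. i < length bs \<Longrightarrow> j < length bs \<Longrightarrow> \<phi> i (bs ! j) = (if i = j then 1 else 0 :: complex)"
    have "t \<in> base_change (cvs.span (set bs))" using S(3) bs(3) by simp
    then obtain c where "t = Kcomb bs c" using base_change_Kcomb[OF \<phi>] by blast
    then show ?thesis using that[of bs c \<phi>] bs(2) S(2) \<phi> by blast
  qed
qed

text \<open>For the converse, D is diagonal in a basis of weight vectors. Comparing coordinates,
  each of the two conditions multiplies c_j by a difference of two values of \<nu>, which removes
  every coordinate whose weight is not (\<alpha>, \<beta>).\<close>

lemma AK_weight_iff:
  "t \<in> AK_weight L \<alpha> \<beta> \<longleftrightarrow>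
    t \<in> AK L \<and> l.Dop t = Kscale (mu (nu L \<beta>)) t \<and> r.Dop t = Kscale (lam (nu L \<alpha>)) t"
proof
  assume t: "t \<in> AK_weight L \<alpha> \<beta>"
  have "AK_weight L \<alpha> \<beta> \<subseteq> AK L"
    by (rule base_change_mono) (auto simp: Aq_weight_def)
  moreover have "l.Dop t = Kscale (mu (nu L \<beta>)) t \<and> r.Dop t = Kscale (lam (nu L \<alpha>)) t"
    using t
  proof (induction t rule: base_change_induct)
    case zero
    show ?case by (simp add: Modules.module_hom.zero[OF l.module_hom_Dop] Modules.module_hom.zero[OF r.module_hom_Dop])
  next
    case (tensor c a)
    then show ?case by (simp add: Aq_weight_def l.Dop_weight r.Dop_weight Kscale_tensor)
  next
    case (add s t)
    then show ?case
      by (simp add: Modules.module_hom.add[OF l.module_hom_Dop] Modules.module_hom.add[OF r.module_hom_Dop]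
          Kscale_add)
  qed
  ultimately show "t \<in> AK L \<and> l.Dop t = Kscale (mu (nu L \<beta>)) t \<and> r.Dop t = Kscale (lam (nu L \<alpha>)) t"
    using t by blast
next
  assume t: "t \<in> AK L \<and> l.Dop t = Kscale (mu (nu L \<beta>)) t \<and> r.Dop t = Kscale (lam (nu L \<alpha>)) t"
  then obtain bs c and \<phi> :: "nat \<Rightarrow> functional \<Rightarrow> complex" where tc: "t = Kcomb bs c"
    and bs: "set bs \<subseteq> (\<Union>(\<alpha>, \<beta>). Aq_weight L \<alpha> \<beta>)" and \<phi>: "\<forall>i. clinear (\<phi> i)"
    "\<forall>i<length bs. \<forall>j<length bs. \<phi> i (bs ! j) = (if i = j then 1 else 0)"
    using weight_decomposition by metis
  have "\<exists>a b. bs ! j \<in> Aq_weight L a b" if "j < length bs" for j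
  proof -
    have "bs ! j \<in> (\<Union>(\<alpha>, \<beta>). Aq_weight L \<alpha> \<beta>)" using bs nth_mem[OF that] by blast
    then show ?thesis by auto
  qed
  then obtain a b where ab: "\<And>j. j < length bs \<Longrightarrow> bs ! j \<in> Aq_weight L (a j) (b j)" by metis
  \<comment> \<open>The difference is inverted in the field F; its image under \<iota> is then a
    unit of K.\<close>
  have zero: "c j = 0"
    if "comm_ring_hom \<iota>" "\<iota> (nu L m) * c j = \<iota> (nu L n) * c j" "m \<noteq> n" for \<iota> :: "mero \<Rightarrow> K" and m n j
  proof -
    interpret \<iota>: comm_ring_hom \<iota> by (rule that)
    have nz: "nu L m - nu L n \<noteq> 0" using nu_diff_nonzero[OF q that(3)] .
    have "\<iota> (nu L m - nu L n) * c j = 0" using that(2) by (simp add: \<iota>.hom_minus left_diff_distrib)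
    then have "\<iota> (inverse (nu L m - nu L n) * (nu L m - nu L n)) * c j = 0"
      by (simp add: \<iota>.hom_mult mult.assoc del: left_inverse)
    then show ?thesis using nz by simp
  qed
  have left_eq: "Kcomb bs (\<lambda>j. mu (nu L (b j)) * c j) = Kcomb bs (\<lambda>j. mu (nu L \<beta>) * c j)"
  proof -
    have "l.Dop (Kcomb bs c) = Kcomb bs (\<lambda>j. mu (nu L (b j)) * c j)"
      unfolding Kcomb_def Modules.module_hom.sum[OF l.module_hom_Dop]
      by (rule sum.cong[OF refl], rule l.Dop_weight) (use ab in \<open>auto simp: Aq_weight_def\<close>)
    then show ?thesis using t by (simp add: tc Kscale_Kcomb)
  qed
  have left: "mu (nu L (b j)) * c j = mu (nu L \<beta>) * c j" if "j < length bs" for j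
    by (rule Kcomb_inject[where \<phi> = \<phi>, OF _ _ left_eq that]) (use \<phi> in simp_all)
  have right_eq: "Kcomb bs (\<lambda>j. lam (nu L (a j)) * c j) = Kcomb bs (\<lambda>j. lam (nu L \<alpha>) * c j)"
  proof -
    have "r.Dop (Kcomb bs c) = Kcomb bs (\<lambda>j. lam (nu L (a j)) * c j)"
      unfolding Kcomb_def Modules.module_hom.sum[OF r.module_hom_Dop]
      by (rule sum.cong[OF refl], rule r.Dop_weight) (use ab in \<open>auto simp: Aq_weight_def\<close>)
    then show ?thesis using t by (simp add: tc Kscale_Kcomb)
  qed
  have right: "lam (nu L (a j)) * c j = lam (nu L \<alpha>) * c j" if "j < length bs" for j
    by (rule Kcomb_inject[where \<phi> = \<phi>, OF _ _ right_eq that]) (use \<phi> in simp_all)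
  have "c j \<otimes>\<^sub>C (bs ! j) \<in> AK_weight L \<alpha> \<beta>" if j: "j < length bs" for j
  proof (cases "a j = \<alpha> \<and> b j = \<beta>")
    case True
    then show ?thesis using ab[OF j] by (auto intro: base_change_tensor)
  next
    case False
    then have "c j = 0"
      using zero[OF comm_ring_hom_mu left[OF j]] zero[OF comm_ring_hom_lam right[OF j]] by blast
    then show ?thesis by (simp add: base_change_zero)
  qed
  then show "t \<in> AK_weight L \<alpha> \<beta>"
    unfolding tc Kcomb_def by (intro base_change_sum) simp
qed

lemma lact_Y: "t \<in> AK L \<Longrightarrow> lact L (Y L mu) t = l.Yop t"
  using l.Kact_Y[of t] by (simp add: lact_def Kact_def)

lemma ract_Y: "t \<in> AK L \<Longrightarrow> ract L t (Y L lam) = r.Yop t"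
  using r.Kact_Y[of t] by (simp add: ract_def Kact_def)

lemma x_left_eq: "t \<in> AK L \<Longrightarrow> x_left L mu t = l.xop t"
  using l.Kact_x[of t] by (simp add: x_left_def lact_def Kact_def)

lemma x_right_eq: "t \<in> AK L \<Longrightarrow> x_right L t lam = r.xop t"
  using r.Kact_x[of t] by (simp add: x_right_def ract_def Kact_def)

text \<open>Each a is written as s x(\<lambda>), and b = x(\<mu>) s is the vector from which
  \<open>Ax\<close> produces it. The left condition on a passes to s through the right action of x,
  and x(\<mu>) then turns \<open>Y\<close> into D. The right condition becomes one on s under D,
  which x(\<mu>) preserves. Injectivity of both actions makes each passage an equivalence, so
  together they say that b has weight (\<alpha>, \<beta>).\<close>

lemma Ax_eq:
  "Ax L \<alpha> \<beta> = {a \<in> AK L. l.Yop a = Kscale (mu (nu L \<beta>)) a \<and> r.Yop a = Kscale (lam (nu L \<alpha>)) a}"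
proof -
  note YL = l.xop_Yop_left[OF lreg_mult] and YR = r.xop_Yop_right[OF rreg_mult]
  have key: "l.Yop (r.xop s) = Kscale (mu (nu L \<beta>)) (r.xop s) \<and> r.Yop (r.xop s) = Kscale (lam (nu L \<alpha>)) (r.xop s)
    \<longleftrightarrow> l.xop s \<in> AK_weight L \<alpha> \<beta>" if s: "s \<in> AK L" for s
  proof -
    have "l.Yop (r.xop s) = Kscale (mu (nu L \<beta>)) (r.xop s) \<longleftrightarrow>
      r.xop (l.Yop s) = r.xop (Kscale (mu (nu L \<beta>)) s)"
      by (simp add: r.xop_hom[OF l.module_hom_Yop A_Yop_commute s] r.xop_Kscale s)
    also have "\<dots> \<longleftrightarrow> l.Yop s = Kscale (mu (nu L \<beta>)) s"
      by (intro inj_on_eq_iff[OF r.xop_inj] l.Yop_AK base_change_Kscale s)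
    also have "\<dots> \<longleftrightarrow> l.xop (l.Yop s) = l.xop (Kscale (mu (nu L \<beta>)) s)"
      by (intro inj_on_eq_iff[OF l.xop_inj, symmetric] l.Yop_AK base_change_Kscale s)
    also have "\<dots> \<longleftrightarrow> l.Dop (l.xop s) = Kscale (mu (nu L \<beta>)) (l.xop s)"
      by (simp add: YL l.xop_Kscale s)
    finally have 1: "l.Yop (r.xop s) = Kscale (mu (nu L \<beta>)) (r.xop s) \<longleftrightarrow>
      l.Dop (l.xop s) = Kscale (mu (nu L \<beta>)) (l.xop s)" .
    have "r.Yop (r.xop s) = Kscale (lam (nu L \<alpha>)) (r.xop s) \<longleftrightarrow>
      r.xop (r.Dop s) = r.xop (Kscale (lam (nu L \<alpha>)) s)"
      by (simp add: YR r.xop_Kscale s)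
    also have "\<dots> \<longleftrightarrow> r.Dop s = Kscale (lam (nu L \<alpha>)) s"
      by (intro inj_on_eq_iff[OF r.xop_inj] r.Dop_AK base_change_Kscale s)
    also have "\<dots> \<longleftrightarrow> l.xop (r.Dop s) = l.xop (Kscale (lam (nu L \<alpha>)) s)"
      by (intro inj_on_eq_iff[OF l.xop_inj, symmetric] r.Dop_AK base_change_Kscale s)
    also have "\<dots> \<longleftrightarrow> r.Dop (l.xop s) = Kscale (lam (nu L \<alpha>)) (l.xop s)"
      by (simp add: l.xop_hom[OF r.module_hom_Dop A_Dop_commute s] l.xop_Kscale s)
    finally show ?thesis using 1 l.xop_AK[OF s] by (simp add: AK_weight_iff)
  qed
  \<comment> \<open>\<open>inv_into\<close> refers to \<open>x_left\<close>, which is known to agree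
    with \<open>xop\<close> on \<open>AK L\<close>; surjectivity there places the chosen preimage in
    \<open>AK L\<close>.\<close>
  have bij: "inv_into (AK L) (x_left L mu) b \<in> AK L"
    "l.xop (inv_into (AK L) (x_left L mu) b) = b" if "b \<in> AK L" for b
  proof -
    have "b \<in> x_left L mu ` AK L" using l.xop_surj[OF that] x_left_eq by force
    then show 1: "inv_into (AK L) (x_left L mu) b \<in> AK L" by (rule inv_into_into)
    show "l.xop (inv_into (AK L) (x_left L mu) b) = b"
      using f_inv_into_f[OF \<open>b \<in> x_left L mu ` AK L\<close>] x_left_eq[OF 1] by simp
  qed
  have weight_AK: "b \<in> AK L" if "b \<in> AK_weight L \<alpha> \<beta>" for b
    using that AK_weight_iff by blast
  show ?thesis
  proof (intro equalityI subsetI)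
    fix a assume "a \<in> Ax L \<alpha> \<beta>"
    then obtain b where b: "b \<in> AK_weight L \<alpha> \<beta>" "a = x_right L (x_inv_left L mu b) lam"
      by (auto simp: Ax_def)
    define s where "s = inv_into (AK L) (x_left L mu) b"
    have s: "s \<in> AK L" "l.xop s = b" using bij[OF weight_AK[OF b(1)]] by (simp_all add: s_def)
    have "a = r.xop s" using b(2) x_right_eq[OF s(1)] by (simp add: x_inv_left_def s_def)
    then show "a \<in> {a \<in> AK L. l.Yop a = Kscale (mu (nu L \<beta>)) a \<and> r.Yop a = Kscale (lam (nu L \<alpha>)) a}"
      using key[OF s(1)] b(1) s r.xop_AK by simp
  next
    fix a assume a: "a \<in> {a \<in> AK L. l.Yop a = Kscale (mu (nu L \<beta>)) a \<and> r.Yop a = Kscale (lam (nu L \<alpha>)) a}"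
    then obtain s where s: "s \<in> AK L" "r.xop s = a" using r.xop_surj by blast
    then have w: "l.xop s \<in> AK_weight L \<alpha> \<beta>" using key a by blast
    \<comment> \<open>Injectivity identifies the chosen preimage with s.\<close>
    have "x_inv_left L mu (l.xop s) = s"
      unfolding x_inv_left_def using bij[OF weight_AK[OF w]] inj_onD[OF l.xop_inj] s(1) by blast
    then have "a = x_right L (x_inv_left L mu (l.xop s)) lam" using s x_right_eq by simp
    then show "a \<in> Ax L \<alpha> \<beta>" unfolding Ax_def using w by blast
  qed
qed

end

theorem proposition4p1:
  fixes q L :: complex and \<alpha> \<beta> :: int
  assumes "q \<noteq> 0" and "\<forall>n>0. q ^ n \<noteq> 1" and "exp L = q"
  shows "Ax L \<alpha> \<beta> =
    {a \<in> AK L. lact L (Y L mu) a = Kscale (mu (nu L \<beta>)) a \<and>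
      ract L a (Y L lam) = Kscale (lam (nu L \<alpha>)) a}"
proof -
  have q: "\<forall>n>0. exp L ^ n \<noteq> 1" using assms by simp
  show ?thesis
    unfolding Ax_eq[OF q] by (auto simp: lact_Y[OF q] ract_Y[OF q])
qed

end
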